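(* Let $n\ge 2$. There exist constants $c, c_0, C_0, C>0$, independent of $\kappa$ and $j$, such that for every $\kappa\ge 1$ the singular values $\sigma_j(A_\kappa)$, $j\ge 1$, of the operator $A_\kappa : L^2(\mathbb{S}^{n-1})\to L^2(B_1)$ satisfy $$ C^{-1}\le \sigma_j(A_\kappa)\le C \quad\text{for all integers } 1\le j\le c_0\kappa^{n-1}, $$ $$ \sigma_j(A_\kappa)\le C\exp\left(-c\,\kappa^{-1}j^{\frac{1}{n-1}}\right)\quad\text{for all integers } j\ge C_0\kappa^{n-1}. $$
   Context: $B_1$ is the open unit ball in $\mathbb{R}^n$ and $\mathrm{d}S$ is the surface measure on the unit sphere $\mathbb{S}^{n-1}$. For $f\in L^2(\mathbb{S}^{n-1})$ and $\kappa>0$, the Herglotz wave function is $(P_\kappa f)(x)=\int_{\mathbb{S}^{n-1}}e^{\mathbf{i}\kappa\omega\cdot x}f(\omega)\,\mathrm{d}S(\omega)$, $x\in\mathbb{R}^n$. The operator $A_\kappa:L^2(\mathbb{S}^{n-1})\to L^2(B_1)$ is defined by $A_\kappa f=\kappa^{\frac{n-1}{2}}\,(P_\kappa f)|_{B_1}$. It is compact and injective, and its singular values are listed in nonincreasing order with multiplicity, $\sigma_1\ge\sigma_2\ge\cdots\to 0$. *)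

theory Defs
  imports "HOL-Analysis.Analysis"
begin

text \<open>
  Surface measure on the unit sphere, in the polar-coordinate normalisation: the measure of
  \<open>E\<close> is \<open>n\<close> times the Lebesgue measure of the cone \<open>{r \<omega> | 0 < r < 1, \<omega> \<in> E}\<close>.
  The origin is removed from the ball so that the radial projection maps into the sphere.
\<close>

definition surface_measure :: "(real ^ 'n) measure" where
  "surface_measure =
     scale_measure (of_nat CARD('n))
       (distr (restrict_space lborel (ball 0 1 - {0})) (restrict_space borel (sphere 0 1))
          (\<lambda>x. x /\<^sub>R norm x))"

lemma measurable_radial_projection:
  "(\<lambda>x :: real ^ 'n. x /\<^sub>R norm x)
     \<in> restrict_space lborel (ball 0 1 - {0}) \<rightarrow>\<^sub>M restrict_space borel (sphere 0 1)"
proof (rule measurable_restrict_space2)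
  show "(\<lambda>x :: real ^ 'n. x /\<^sub>R norm x) \<in> space (restrict_space lborel (ball 0 1 - {0})) \<rightarrow> sphere 0 1"
    by (auto simp: space_restrict_space)
  show "(\<lambda>x :: real ^ 'n. x /\<^sub>R norm x) \<in> restrict_space lborel (ball 0 1 - {0}) \<rightarrow>\<^sub>M borel"
    by (rule measurable_restrict_space1) simp
qed

lemma emeasure_surface_measure:
  fixes E :: "(real ^ 'n) set"
  assumes "E \<in> sets borel" "E \<subseteq> sphere 0 1"
  shows "emeasure surface_measure E =
           of_nat CARD('n) * emeasure lborel {x. 0 < norm x \<and> norm x < 1 \<and> x /\<^sub>R norm x \<in> E}"
proof -
  have E: "E \<in> sets (restrict_space borel (sphere 0 1))"
    using assms by (auto simp: sets_restrict_space)
  have eq: "(\<lambda>x. x /\<^sub>R norm x) -` E \<inter> space (restrict_space lborel (ball 0 1 - {0}))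
      = {x. 0 < norm x \<and> norm x < 1 \<and> x /\<^sub>R norm x \<in> E}"
    by (auto simp: space_restrict_space)
  show ?thesis
    unfolding surface_measure_def
    by (simp only: emeasure_scale_measure emeasure_distr[OF measurable_radial_projection E] eq)
       (subst emeasure_restrict_space; auto)
qed

text \<open>
  \<open>L\<^sup>2\<close> is represented by square-integrable functions rather than equivalence classes;
  accordingly equalities and linear independence below are taken modulo null sets.
\<close>

definition L2_space :: "'a measure \<Rightarrow> ('a \<Rightarrow> complex) set" where
  "L2_space M = {f \<in> borel_measurable M. integrable M (\<lambda>x. (cmod (f x))\<^sup>2)}"

definition L2_inner :: "'a measure \<Rightarrow> ('a \<Rightarrow> complex) \<Rightarrow> ('a \<Rightarrow> complex) \<Rightarrow> complex" where
  "L2_inner M f g = (LINT x|M. f x * cnj (g x))"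

definition L2_independent :: "'a measure \<Rightarrow> nat \<Rightarrow> (nat \<Rightarrow> 'a \<Rightarrow> complex) \<Rightarrow> bool" where
  "L2_independent M k f \<longleftrightarrow>
     (\<forall>c :: nat \<Rightarrow> complex. (AE x in M. (\<Sum>i<k. c i * f i x) = 0) \<longrightarrow> (\<forall>i<k. c i = 0))"

text \<open>
  The Hilbert space adjoint of a bounded operator \<open>T : L\<^sup>2(M) \<rightarrow> L\<^sup>2(N)\<close>; the chosen
  value is unique up to a null set.
\<close>

definition L2_adjoint ::
  "'a measure \<Rightarrow> 'b measure \<Rightarrow> (('a \<Rightarrow> complex) \<Rightarrow> 'b \<Rightarrow> complex) \<Rightarrow> ('b \<Rightarrow> complex) \<Rightarrow> 'a \<Rightarrow> complex"
where
  "L2_adjoint M N T h =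
     (SOME u. u \<in> L2_space M \<and> (\<forall>g\<in>L2_space M. L2_inner N (T g) h = L2_inner M g u))"

text \<open>The eigenspace of \<open>T\<^sup>*T\<close> for the eigenvalue \<open>s\<^sup>2\<close>.\<close>

definition singular_space ::
  "'a measure \<Rightarrow> 'b measure \<Rightarrow> (('a \<Rightarrow> complex) \<Rightarrow> 'b \<Rightarrow> complex) \<Rightarrow> real \<Rightarrow> ('a \<Rightarrow> complex) set"
where
  "singular_space M N T s =
     {f \<in> L2_space M. AE x in M. L2_adjoint M N T (T f) x = complex_of_real (s\<^sup>2) * f x}"

text \<open>
  The \<open>j\<close>-th singular value (\<open>j \<ge> 1\<close>) in nonincreasing order with multiplicity: the largest
  \<open>s\<close> such that at least \<open>j\<close> singular values, counted with multiplicity, are \<open>\<ge> s\<close>.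
  Sums of eigenspaces for distinct eigenvalues are direct, so this count is the maximal number
  of linearly independent vectors in these eigenspaces.  The element \<open>0\<close> is the usual
  convention for operators of rank less than \<open>j\<close>.
\<close>

definition singular_value ::
  "'a measure \<Rightarrow> 'b measure \<Rightarrow> (('a \<Rightarrow> complex) \<Rightarrow> 'b \<Rightarrow> complex) \<Rightarrow> nat \<Rightarrow> real"
where
  "singular_value M N T j =
     Sup (insert 0 {s. 0 < s \<and>
       (\<exists>f. L2_independent M j f \<and> (\<forall>i<j. \<exists>t\<ge>s. f i \<in> singular_space M N T t))})"

definition herglotz_wave :: "real \<Rightarrow> (real ^ 'n \<Rightarrow> complex) \<Rightarrow> real ^ 'n \<Rightarrow> complex" where
  "herglotz_wave \<kappa> f x =
     (LINT \<omega>|surface_measure. exp (\<i> * complex_of_real (\<kappa> * (\<omega> \<bullet> x))) * f \<omega>)"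

text \<open>
  The restriction to the unit ball is effected by the measure of the target space
  \<open>L\<^sup>2(unit_ball_measure)\<close>.
\<close>

definition herglotz_operator :: "real \<Rightarrow> (real ^ 'n \<Rightarrow> complex) \<Rightarrow> real ^ 'n \<Rightarrow> complex" where
  "herglotz_operator \<kappa> f =
     (\<lambda>x. complex_of_real (\<kappa> powr ((real CARD('n) - 1) / 2)) * herglotz_wave \<kappa> f x)"

definition unit_ball_measure :: "(real ^ 'n) measure" where
  "unit_ball_measure = restrict_space lborel (ball 0 1)"

definition herglotz_singular_value :: "'n::finite itself \<Rightarrow> real \<Rightarrow> nat \<Rightarrow> real" where
  "herglotz_singular_value _ \<kappa> j =
     singular_value (surface_measure :: (real ^ 'n) measure) (unit_ball_measure :: (real ^ 'n) measure)
       (herglotz_operator \<kappa>) j"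

end

theory Submission
  imports Defs "HOL-Probability.Characteristic_Functions" "HOL-Complex_Analysis.Great_Picard"
begin

text \<open>
  With a Gaussian weight the integral of \<open>|P\<^sub>\<kappa> f|\<^sup>2\<close> over \<open>\<real>\<^sup>n\<close> is a quadratic form on the sphere whose
  kernel is a Gaussian in \<open>\<kappa>(\<omega> - \<omega>')\<close>.  Majorising the indicator of the ball by a Gaussian, the
  Schur test gives \<open>\<parallel>A\<^sub>\<kappa>\<parallel> \<le> C\<close>.  Minorising it by a difference of two Gaussians shows
  \<open>\<parallel>A\<^sub>\<kappa> f\<parallel> \<ge> C\<^sup>-\<^sup>1 \<parallel>f\<parallel>\<close> on the span of the indicators of about \<open>\<kappa>\<^bsup>n-1\<^esup>\<close> well separated caps of radius \<open>1/\<kappa>\<close>,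
  because the off-diagonal part of the form is small; the min-max principle then bounds \<open>\<sigma>\<^sub>j\<close> from below.
  For the decay, a function orthogonal to the polynomials of degree at most \<open>d\<close> on the sphere, a space
  of dimension of order \<open>d\<^bsup>n-1\<^esup>\<close>, only sees the remainder of order \<open>\<kappa>\<^bsup>d+1\<^esup>/(d+1)!\<close> of the exponential series.
\<close>

section \<open>Square-integrable functions\<close>

text \<open>The weight \<kappa>^{(n-1)/2} makes the plateau independent of \<kappa>: a Gaussian in
  \<kappa>(w - w') has mass of order \<kappa>^{-(n-1)} on the sphere, and the squared weight cancels
  exactly this. Singular values are defined through linearly independent eigenvectors, so the two
  halves of min-max differ in cost. An upper bound is an inequality on the span of given
  eigenvectors, whereas a lower bound must produce eigenvectors; these come from a spectral argument
  for bounded Lipschitz kernels on a compact set. The minorant of the ball must keep a positive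
  Fourier transform: one Gaussian alone stays positive outside the ball, and subtracting a second
  one is harmless when the rates are of order n, because 2^{n/2} < e^n. For the decay, \<kappa>^D /
  D! is at most e^{-D} once D \<ge> 9\<kappa>, and degree about j^{1/(n-1)} / 16 leaves fewer than j
  monomials; this gives C0 = (9 * 16)^{n-1}. The outcome is exponential decay in j^{1/(n-1)} itself,
  weakened to the stated exponent by \<kappa> \<ge> 1.\<close>

lemma borel_measurable_cnj [measurable]: "cnj \<in> borel_measurable borel"
  by (intro borel_measurable_continuous_onI continuous_intros)

definition L2_sqnorm :: "'a measure \<Rightarrow> ('a \<Rightarrow> complex) \<Rightarrow> real" where
  "L2_sqnorm M f = (LINT x|M. (cmod (f x))\<^sup>2)"

lemma L2_spaceD:
  assumes "f \<in> L2_space M"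
  shows "f \<in> borel_measurable M" "integrable M (\<lambda>x. (cmod (f x))\<^sup>2)"
  using assms by (auto simp: L2_space_def)

lemma L2_sqnorm_nonneg: "0 \<le> L2_sqnorm M f"
  by (simp add: L2_sqnorm_def)

lemma L2_inner_self: "L2_inner M f f = of_real (L2_sqnorm M f)"
  unfolding L2_inner_def L2_sqnorm_def
  by (subst integral_complex_of_real[symmetric]) (simp only: complex_norm_square)

lemma L2_integrable_mult:
  assumes "f \<in> L2_space M" "g \<in> L2_space M"
  shows "integrable M (\<lambda>x. f x * cnj (g x))"
proof (rule Bochner_Integration.integrable_bound)
  show "integrable M (\<lambda>x. (cmod (f x))\<^sup>2 + (cmod (g x))\<^sup>2)"
    using assms by (auto simp: L2_space_def)
  have [measurable]: "f \<in> borel_measurable M" "g \<in> borel_measurable M"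
    using assms by (auto simp: L2_space_def)
  show "(\<lambda>x. f x * cnj (g x)) \<in> borel_measurable M"
    by measurable
  have "cmod (f x) * cmod (g x) \<le> (cmod (f x))\<^sup>2 + (cmod (g x))\<^sup>2" for x
    using sum_squares_bound[of "cmod (f x)" "cmod (g x)"]
      mult_nonneg_nonneg[OF norm_ge_zero norm_ge_zero, of "f x" "g x"]
    unfolding mult.assoc by linarith
  then show "AE x in M. norm (f x * cnj (g x)) \<le> norm ((cmod (f x))\<^sup>2 + (cmod (g x))\<^sup>2)"
    by (simp add: norm_mult)
qed

lemma L2_space_scale: "f \<in> L2_space M \<Longrightarrow> (\<lambda>x. c * f x) \<in> L2_space M"
  by (auto simp: L2_space_def norm_mult power_mult_distrib)

lemma L2_space_add:
  assumes "f \<in> L2_space M" "g \<in> L2_space M"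
  shows "(\<lambda>x. f x + g x) \<in> L2_space M"
proof -
  have "integrable M (\<lambda>x. (cmod (f x + g x))\<^sup>2)"
  proof (rule Bochner_Integration.integrable_bound)
    show "integrable M (\<lambda>x. 2 * (cmod (f x))\<^sup>2 + 2 * (cmod (g x))\<^sup>2)"
      using assms by (auto simp: L2_space_def)
    show "(\<lambda>x. (cmod (f x + g x))\<^sup>2) \<in> borel_measurable M"
      using assms by (auto simp: L2_space_def)
    have "(cmod (f x + g x))\<^sup>2 \<le> 2 * (cmod (f x))\<^sup>2 + 2 * (cmod (g x))\<^sup>2" for x
    proof -
      have "(cmod (f x + g x))\<^sup>2 \<le> (cmod (f x) + cmod (g x))\<^sup>2"
        by (intro power_mono norm_triangle_ineq) auto
      also have "\<dots> \<le> 2 * (cmod (f x))\<^sup>2 + 2 * (cmod (g x))\<^sup>2"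
        using sum_squares_bound[of "cmod (f x)" "cmod (g x)"] by (simp add: power2_sum)
      finally show ?thesis .
    qed
    then show "AE x in M. norm ((cmod (f x + g x))\<^sup>2) \<le> norm (2 * (cmod (f x))\<^sup>2 + 2 * (cmod (g x))\<^sup>2)"
      by simp
  qed
  then show ?thesis
    using assms by (auto simp: L2_space_def)
qed

lemma L2_space_diff:
  assumes "f \<in> L2_space M" "g \<in> L2_space M"
  shows "(\<lambda>x. f x - g x) \<in> L2_space M"
  using L2_space_add[OF assms(1) L2_space_scale[OF assms(2), of "-1"]] by simp

lemma L2_space_zero: "(\<lambda>x. 0) \<in> L2_space M"
  by (auto simp: L2_space_def)

lemma L2_space_sum:
  assumes "\<And>i. i \<in> I \<Longrightarrow> f i \<in> L2_space M"
  shows "(\<lambda>x. \<Sum>i\<in>I. c i * f i x) \<in> L2_space M"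
  using assms
proof (induction I rule: infinite_finite_induct)
  case (insert i I)
  then show ?case
    using L2_space_add[OF L2_space_scale[of "f i" M "c i"], of "\<lambda>x. \<Sum>i\<in>I. c i * f i x"] by auto
qed (auto intro: L2_space_zero)

lemma L2_space_bounded:
  assumes "finite_measure M" "f \<in> borel_measurable M" "\<And>x. x \<in> space M \<Longrightarrow> cmod (f x) \<le> b"
  shows "f \<in> L2_space M"
proof -
  interpret finite_measure M by fact
  have "integrable M (\<lambda>x. (cmod (f x))\<^sup>2)"
    by (rule integrable_const_bound[where B="b\<^sup>2"])
       (use assms in \<open>auto intro!: AE_I2 power_mono\<close>)
  then show ?thesis using assms by (auto simp: L2_space_def)
qed

lemma L2_inner_add_left:
  assumes "f \<in> L2_space M" "g \<in> L2_space M" "h \<in> L2_space M"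
  shows "L2_inner M (\<lambda>x. f x + g x) h = L2_inner M f h + L2_inner M g h"
  unfolding L2_inner_def using L2_integrable_mult assms
  by (subst Bochner_Integration.integral_add[symmetric]) (auto simp: algebra_simps)

lemma L2_inner_scale_left: "L2_inner M (\<lambda>x. c * f x) h = c * L2_inner M f h"
  unfolding L2_inner_def by (subst integral_mult_right_zero[symmetric]) (simp add: mult.assoc)

lemma L2_inner_commute: "L2_inner M f g = cnj (L2_inner M g f)"
proof -
  have "cnj (L2_inner M g f) = (LINT x|M. cnj (g x * cnj (f x)))"
    unfolding L2_inner_def by (rule Bochner_Integration.integral_cnj[symmetric])
  then show ?thesis by (simp add: L2_inner_def mult.commute)
qed

lemma L2_inner_scale_right: "L2_inner M f (\<lambda>x. c * h x) = cnj c * L2_inner M f h"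
  by (subst (1 2) L2_inner_commute) (simp add: L2_inner_scale_left)

lemma L2_inner_add_right:
  assumes "f \<in> L2_space M" "g \<in> L2_space M" "h \<in> L2_space M"
  shows "L2_inner M h (\<lambda>x. f x + g x) = L2_inner M h f + L2_inner M h g"
  by (subst (1 2 3) L2_inner_commute) (simp add: L2_inner_add_left assms)

lemma L2_inner_diff_left:
  assumes "f \<in> L2_space M" "g \<in> L2_space M" "h \<in> L2_space M"
  shows "L2_inner M (\<lambda>x. f x - g x) h = L2_inner M f h - L2_inner M g h"
  unfolding L2_inner_def using L2_integrable_mult assms
  by (subst Bochner_Integration.integral_diff[symmetric]) (auto simp: algebra_simps)

lemma L2_inner_diff_right:
  assumes "f \<in> L2_space M" "g \<in> L2_space M" "h \<in> L2_space M"
  shows "L2_inner M h (\<lambda>x. f x - g x) = L2_inner M h f - L2_inner M h g"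
  by (subst (1 2 3) L2_inner_commute) (simp add: L2_inner_diff_left assms)

lemma L2_inner_sum_left:
  assumes "\<And>i. i \<in> I \<Longrightarrow> f i \<in> L2_space M" "h \<in> L2_space M"
  shows "L2_inner M (\<lambda>x. \<Sum>i\<in>I. c i * f i x) h = (\<Sum>i\<in>I. c i * L2_inner M (f i) h)"
proof -
  have "L2_inner M (\<lambda>x. \<Sum>i\<in>I. c i * f i x) h = (LINT x|M. (\<Sum>i\<in>I. c i * (f i x * cnj (h x))))"
    unfolding L2_inner_def by (simp add: sum_distrib_right mult.assoc)
  also have "\<dots> = (\<Sum>i\<in>I. c i * L2_inner M (f i) h)"
    unfolding L2_inner_def
    by (subst Bochner_Integration.integral_sum)
       (auto intro!: integrable_mult_right L2_integrable_mult assms)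
  finally show ?thesis .
qed

lemma L2_inner_sum_right:
  assumes "\<And>i. i \<in> I \<Longrightarrow> f i \<in> L2_space M" "h \<in> L2_space M"
  shows "L2_inner M h (\<lambda>x. \<Sum>i\<in>I. c i * f i x) = (\<Sum>i\<in>I. cnj (c i) * L2_inner M h (f i))"
  by (subst (1 2) L2_inner_commute) (simp add: L2_inner_sum_left assms)

lemma L2_inner_cong_AE:
  assumes "f \<in> borel_measurable M" "f' \<in> borel_measurable M" "g \<in> borel_measurable M"
    "AE x in M. f x = f' x"
  shows "L2_inner M f g = L2_inner M f' g"
proof -
  have [measurable]: "f \<in> borel_measurable M" "f' \<in> borel_measurable M" "g \<in> borel_measurable M"
    using assms by auto
  show ?thesis
    unfolding L2_inner_def
  proof (rule integral_cong_AE)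
    show "AE x in M. f x * cnj (g x) = f' x * cnj (g x)" using assms(4) by eventually_elim simp
  qed measurable
qed

lemma L2_sqnorm_scale: "L2_sqnorm M (\<lambda>x. c * f x) = (cmod c)\<^sup>2 * L2_sqnorm M f"
  unfolding L2_sqnorm_def by (simp add: norm_mult power_mult_distrib)

lemma L2_sqnorm_add:
  assumes "f \<in> L2_space M" "g \<in> L2_space M"
  shows "L2_sqnorm M (\<lambda>x. f x + g x) = L2_sqnorm M f + 2 * Re (L2_inner M f g) + L2_sqnorm M g"
proof -
  have "complex_of_real (L2_sqnorm M (\<lambda>x. f x + g x))
      = L2_sqnorm M f + (L2_inner M f g + cnj (L2_inner M f g)) + L2_sqnorm M g"
    unfolding L2_inner_self[symmetric] L2_inner_commute[of M g f, symmetric]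
    by (simp add: L2_inner_add_left L2_inner_add_right L2_space_add assms)
  then show ?thesis
    by (metis complex_add_cnj of_real_add of_real_eq_iff)
qed

lemma L2_sqnorm_diff:
  assumes "f \<in> L2_space M" "g \<in> L2_space M"
  shows "L2_sqnorm M (\<lambda>x. f x - g x) = L2_sqnorm M f - 2 * Re (L2_inner M f g) + L2_sqnorm M g"
  using L2_sqnorm_add[OF assms(1) L2_space_scale[OF assms(2), of "-1"]] L2_sqnorm_scale[of M "-1" g]
  by (simp add: L2_inner_scale_right[of M f "-1" g, simplified])

lemma L2_sqnorm_eq_0_iff:
  assumes "f \<in> L2_space M"
  shows "L2_sqnorm M f = 0 \<longleftrightarrow> (AE x in M. f x = 0)"
  unfolding L2_sqnorm_def using assms
  by (subst integral_nonneg_eq_0_iff_AE) (auto simp: L2_space_def)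

lemma L2_Cauchy_Schwarz:
  assumes "f \<in> L2_space M" "g \<in> L2_space M"
  shows "(cmod (L2_inner M f g))\<^sup>2 \<le> L2_sqnorm M f * L2_sqnorm M g"
proof (cases "L2_sqnorm M g = 0")
  case True
  have "L2_inner M g f = L2_inner M (\<lambda>x. 0) f"
    using True assms L2_sqnorm_eq_0_iff[of g M] by (intro L2_inner_cong_AE) (auto dest: L2_spaceD)
  then show ?thesis
    using L2_inner_commute[of M f g] True by (simp add: L2_inner_def)
next
  case False
  then have pos: "0 < L2_sqnorm M g" using L2_sqnorm_nonneg[of M g] by simp
  define a where "a = L2_inner M f g / L2_sqnorm M g"
  have "0 \<le> L2_sqnorm M (\<lambda>x. f x - a * g x)" by (rule L2_sqnorm_nonneg)
  also have "\<dots> = L2_sqnorm M f - 2 * Re (L2_inner M f (\<lambda>x. a * g x)) + (cmod a)\<^sup>2 * L2_sqnorm M g"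
    by (simp add: L2_sqnorm_diff L2_sqnorm_scale assms L2_space_scale)
  also have "L2_inner M f (\<lambda>x. a * g x) = of_real ((cmod (L2_inner M f g))\<^sup>2 / L2_sqnorm M g)"
    unfolding L2_inner_scale_right a_def
    by (simp add: complex_norm_square[symmetric] mult.commute del: of_real_power)
  also have "(cmod a)\<^sup>2 * L2_sqnorm M g = (cmod (L2_inner M f g))\<^sup>2 / L2_sqnorm M g"
    using pos by (simp add: a_def norm_divide power_divide power2_eq_square)
  finally show ?thesis using pos by (simp add: field_simps)
qed

text \<open>Cauchy-Schwarz for |f| against the constant 1. It turns L2 data into the absolute
  integrability behind the Fubini steps and the pointwise kernel bounds.\<close>

lemma L2_L1_bound:
  assumes "finite_measure M" "f \<in> L2_space M"
  shows "integrable M f" "(LINT x|M. cmod (f x))\<^sup>2 \<le> measure M (space M) * L2_sqnorm M f"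
proof -
  interpret finite_measure M by fact
  have 1: "(\<lambda>x. 1) \<in> L2_space M" by (rule L2_space_bounded[where b=1]) (auto intro: assms)
  show "integrable M f"
    using L2_integrable_mult[OF assms(2) 1] by simp
  have c: "(\<lambda>x. of_real (cmod (f x))) \<in> L2_space M"
    using assms(2) by (auto simp: L2_space_def)
  have "L2_inner M (\<lambda>x. of_real (cmod (f x))) (\<lambda>x. 1) = of_real (LINT x|M. cmod (f x))"
    unfolding L2_inner_def by simp
  moreover have "L2_sqnorm M (\<lambda>x. 1) = measure M (space M)" by (simp add: L2_sqnorm_def)
  moreover have "L2_sqnorm M (\<lambda>x. of_real (cmod (f x))) = L2_sqnorm M f" by (simp add: L2_sqnorm_def)
  ultimately show "(LINT x|M. cmod (f x))\<^sup>2 \<le> measure M (space M) * L2_sqnorm M f"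
    using L2_Cauchy_Schwarz[OF c 1] by (simp add: mult.commute)
qed

text \<open>Elimination by induction on the number of unknowns. It supplies nonzero combinations of
  \<open>n\<close> functions meeting fewer than \<open>n\<close> linear conditions: orthogonality to
  eigenvectors already found, and vanishing of polynomial moments.\<close>

lemma underdetermined_system:
  fixes a :: "'b \<Rightarrow> nat \<Rightarrow> 'c::field"
  assumes "finite J" "card J < n"
  shows "\<exists>c. (\<exists>i<n. c i \<noteq> 0) \<and> (\<forall>l\<in>J. (\<Sum>i<n. a l i * c i) = 0)"
  using assms
proof (induction n arbitrary: J a)
  case (Suc n)
  show ?case
  proof (cases "\<forall>l\<in>J. a l n = 0")
    case True
    then show ?thesis
      by (intro exI[of _ "\<lambda>i. if i = n then 1 else 0"]) (auto simp: sum.neutral)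
  next
    case False
    then obtain p where p: "p \<in> J" "a p n \<noteq> 0" by auto
    \<comment> \<open>\<open>b\<close> is the system after clearing the last column with the pivot
      row \<open>p\<close>; the last unknown is then chosen to satisfy that row.\<close>
    define b where "b l i = a l i - a l n / a p n * a p i" for l i
    have "card (J - {p}) < n"
      using p Suc.prems card_Diff1_less[of J p] by linarith
    then obtain c where c: "\<exists>i<n. c i \<noteq> 0" "\<forall>l\<in>J-{p}. (\<Sum>i<n. b l i * c i) = 0"
      using Suc.IH[of "J - {p}" b] Suc.prems by auto
    define e where "e = (\<Sum>i<n. a p i * c i)"
    define d where "d = c(n := - e / a p n)"
    have d: "(\<Sum>i<Suc n. a l i * d i) = (\<Sum>i<n. a l i * c i) - a l n * e / a p n" for l
      by (simp add: d_def)
    have "(\<Sum>i<Suc n. a l i * d i) = 0" if "l \<in> J" for l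
    proof (cases "l = p")
      case True then show ?thesis unfolding d using p by (simp add: e_def)
    next
      case False
      then have "0 = (\<Sum>i<n. b l i * c i)" using c that by auto
      also have "\<dots> = (\<Sum>i<n. a l i * c i) - a l n / a p n * e"
        by (simp add: b_def e_def left_diff_distrib sum_subtractf sum_distrib_left mult.assoc)
      finally show ?thesis unfolding d by simp
    qed
    moreover have "\<exists>i<Suc n. d i \<noteq> 0" using c(1) by (auto simp: d_def less_Suc_eq)
    ultimately show ?thesis by blast
  qed
qed simp

section \<open>Singular values of integral operators\<close>

lemma norm_integral_le:
  fixes f :: "'a \<Rightarrow> 'b::{banach, second_countable_topology}"
  assumes "integrable M f" "integrable M g" "\<And>x. x \<in> space M \<Longrightarrow> norm (f x) \<le> g x"
  shows "norm (integral\<^sup>L M f) \<le> integral\<^sup>L M g"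
  using integral_norm_bound[of M f] integral_mono[OF integrable_norm[OF assms(1)] assms(2,3)] by linarith

definition kernel_op :: "'a measure \<Rightarrow> ('b \<Rightarrow> 'a \<Rightarrow> complex) \<Rightarrow> ('a \<Rightarrow> complex) \<Rightarrow> 'b \<Rightarrow> complex" where
  "kernel_op M k f x = (LINT w|M. k x w * f w)"

lemma L2_inner_cong:
  assumes "\<And>x. x \<in> space M \<Longrightarrow> f x = f' x" "\<And>x. x \<in> space M \<Longrightarrow> g x = g' x"
  shows "L2_inner M f g = L2_inner M f' g'"
  unfolding L2_inner_def using assms by (intro Bochner_Integration.integral_cong) auto

lemma L2_sqnorm_cong:
  assumes "\<And>x. x \<in> space M \<Longrightarrow> f x = f' x"
  shows "L2_sqnorm M f = L2_sqnorm M f'"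
  unfolding L2_sqnorm_def using assms by (intro Bochner_Integration.integral_cong) auto

lemma L2_sqnorm_parallelogram:
  assumes "f \<in> L2_space M" "g \<in> L2_space M"
  shows "L2_sqnorm M (\<lambda>x. f x + g x) + L2_sqnorm M (\<lambda>x. f x - g x) = 2 * L2_sqnorm M f + 2 * L2_sqnorm M g"
  by (simp add: L2_sqnorm_add L2_sqnorm_diff assms)

lemma L2_inner_sum_sum:
  assumes "\<And>i. i \<in> I \<Longrightarrow> f i \<in> L2_space M"
  shows "L2_inner M (\<lambda>x. \<Sum>i\<in>I. c i * f i x) (\<lambda>x. \<Sum>i\<in>I. c i * f i x)
    = (\<Sum>i\<in>I. \<Sum>l\<in>I. c i * cnj (c l) * L2_inner M (f i) (f l))"
proof -
  have "L2_inner M (\<lambda>x. \<Sum>i\<in>I. c i * f i x) (\<lambda>x. \<Sum>i\<in>I. c i * f i x)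
      = (\<Sum>i\<in>I. c i * L2_inner M (f i) (\<lambda>x. \<Sum>i\<in>I. c i * f i x))"
    by (intro L2_inner_sum_left L2_space_sum assms)
  also have "\<dots> = (\<Sum>i\<in>I. c i * (\<Sum>l\<in>I. cnj (c l) * L2_inner M (f i) (f l)))"
    by (intro sum.cong refl arg_cong2[where f="(*)"] L2_inner_sum_right assms)
  finally show ?thesis by (simp add: sum_distrib_left mult.assoc)
qed

text \<open>A bounded kernel between finite measures makes \<open>T f\<close> a bounded function,
  with a bound at every point. This control replaces abstract operator theory: adjoints come from
  Fubini, uniform limits from equicontinuity.\<close>

locale kernel_operator =
  fixes M :: "'a measure" and N :: "'b measure" and k :: "'b \<Rightarrow> 'a \<Rightarrow> complex" and b :: real
  assumes finite_M: "finite_measure M" and finite_N: "finite_measure N"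
    and k_measurable [measurable]: "(\<lambda>(x, w). k x w) \<in> borel_measurable (N \<Otimes>\<^sub>M M)"
    and k_bound: "\<And>x w. x \<in> space N \<Longrightarrow> w \<in> space M \<Longrightarrow> cmod (k x w) \<le> b"
begin

abbreviation "T \<equiv> kernel_op M k"
abbreviation "Tadj \<equiv> kernel_op N (\<lambda>w x. cnj (k x w))"
abbreviation "mM \<equiv> measure M (space M)"
abbreviation "mN \<equiv> measure N (space N)"

sublocale M: finite_measure M by (rule finite_M)
sublocale N: finite_measure N by (rule finite_N)
sublocale NM: pair_sigma_finite N M ..

text \<open>The transposed kernel satisfies the same assumptions, so every fact about
  \<open>T\<close> becomes available for \<open>Tadj\<close>.\<close>

lemma swap: "kernel_operator N M (\<lambda>w x. cnj (k x w)) b"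
proof
  show "(\<lambda>(w, x). cnj (k x w)) \<in> borel_measurable (M \<Otimes>\<^sub>M N)"
    using measurable_compose[OF measurable_pair_swap[OF k_measurable] borel_measurable_cnj]
    by (simp add: case_prod_beta')
qed (auto simp: k_bound)

lemma integrable_kernel:
  assumes "f \<in> L2_space M" "x \<in> space N"
  shows "integrable M (\<lambda>w. k x w * f w)"
proof (rule Bochner_Integration.integrable_bound)
  show "integrable M (\<lambda>w. b * cmod (f w))"
    using L2_L1_bound(1)[OF finite_M assms(1)] by auto
  have [measurable]: "f \<in> borel_measurable M" using assms by (auto dest: L2_spaceD)
  show "(\<lambda>w. k x w * f w) \<in> borel_measurable M"
    using assms by measurable
  show "AE w in M. norm (k x w * f w) \<le> norm (b * cmod (f w))"
  proof (rule AE_I2)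
    fix w assume "w \<in> space M"
    then have "cmod (k x w) * cmod (f w) \<le> b * cmod (f w)"
      by (intro mult_right_mono k_bound assms) auto
    then show "norm (k x w * f w) \<le> norm (b * cmod (f w))"
      by (simp add: norm_mult)
  qed
qed

lemma T_pointwise:
  assumes "f \<in> L2_space M" "x \<in> space N"
  shows "(cmod (T f x))\<^sup>2 \<le> b\<^sup>2 * mM * L2_sqnorm M f"
proof -
  have "cmod (T f x) \<le> (LINT w|M. b * cmod (f w))"
    unfolding kernel_op_def
  proof (rule norm_integral_le[OF integrable_kernel[OF assms]])
    show "integrable M (\<lambda>w. b * cmod (f w))"
      using L2_L1_bound(1)[OF finite_M assms(1)] by auto
  qed (auto simp: norm_mult intro!: mult_right_mono k_bound assms)
  also have "\<dots> = b * (LINT w|M. cmod (f w))" by simp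
  finally have "(cmod (T f x))\<^sup>2 \<le> (b * (LINT w|M. cmod (f w)))\<^sup>2"
    by (intro power_mono) auto
  also have "\<dots> \<le> b\<^sup>2 * (mM * L2_sqnorm M f)"
    unfolding power_mult_distrib by (intro mult_left_mono L2_L1_bound finite_M assms) auto
  finally show ?thesis by (simp add: mult.assoc)
qed

lemma T_measurable:
  assumes [measurable]: "f \<in> borel_measurable M"
  shows "T f \<in> borel_measurable N"
  unfolding kernel_op_def by measurable

lemma T_L2:
  assumes "f \<in> L2_space M"
  shows "T f \<in> L2_space N"
proof (rule L2_space_bounded[OF finite_N])
  show "T f \<in> borel_measurable N" using assms by (auto intro: T_measurable dest: L2_spaceD)
  show "cmod (T f x) \<le> sqrt (b\<^sup>2 * mM * L2_sqnorm M f)" if "x \<in> space N" for x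
    using T_pointwise[OF assms that] by (rule real_le_rsqrt)
qed

lemma T_sqnorm_le:
  assumes "f \<in> L2_space M"
  shows "L2_sqnorm N (T f) \<le> mN * (b\<^sup>2 * mM) * L2_sqnorm M f"
proof -
  have "L2_sqnorm N (T f) \<le> (LINT x|N. b\<^sup>2 * mM * L2_sqnorm M f)"
    unfolding L2_sqnorm_def[of N]
    by (rule integral_mono) (use L2_spaceD[OF T_L2[OF assms]] T_pointwise[OF assms] in auto)
  then show ?thesis by (simp add: mult_ac)
qed

lemma T_sum:
  assumes "\<And>i. i \<in> I \<Longrightarrow> f i \<in> L2_space M" "x \<in> space N"
  shows "T (\<lambda>w. \<Sum>i\<in>I. c i * f i w) x = (\<Sum>i\<in>I. c i * T (f i) x)"
proof -
  have "T (\<lambda>w. \<Sum>i\<in>I. c i * f i w) x = (LINT w|M. (\<Sum>i\<in>I. c i * (k x w * f i w)))"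
    unfolding kernel_op_def by (simp add: sum_distrib_left mult_ac)
  also have "\<dots> = (\<Sum>i\<in>I. c i * T (f i) x)"
    unfolding kernel_op_def
    by (subst Bochner_Integration.integral_sum) (auto intro!: integrable_mult_right integrable_kernel assms)
  finally show ?thesis .
qed

lemma T_diff:
  assumes "f \<in> L2_space M" "g \<in> L2_space M" "x \<in> space N"
  shows "T (\<lambda>w. f w - g w) x = T f x - T g x"
  unfolding kernel_op_def
  using Bochner_Integration.integral_diff[OF integrable_kernel[OF assms(1,3)] integrable_kernel[OF assms(2,3)]]
  by (simp add: algebra_simps)

lemma T_add:
  assumes "f \<in> L2_space M" "g \<in> L2_space M" "x \<in> space N"
  shows "T (\<lambda>w. f w + g w) x = T f x + T g x"
  unfolding kernel_op_def
  using Bochner_Integration.integral_add[OF integrable_kernel[OF assms(1,3)] integrable_kernel[OF assms(2,3)]]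
  by (simp add: algebra_simps)

lemma T_scale: "T (\<lambda>w. c * f w) x = c * T f x"
  unfolding kernel_op_def by (subst integral_mult_right_zero[symmetric]) (simp add: mult_ac)

text \<open>Fubini with dominating function \<open>b * (cmod (h x) * cmod (f w))\<close>, which is
  integrable because square-integrable functions on finite measures are integrable.\<close>

lemma T_adjoint:
  assumes f: "f \<in> L2_space M" and h: "h \<in> L2_space N"
  shows "L2_inner N (T f) h = L2_inner M f (Tadj h)"
proof -
  have [measurable]: "f \<in> borel_measurable M" "h \<in> borel_measurable N"
    using assms by (auto dest: L2_spaceD)
  have int: "integrable (N \<Otimes>\<^sub>M M) (\<lambda>(x, w). k x w * f w * cnj (h x))"
  proof (rule Bochner_Integration.integrable_bound)
    show "integrable (N \<Otimes>\<^sub>M M) (\<lambda>(x, w). b * (cmod (h x) * cmod (f w)))"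
      using L2_L1_bound(1)[OF finite_M f] L2_L1_bound(1)[OF finite_N h]
      by (intro NM.Fubini_integrable) (auto simp: abs_mult mult.assoc[symmetric])
    show "AE p in N \<Otimes>\<^sub>M M. norm (case p of (x, w) \<Rightarrow> k x w * f w * cnj (h x))
        \<le> norm (case p of (x, w) \<Rightarrow> b * (cmod (h x) * cmod (f w)))"
    proof (rule AE_I2)
      fix p assume "p \<in> space (N \<Otimes>\<^sub>M M)"
      then obtain x w where p: "p = (x, w)" "x \<in> space N" "w \<in> space M"
        by (auto simp: space_pair_measure)
      have "cmod (k x w) * (cmod (h x) * cmod (f w)) \<le> b * (cmod (h x) * cmod (f w))"
        by (intro mult_right_mono k_bound p) auto
      also have "\<dots> \<le> \<bar>b * (cmod (h x) * cmod (f w))\<bar>" by simp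
      finally show "norm (case p of (x, w) \<Rightarrow> k x w * f w * cnj (h x))
        \<le> norm (case p of (x, w) \<Rightarrow> b * (cmod (h x) * cmod (f w)))"
        by (simp add: p norm_mult mult_ac)
    qed
  qed measurable
  have "L2_inner N (T f) h = (LINT x|N. LINT w|M. k x w * f w * cnj (h x))"
    unfolding L2_inner_def kernel_op_def by simp
  also have "\<dots> = (LINT w|M. LINT x|N. k x w * f w * cnj (h x))"
    using NM.Fubini_integral[OF int] by simp
  also have "\<dots> = (LINT w|M. f w * cnj (Tadj h w))"
  proof (rule Bochner_Integration.integral_cong[OF refl])
    fix w
    have "(LINT x|N. k x w * f w * cnj (h x)) = (LINT x|N. f w * cnj (cnj (k x w) * h x))"
      by (simp add: mult_ac)
    then show "(LINT x|N. k x w * f w * cnj (h x)) = f w * cnj (Tadj h w)"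
      by (simp add: kernel_op_def del: complex_cnj_mult)
  qed
  finally show ?thesis by (simp add: L2_inner_def)
qed

lemma Tadj_L2: "h \<in> L2_space N \<Longrightarrow> Tadj h \<in> L2_space M"
  by (rule kernel_operator.T_L2[OF swap])

text \<open>\<open>L2_adjoint\<close> is an arbitrary choice, but any two candidates have a
  difference \<open>d\<close> with <d, d> = 0. Afterwards the concrete kernel adjoint can be used
  throughout.\<close>

lemma L2_adjoint_AE:
  assumes h: "h \<in> L2_space N"
  shows "AE w in M. L2_adjoint M N T h w = Tadj h w"
proof -
  let ?P = "\<lambda>u. u \<in> L2_space M \<and> (\<forall>g\<in>L2_space M. L2_inner N (T g) h = L2_inner M g u)"
  have "?P (Tadj h)" using T_adjoint Tadj_L2 h by auto
  then have P: "?P (L2_adjoint M N T h)" unfolding L2_adjoint_def by (rule someI[where P="?P"])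
  define d where "d w = L2_adjoint M N T h w - Tadj h w" for w
  have d: "d \<in> L2_space M"
    unfolding d_def using P Tadj_L2[OF h] by (intro L2_space_diff) auto
  have "L2_inner M d d = L2_inner M d (L2_adjoint M N T h) - L2_inner M d (Tadj h)"
    unfolding d_def[abs_def]
    by (rule L2_inner_diff_right) (use P Tadj_L2[OF h] d in \<open>auto simp: d_def[abs_def]\<close>)
  also have "\<dots> = 0" using P d T_adjoint[OF d h] by auto
  finally have "L2_sqnorm M d = 0" by (simp add: L2_inner_self)
  then show ?thesis using L2_sqnorm_eq_0_iff[OF d] by (simp add: d_def)
qed

lemma singular_space_iff:
  "f \<in> singular_space M N T s \<longleftrightarrow>
     f \<in> L2_space M \<and> (AE w in M. Tadj (T f) w = complex_of_real (s\<^sup>2) * f w)"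
proof -
  have "(AE w in M. L2_adjoint M N T (T f) w = complex_of_real (s\<^sup>2) * f w) \<longleftrightarrow>
      (AE w in M. Tadj (T f) w = complex_of_real (s\<^sup>2) * f w)" if "f \<in> L2_space M"
  proof -
    have "AE w in M. (L2_adjoint M N T (T f) w = complex_of_real (s\<^sup>2) * f w) \<longleftrightarrow>
      (Tadj (T f) w = complex_of_real (s\<^sup>2) * f w)"
      using L2_adjoint_AE[OF T_L2[OF that]] by eventually_elim simp
    then show ?thesis by (rule eventually_subst)
  qed
  then show ?thesis unfolding singular_space_def by blast
qed

lemma singular_inner:
  assumes f: "f \<in> singular_space M N T t" and g: "g \<in> L2_space M"
  shows "L2_inner N (T f) (T g) = complex_of_real (t\<^sup>2) * L2_inner M f g"
proof -
  have f2: "f \<in> L2_space M" and ae: "AE w in M. Tadj (T f) w = complex_of_real (t\<^sup>2) * f w"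
    using f by (auto simp: singular_space_iff)
  have "L2_inner N (T g) (T f) = L2_inner M g (Tadj (T f))"
    by (rule T_adjoint[OF g T_L2[OF f2]])
  also have "\<dots> = cnj (L2_inner M (Tadj (T f)) g)" by (rule L2_inner_commute)
  also have "L2_inner M (Tadj (T f)) g = L2_inner M (\<lambda>w. complex_of_real (t\<^sup>2) * f w) g"
    using ae L2_spaceD(1)[OF Tadj_L2[OF T_L2[OF f2]]] L2_spaceD(1)[OF f2] L2_spaceD(1)[OF g]
    by (intro L2_inner_cong_AE) auto
  finally show ?thesis
    by (subst L2_inner_commute) (simp add: L2_inner_scale_left)
qed

text \<open>Eigenvectors for different eigenvalues are orthogonal, so \<open>t\<^sub>i\<^sup>2 - s\<^sup>2\<close> may be replaced by
  \<open>r\<^sub>i r\<^sub>l\<close>, \<open>r\<^sub>i = \<surd>(t\<^sub>i\<^sup>2 - s\<^sup>2)\<close>, in front of \<open>\<langle>f\<^sub>i, f\<^sub>l\<rangle>\<close>.\<close>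

lemma singular_span_lower_bound:
  assumes f: "\<And>i. i < j \<Longrightarrow> f i \<in> singular_space M N T (t i)" and t: "\<And>i. i < j \<Longrightarrow> s \<le> t i" and s: "0 < s"
  shows "s\<^sup>2 * L2_sqnorm M (\<lambda>w. \<Sum>i<j. c i * f i w) \<le> L2_sqnorm N (T (\<lambda>w. \<Sum>i<j. c i * f i w))"
proof -
  let ?F = "\<lambda>w. \<Sum>i<j. c i * f i w"
  have f2: "\<And>i. i < j \<Longrightarrow> f i \<in> L2_space M" using f by (auto simp: singular_space_iff)
  define r where "r i = sqrt ((t i)\<^sup>2 - s\<^sup>2)" for i
  have r2: "(r i)\<^sup>2 = (t i)\<^sup>2 - s\<^sup>2" if "i < j" for i
    using t[OF that] s by (auto simp: r_def intro!: real_sqrt_pow2 power_mono)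
  have orth: "complex_of_real ((t i)\<^sup>2) * L2_inner M (f i) (f l) = s\<^sup>2 * L2_inner M (f i) (f l)
      + of_real (r i * r l) * L2_inner M (f i) (f l)" if "i < j" "l < j" for i l
  proof -
    have "complex_of_real ((t i)\<^sup>2) * L2_inner M (f i) (f l) = cnj (L2_inner N (T (f l)) (T (f i)))"
      unfolding singular_inner[OF f f2, OF that, symmetric] by (rule L2_inner_commute)
    also have "\<dots> = complex_of_real ((t l)\<^sup>2) * L2_inner M (f i) (f l)"
      unfolding singular_inner[OF f f2, OF that(2,1)] L2_inner_commute[of M "f i" "f l"] by simp
    finally have "complex_of_real ((t i)\<^sup>2) * L2_inner M (f i) (f l) = complex_of_real ((t l)\<^sup>2) * L2_inner M (f i) (f l)" .
    then have "L2_inner M (f i) (f l) = 0 \<or> (t i)\<^sup>2 = (t l)\<^sup>2"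
      by (metis mult_cancel_right of_real_eq_iff)
    moreover have "r i * r l = (t i)\<^sup>2 - s\<^sup>2" if "(t i)\<^sup>2 = (t l)\<^sup>2"
      using that r2[OF \<open>i < j\<close>] by (simp add: r_def power2_eq_square)
    ultimately have "L2_inner M (f i) (f l) = 0 \<or> (t i)\<^sup>2 = s\<^sup>2 + r i * r l" by auto
    then show ?thesis
    proof
      assume "(t i)\<^sup>2 = s\<^sup>2 + r i * r l"
      then show ?thesis by (simp only: of_real_add distrib_right)
    qed simp
  qed
  have "complex_of_real (L2_sqnorm N (T ?F)) = L2_inner N (\<lambda>x. \<Sum>i<j. c i * T (f i) x) (\<lambda>x. \<Sum>i<j. c i * T (f i) x)"
    unfolding L2_inner_self[symmetric] by (rule L2_inner_cong) (auto intro!: T_sum f2)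
  also have "\<dots> = (\<Sum>i<j. \<Sum>l<j. c i * cnj (c l) * L2_inner N (T (f i)) (T (f l)))"
    by (rule L2_inner_sum_sum) (auto intro: T_L2 f2)
  also have "\<dots> = (\<Sum>i<j. \<Sum>l<j. c i * cnj (c l) * (complex_of_real ((t i)\<^sup>2) * L2_inner M (f i) (f l)))"
    by (intro sum.cong refl arg_cong2[where f="(*)"] singular_inner) (use f f2 in auto)
  also have "\<dots> = (\<Sum>i<j. \<Sum>l<j. c i * cnj (c l) * (s\<^sup>2 * L2_inner M (f i) (f l)
      + of_real (r i * r l) * L2_inner M (f i) (f l)))"
    by (intro sum.cong refl arg_cong2[where f="(*)"] orth) auto
  also have "\<dots> = s\<^sup>2 * (\<Sum>i<j. \<Sum>l<j. c i * cnj (c l) * L2_inner M (f i) (f l))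
      + (\<Sum>i<j. \<Sum>l<j. (c i * r i) * cnj (c l * r l) * L2_inner M (f i) (f l))"
    by (simp add: sum_distrib_left distrib_left sum.distrib mult_ac)
  also have "(\<Sum>i<j. \<Sum>l<j. c i * cnj (c l) * L2_inner M (f i) (f l)) = L2_sqnorm M ?F"
    unfolding L2_inner_self[symmetric]
    by (rule L2_inner_sum_sum[symmetric]) (auto intro: f2)
  \<comment> \<open>The remaining Gram sum is again a squared norm, of the combination with
    coefficients \<open>c i * r i\<close>, and hence nonnegative.\<close>
  also have "(\<Sum>i<j. \<Sum>l<j. (c i * r i) * cnj (c l * r l) * L2_inner M (f i) (f l))
      = L2_sqnorm M (\<lambda>w. \<Sum>i<j. (c i * r i) * f i w)"
    unfolding L2_inner_self[symmetric]
    by (rule L2_inner_sum_sum[symmetric]) (auto intro: f2)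
  finally have "L2_sqnorm N (T ?F) = s\<^sup>2 * L2_sqnorm M ?F + L2_sqnorm M (\<lambda>w. \<Sum>i<j. (c i * r i) * f i w)"
    by (simp only: of_real_mult[symmetric] of_real_add[symmetric] of_real_eq_iff)
  then show ?thesis using L2_sqnorm_nonneg[of M "\<lambda>w. \<Sum>i<j. (c i * r i) * f i w"] by simp
qed

lemma L2_independent_sqnorm_pos:
  assumes "L2_independent M j f" "\<And>i. i < j \<Longrightarrow> f i \<in> L2_space M" "\<exists>i<j. c i \<noteq> 0"
  shows "0 < L2_sqnorm M (\<lambda>w. \<Sum>i<j. c i * f i w)"
proof -
  have "(\<lambda>w. \<Sum>i<j. c i * f i w) \<in> L2_space M" by (intro L2_space_sum) (auto intro: assms)
  then have "L2_sqnorm M (\<lambda>w. \<Sum>i<j. c i * f i w) \<noteq> 0"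
    using assms(1,3) by (auto simp: L2_sqnorm_eq_0_iff L2_independent_def)
  then show ?thesis using L2_sqnorm_nonneg[of M "\<lambda>w. \<Sum>i<j. c i * f i w"] by linarith
qed

text \<open>Eigenvectors for values at least \<open>r\<close> span a space that \<open>T\<close>
  enlarges by at least \<open>r\<close>; a nonzero combination enlarged by at most \<open>s\<close>
  therefore forces \<open>r \<le> s\<close>. Boundedness is recorded as well, because a supremum of
  reals dominates its members only for a bounded set.\<close>

lemma singular_value_le:
  assumes s: "0 \<le> s" and small: "\<And>f. L2_independent M j f \<Longrightarrow> (\<And>i. i < j \<Longrightarrow> f i \<in> L2_space M) \<Longrightarrow>
     \<exists>c. (\<exists>i<j. c i \<noteq> 0) \<and>
       L2_sqnorm N (T (\<lambda>w. \<Sum>i<j. c i * f i w)) \<le> s\<^sup>2 * L2_sqnorm M (\<lambda>w. \<Sum>i<j. c i * f i w)"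
  shows "singular_value M N T j \<le> s"
    and "bdd_above (insert 0 {s. 0 < s \<and>
       (\<exists>f. L2_independent M j f \<and> (\<forall>i<j. \<exists>t\<ge>s. f i \<in> singular_space M N T t))})"
proof -
  let ?A = "{s. 0 < s \<and> (\<exists>f. L2_independent M j f \<and> (\<forall>i<j. \<exists>t\<ge>s. f i \<in> singular_space M N T t))}"
  have le: "r \<le> s" if "r \<in> insert 0 ?A" for r
  proof (cases "r = 0")
    case False
    with that obtain f where r: "0 < r" and f: "L2_independent M j f"
      "\<forall>i<j. \<exists>t\<ge>r. f i \<in> singular_space M N T t" by auto
    then obtain t where t: "\<And>i. i < j \<Longrightarrow> r \<le> t i" "\<And>i. i < j \<Longrightarrow> f i \<in> singular_space M N T (t i)"
      by metis
    have f2: "\<And>i. i < j \<Longrightarrow> f i \<in> L2_space M" using t by (auto simp: singular_space_iff)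
    obtain c where c: "\<exists>i<j. c i \<noteq> 0"
      "L2_sqnorm N (T (\<lambda>w. \<Sum>i<j. c i * f i w)) \<le> s\<^sup>2 * L2_sqnorm M (\<lambda>w. \<Sum>i<j. c i * f i w)"
      using small[OF f(1) f2] by auto
    have "r\<^sup>2 * L2_sqnorm M (\<lambda>w. \<Sum>i<j. c i * f i w) \<le> s\<^sup>2 * L2_sqnorm M (\<lambda>w. \<Sum>i<j. c i * f i w)"
      using singular_span_lower_bound[of j f t r c] t r c(2) by fastforce
    then have "r\<^sup>2 \<le> s\<^sup>2"
      using L2_independent_sqnorm_pos[OF f(1) f2 c(1)] by simp
    then show ?thesis using s by (rule power2_le_imp_le)
  qed (use s in simp)
  show "singular_value M N T j \<le> s"
    unfolding singular_value_def by (rule cSup_least) (use le in auto)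
  show "bdd_above (insert 0 ?A)" using le by (auto simp: bdd_above_def)
qed

end

section \<open>Existence of eigenvectors and lower bounds for singular values\<close>

locale compact_kernel_operator = kernel_operator M N k b
  for M :: "'a::euclidean_space measure" and N :: "'b measure" and k b +
  fixes L :: real
  assumes compact_M: "compact (space M)"
    and k_lipschitz: "\<And>x w w'. x \<in> space N \<Longrightarrow> w \<in> space M \<Longrightarrow> w' \<in> space M \<Longrightarrow>
      cmod (k x w - k x w') \<le> L * norm (w - w')"
begin

text \<open>The Lipschitz constant is uniform over normalised \<open>f\<close>, so the functions
  \<open>Tadj (T f)\<close> form an equicontinuous family; this is the compactness used
  below.\<close>

lemma Tadj_T_lipschitz:
  assumes f: "f \<in> L2_space M" "L2_sqnorm M f = 1" and w: "w \<in> space M" "w' \<in> space M"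
  shows "cmod (Tadj (T f) w - Tadj (T f) w') \<le> mN * sqrt (b\<^sup>2 * mM) * L * norm (w - w')"
proof -
  note int = kernel_operator.integrable_kernel[OF swap T_L2[OF f(1)]]
  let ?B = "sqrt (b\<^sup>2 * mM)"
  have "Tadj (T f) w - Tadj (T f) w' = (LINT x|N. cnj (k x w - k x w') * T f x)"
    unfolding kernel_op_def[of N]
    by (subst Bochner_Integration.integral_diff[symmetric, OF int int]) (auto simp: w algebra_simps)
  also have "cmod \<dots> \<le> (LINT x|N. L * norm (w - w') * ?B)"
  proof (rule norm_integral_le)
    show "integrable N (\<lambda>x. cnj (k x w - k x w') * T f x)"
      using Bochner_Integration.integrable_diff[OF int[OF w(1)] int[OF w(2)]] by (simp add: algebra_simps)
    show "norm (cnj (k x w - k x w') * T f x) \<le> L * norm (w - w') * ?B" if x: "x \<in> space N" for x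
    proof -
      have "cmod (T f x) \<le> ?B"
        using T_pointwise[OF f(1) x] f(2) by (intro real_le_rsqrt) simp
      moreover have "0 \<le> L * norm (w - w')"
        using k_lipschitz[OF x w] norm_ge_zero order_trans by blast
      ultimately show ?thesis
        unfolding norm_mult complex_mod_cnj by (intro mult_mono k_lipschitz x w) auto
    qed
  qed auto
  finally show ?thesis by (simp add: mult_ac)
qed

text \<open>The eigenvector maximises \<open>\<parallel>T f\<parallel>\<close> on the unit sphere of the orthogonal complement \<open>E\<close> of the given
  eigenvectors.  If \<open>f\<^sub>n\<close> is a maximising sequence, then \<open>\<lambda> f\<^sub>n - T\<^sup>*T f\<^sub>n \<rightarrow> 0\<close>, and \<open>T\<^sup>*T f\<^sub>n\<close> converges uniformly
  along a subsequence by Arzela-Ascoli, so no completeness of \<open>L\<^sup>2\<close> is needed.\<close>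

lemma eigenvector_orthogonal:
  fixes e :: "nat \<Rightarrow> 'a \<Rightarrow> complex"
  assumes e: "\<And>i. i < m \<Longrightarrow> e i \<in> singular_space M N T (t i)"
    and v: "v \<in> L2_space M" "\<And>i. i < m \<Longrightarrow> L2_inner M v (e i) = 0" "0 < L2_sqnorm M v"
      "s\<^sup>2 * L2_sqnorm M v \<le> L2_sqnorm N (T v)"
    and s: "0 < s"
  shows "\<exists>f r. s \<le> r \<and> f \<in> singular_space M N T r \<and> L2_sqnorm M f = 1 \<and> (\<forall>i<m. L2_inner M f (e i) = 0)"
proof -
  define E where "E = {f \<in> L2_space M. \<forall>i<m. L2_inner M f (e i) = 0}"
  define Q where "Q f = L2_sqnorm N (T f)" for f
  define A where "A = {Q f | f. f \<in> E \<and> L2_sqnorm M f = 1}"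
  define lam where "lam = Sup A"
  \<comment> \<open>\<open>R\<close> is the quadratic form of lam - T*T; on \<open>E\<close> it is
    nonnegative because \<open>lam\<close> is the supremum of \<open>Q\<close> over normalised
    functions.\<close>
  define R where "R f = lam * L2_sqnorm M f - Q f" for f
  define K where "K f = Tadj (T f)" for f
  have e2: "e i \<in> L2_space M" if "i < m" for i using e[OF that] by (auto simp: singular_space_iff)
  have E2: "f \<in> L2_space M" if "f \<in> E" for f using that by (simp add: E_def)
  have Ediff: "(\<lambda>w. f w - g w) \<in> E" if "f \<in> E" "g \<in> E" for f g
    using that e2 by (simp add: E_def L2_space_diff L2_inner_diff_left)
  have Escale: "(\<lambda>w. c * f w) \<in> E" if "f \<in> E" for f c
    using that by (simp add: E_def L2_space_scale L2_inner_scale_left)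
  have Qscale: "Q (\<lambda>w. c * f w) = (cmod c)\<^sup>2 * Q f" for c f
    unfolding Q_def by (simp add: T_scale[abs_def] L2_sqnorm_scale)
  have Qle: "Q f \<le> mN * (b\<^sup>2 * mM) * L2_sqnorm M f" if "f \<in> E" for f
    unfolding Q_def by (rule T_sqnorm_le[OF E2[OF that]])
  have bdd: "bdd_above A"
    unfolding A_def bdd_above_def using Qle by fastforce
  have normalise: "\<exists>c>0. L2_sqnorm M (\<lambda>w. of_real c * f w) = 1 \<and> c\<^sup>2 * L2_sqnorm M f = 1"
    if "0 < L2_sqnorm M f" for f
    unfolding L2_sqnorm_scale
    using that by (intro exI[of _ "1 / sqrt (L2_sqnorm M f)"]) (simp add: norm_divide power_divide)
  have lamQ: "Q f \<le> lam * L2_sqnorm M f" if f: "f \<in> E" for f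
  proof (cases "L2_sqnorm M f = 0")
    case True
    then show ?thesis using Qle[OF f] by simp
  next
    case False
    then have "0 < L2_sqnorm M f" using L2_sqnorm_nonneg[of M f] by simp
    then obtain c where c: "c > 0" "L2_sqnorm M (\<lambda>w. of_real c * f w) = 1" "c\<^sup>2 * L2_sqnorm M f = 1"
      using normalise by blast
    have "Q (\<lambda>w. of_real c * f w) \<in> A" using c Escale[OF f] by (auto simp: A_def)
    then have "c\<^sup>2 * Q f \<le> lam * (c\<^sup>2 * L2_sqnorm M f)"
      unfolding lam_def c(3) using cSup_upper[OF _ bdd] by (simp add: Qscale)
    then have "c\<^sup>2 * Q f \<le> c\<^sup>2 * (lam * L2_sqnorm M f)" by (simp add: mult_ac)
    then show ?thesis using c(1) by simp
  qed
  have vE: "v \<in> E" using v by (simp add: E_def)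
  have "s\<^sup>2 * L2_sqnorm M v \<le> lam * L2_sqnorm M v" using lamQ[OF vE] v(4) by (simp add: Q_def)
  then have lam_s: "s\<^sup>2 \<le> lam" using v(3) by simp
  then have lam0: "0 < lam" using s by (simp add: order_less_le_trans[of 0 "s\<^sup>2"])
  have A_ne: "A \<noteq> {}"
    using normalise[OF v(3)] Escale[OF vE] unfolding A_def by blast
  have K2: "K f \<in> L2_space M" if "f \<in> L2_space M" for f
    unfolding K_def by (intro Tadj_L2 T_L2 that)
  \<comment> \<open>\<open>E\<close> is invariant: T*T is symmetric and the \<open>e i\<close> are
    eigenvectors.\<close>
  have KE: "K f \<in> E" if f: "f \<in> E" for f
  proof -
    have "L2_inner M (K f) (e i) = 0" if i: "i < m" for i
    proof -
      have "L2_inner M (e i) (K f) = L2_inner N (T (e i)) (T f)"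
        unfolding K_def by (rule T_adjoint[symmetric, OF e2[OF i] T_L2[OF E2[OF f]]])
      also have "\<dots> = of_real ((t i)\<^sup>2) * L2_inner M (e i) f"
        by (rule singular_inner[OF e[OF i] E2[OF f]])
      also have "L2_inner M (e i) f = 0"
        using f i L2_inner_commute[of M "e i" f] by (simp add: E_def)
      finally show ?thesis using L2_inner_commute[of M "K f" "e i"] by simp
    qed
    then show ?thesis using K2[OF E2[OF f]] by (simp add: E_def)
  qed
  have Tdiff: "Q (\<lambda>w. f w - g w) = Q f - 2 * Re (L2_inner M (K f) g) + Q g"
    if "f \<in> L2_space M" "g \<in> L2_space M" for f g
  proof -
    have "Q (\<lambda>w. f w - g w) = L2_sqnorm N (\<lambda>x. T f x - T g x)"
      unfolding Q_def by (rule L2_sqnorm_cong) (rule T_diff[OF that])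
    also have "\<dots> = Q f - 2 * Re (L2_inner N (T f) (T g)) + Q g"
      unfolding Q_def by (rule L2_sqnorm_diff[OF T_L2 T_L2, OF that])
    also have "L2_inner N (T g) (T f) = L2_inner M g (K f)"
      unfolding K_def by (rule T_adjoint[OF that(2) T_L2[OF that(1)]])
    then have "L2_inner N (T f) (T g) = L2_inner M (K f) g"
      by (metis L2_inner_commute)
    finally show ?thesis .
  qed
  have R0: "0 \<le> R f" if "f \<in> E" for f using lamQ[OF that] by (simp add: R_def)
  have Rle: "R f \<le> lam * L2_sqnorm M f" for f
    unfolding R_def Q_def using L2_sqnorm_nonneg[of N "T f"] by simp
  have key: "L2_sqnorm M (\<lambda>w. of_real lam * f w - K f w) \<le> lam * R f" if f: "f \<in> E" for f
  proof -
    define g where "g w = of_real lam * f w - K f w" for w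
    have g: "g \<in> E" unfolding g_def by (intro Ediff Escale KE f)
    \<comment> \<open>Here \<open>g\<close> is B f for the operator B = lam - T*T. Testing
      nonnegativity of \<open>R\<close> at f - g / lam gives |B f|^2 \<le> lam * <B f, f>, which
      holds for any nonnegative form bounded by lam times the squared norm.\<close>
    define h where "h w = of_real (1 / lam) * g w" for w
    have h: "h \<in> E" unfolding h_def by (intro Escale g)
    have gg: "L2_sqnorm M g = lam * Re (L2_inner M f g) - Re (L2_inner M (K f) g)"
    proof -
      have "L2_inner M g g = lam * L2_inner M f g - L2_inner M (K f) g"
        unfolding g_def[abs_def]
        using L2_inner_diff_left[OF L2_space_scale[OF E2[OF f], of "of_real lam"] K2[OF E2[OF f]] E2[OF g[unfolded g_def[abs_def]]]]
        by (simp add: L2_inner_scale_left)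
      then show ?thesis by (simp add: L2_inner_self complex_eq_iff)
    qed
    have fh: "L2_inner M f h = of_real (1 / lam) * L2_inner M f g" "L2_inner M (K f) h = of_real (1 / lam) * L2_inner M (K f) g"
      unfolding h_def[abs_def] L2_inner_scale_right by simp_all
    have "0 \<le> R (\<lambda>w. f w - h w)" by (intro R0 Ediff f h)
    also have "\<dots> = R f - 2 * (lam * Re (L2_inner M f h) - Re (L2_inner M (K f) h)) + R h"
      by (simp add: R_def Tdiff L2_sqnorm_diff E2 f h algebra_simps)
    also have "lam * Re (L2_inner M f h) - Re (L2_inner M (K f) h) = L2_sqnorm M g / lam"
      unfolding gg fh using lam0 by (simp add: field_simps)
    also have "R h \<le> lam * L2_sqnorm M h" by (rule Rle)
    also have "lam * L2_sqnorm M h = L2_sqnorm M g / lam"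
      unfolding h_def L2_sqnorm_scale using lam0 by (simp add: norm_divide power2_eq_square)
    finally have "L2_sqnorm M g / lam \<le> R f" by simp
    then show ?thesis using lam0 by (simp add: g_def[abs_def] field_simps)
  qed
  have "\<exists>f. f \<in> E \<and> L2_sqnorm M f = 1 \<and> lam - 1 / Suc n < Q f" for n
  proof -
    have "lam - 1 / Suc n < Sup A" by (simp add: lam_def)
    then obtain a where "a \<in> A" "lam - 1 / Suc n < a" using less_cSup_iff[OF A_ne bdd] by blast
    then show ?thesis by (auto simp: A_def)
  qed
  then obtain F where F: "\<And>n. F n \<in> E" "\<And>n. L2_sqnorm M (F n) = 1" "\<And>n. lam - 1 / Suc n < Q (F n)"
    by metis
  have RF: "R (F n) \<le> 1 / Suc n" for n using F(2,3)[of n] by (simp add: R_def)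
  obtain g p where g: "strict_mono (p :: nat \<Rightarrow> nat)"
    "\<And>\<epsilon>. 0 < \<epsilon> \<Longrightarrow> \<exists>n0. \<forall>n w. n \<ge> n0 \<and> w \<in> space M \<longrightarrow> norm (K (F (p n)) w - g w) < \<epsilon>"
  proof (rule Arzela_Ascoli[of "space M" "\<lambda>n. K (F n)" "sqrt (b\<^sup>2 * mN * (mN * (b\<^sup>2 * mM)))"])
    show "compact (space M)" by (rule compact_M)
    show "norm (K (F n) w) \<le> sqrt (b\<^sup>2 * mN * (mN * (b\<^sup>2 * mM)))" if "w \<in> space M" for n w
    proof (rule real_le_rsqrt)
      have "(cmod (K (F n) w))\<^sup>2 \<le> b\<^sup>2 * mN * L2_sqnorm N (T (F n))"
        unfolding K_def by (rule kernel_operator.T_pointwise[OF swap T_L2[OF E2[OF F(1)]] that])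
      also have "\<dots> \<le> b\<^sup>2 * mN * (mN * (b\<^sup>2 * mM))"
        using Qle[OF F(1)[of n]] F(2)[of n] by (intro mult_left_mono) (auto simp: Q_def)
      finally show "(cmod (K (F n) w))\<^sup>2 \<le> b\<^sup>2 * mN * (mN * (b\<^sup>2 * mM))" .
    qed
    show "\<exists>d>0. \<forall>n y. y \<in> space M \<and> norm (x - y) < d \<longrightarrow> norm (K (F n) x - K (F n) y) < \<epsilon>"
      if x: "x \<in> space M" and \<epsilon>: "0 < \<epsilon>" for x \<epsilon>
    proof -
      define D where "D = \<bar>mN * sqrt (b\<^sup>2 * mM) * L\<bar> + 1"
      have D: "0 < D" "mN * sqrt (b\<^sup>2 * mM) * L \<le> D" by (auto simp: D_def)
      have "norm (K (F n) x - K (F n) y) < \<epsilon>" if y: "y \<in> space M" "norm (x - y) < \<epsilon> / D" for n y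
      proof -
        have "norm (K (F n) x - K (F n) y) \<le> mN * sqrt (b\<^sup>2 * mM) * L * norm (x - y)"
          unfolding K_def by (intro Tadj_T_lipschitz E2 F x y)
        also have "\<dots> \<le> D * norm (x - y)" by (intro mult_right_mono D) auto
        also have "\<dots> < \<epsilon>" using y D by (simp add: field_simps)
        finally show ?thesis .
      qed
      then show ?thesis using D \<epsilon> by (intro exI[of _ "\<epsilon> / D"]) auto
    qed
  qed blast
  \<comment> \<open>Since lam F - K F tends to 0 and K F tends to \<open>g\<close> along the
    subsequence, the only possible limit of the maximising functions is g / lam.\<close>
  define u where "u w = of_real (1 / lam) * g w" for w
  have gM: "g \<in> borel_measurable M"
  proof (rule borel_measurable_LIMSEQ_metric)
    show "K (F (p n)) \<in> borel_measurable M" for n by (intro L2_spaceD(1)[OF K2[OF E2[OF F(1)]]])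
    show "(\<lambda>n. K (F (p n)) w) \<longlonglongrightarrow> g w" if "w \<in> space M" for w
      unfolding LIMSEQ_iff using g(2) that by blast
  qed
  have diffL2: "(\<lambda>w. K (F (p n)) w - g w) \<in> L2_space M"
    and small: "L2_sqnorm M (\<lambda>w. K (F (p n)) w - g w) \<le> \<epsilon>\<^sup>2 * mM"
    if "\<forall>w. w \<in> space M \<longrightarrow> norm (K (F (p n)) w - g w) < \<epsilon>" for n \<epsilon>
  proof -
    show L: "(\<lambda>w. K (F (p n)) w - g w) \<in> L2_space M"
    proof (rule L2_space_bounded[where b=\<epsilon>, OF finite_M])
      show "(\<lambda>w. K (F (p n)) w - g w) \<in> borel_measurable M"
        using gM L2_spaceD(1)[OF K2[OF E2[OF F(1)]]] by measurable
    qed (use that in \<open>auto intro: less_imp_le\<close>)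
    have "L2_sqnorm M (\<lambda>w. K (F (p n)) w - g w) \<le> (LINT w|M. \<epsilon>\<^sup>2)"
      unfolding L2_sqnorm_def
      by (rule integral_mono) (use that L2_spaceD[OF L] in \<open>auto intro!: power_mono simp: less_imp_le\<close>)
    then show "L2_sqnorm M (\<lambda>w. K (F (p n)) w - g w) \<le> \<epsilon>\<^sup>2 * mM" by (simp add: mult.commute)
  qed
  have g2: "g \<in> L2_space M"
  proof -
    obtain n where n: "\<forall>w. w \<in> space M \<longrightarrow> norm (K (F (p n)) w - g w) < 1" using g(2)[of 1] by auto
    show ?thesis
      using L2_space_diff[OF K2[OF E2[OF F(1)]] diffL2[OF n], of "p n"] by simp
  qed
  have u2: "u \<in> L2_space M" unfolding u_def by (intro L2_space_scale g2)
  have conv: "\<exists>n. L2_sqnorm M (\<lambda>w. u w - F (p n) w) < \<epsilon> \<and> R (F (p n)) < \<epsilon>" if \<epsilon>: "0 < \<epsilon>" for \<epsilon>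
  proof -
    \<comment> \<open>The 8 leaves room for the factor 2 of the parallelogram bound on both terms;
      \<open>mM + 1\<close> keeps the quotient meaningful when \<open>mM\<close> is 0.\<close>
    define \<delta> where "\<delta> = sqrt (\<epsilon> * lam\<^sup>2 / (8 * (mM + 1)))"
    have mM: "0 < mM + 1" by (simp add: add_nonneg_pos)
    have \<delta>: "\<delta>\<^sup>2 = \<epsilon> * lam\<^sup>2 / (8 * (mM + 1))" "\<delta> > 0"
      using \<epsilon> lam0 mM by (auto simp: \<delta>_def)
    obtain n0 where n0: "\<forall>n w. n \<ge> n0 \<and> w \<in> space M \<longrightarrow> norm (K (F (p n)) w - g w) < \<delta>"
      using g(2)[OF \<delta>(2)] by blast
    obtain n1 :: nat where n1: "1 / Suc n1 < min \<epsilon> (\<epsilon> * lam / 8)"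
      using nat_approx_posE[of "min \<epsilon> (\<epsilon> * lam / 8)"] \<epsilon> lam0 by auto
    define n where "n = max n0 n1"
    have "1 / Suc (p n) \<le> 1 / Suc n1"
      using seq_suble[OF g(1), of n] by (intro divide_left_mono) (auto simp: n_def)
    then have Rn: "R (F (p n)) < \<epsilon>" "R (F (p n)) < \<epsilon> * lam / 8" using RF[of "p n"] n1 by auto
    have n: "\<forall>w. w \<in> space M \<longrightarrow> norm (K (F (p n)) w - g w) < \<delta>" using n0 by (auto simp: n_def)
    let ?a = "\<lambda>w. of_real lam * F (p n) w - K (F (p n)) w" and ?b = "\<lambda>w. K (F (p n)) w - g w"
    have ab: "?a \<in> L2_space M" "?b \<in> L2_space M"
      by (intro L2_space_diff L2_space_scale E2 K2 F g2)+
    have "L2_sqnorm M (\<lambda>w. u w - F (p n) w) = L2_sqnorm M (\<lambda>w. of_real (- 1 / lam) * (?a w + ?b w))"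
      using lam0 by (intro L2_sqnorm_cong) (simp add: u_def field_simps)
    also have "\<dots> = L2_sqnorm M (\<lambda>w. ?a w + ?b w) / lam\<^sup>2"
      using lam0 unfolding L2_sqnorm_scale by (simp add: norm_divide power_divide)
    also have "\<dots> \<le> (2 * L2_sqnorm M ?a + 2 * L2_sqnorm M ?b) / lam\<^sup>2"
      using L2_sqnorm_parallelogram[OF ab] L2_sqnorm_nonneg[of M "\<lambda>w. ?a w - ?b w"]
      by (intro divide_right_mono) auto
    also have "\<dots> < \<epsilon>"
    proof -
      have "L2_sqnorm M ?a \<le> lam * R (F (p n))" by (rule key[OF F(1)])
      also have "\<dots> < lam * (\<epsilon> * lam / 8)" using Rn(2) lam0 by simp
      finally have a: "L2_sqnorm M ?a < \<epsilon> * lam\<^sup>2 / 8" by (simp add: power2_eq_square mult_ac)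
      have "L2_sqnorm M ?b \<le> \<epsilon> * lam\<^sup>2 / (8 * (mM + 1)) * mM" using small[OF n] unfolding \<delta>(1) .
      also have "\<dots> = \<epsilon> * lam\<^sup>2 / 8 * (mM / (mM + 1))" by simp
      also have "\<dots> \<le> \<epsilon> * lam\<^sup>2 / 8 * 1"
        using \<epsilon> mM by (intro mult_left_mono) auto
      finally have "L2_sqnorm M ?b \<le> \<epsilon> * lam\<^sup>2 / 8" by simp
      moreover have "0 < \<epsilon> * lam\<^sup>2" using \<epsilon> lam0 by simp
      ultimately have "2 * L2_sqnorm M ?a + 2 * L2_sqnorm M ?b < \<epsilon> * lam\<^sup>2" using a by linarith
      then show ?thesis using lam0 by (simp add: divide_less_eq)
    qed
    finally show ?thesis using Rn by blast
  qed
  have uE: "u \<in> E"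
  proof -
    have "L2_inner M u (e i) = 0" if i: "i < m" for i
    proof (rule ccontr)
      assume ne: "L2_inner M u (e i) \<noteq> 0"
      define \<epsilon> where "\<epsilon> = (cmod (L2_inner M u (e i)))\<^sup>2 / (L2_sqnorm M (e i) + 1)"
      have pos: "0 < L2_sqnorm M (e i) + 1" using L2_sqnorm_nonneg[of M "e i"] by simp
      have "0 < \<epsilon>" using ne pos by (simp add: \<epsilon>_def)
      from conv[OF this] obtain n where n: "L2_sqnorm M (\<lambda>w. u w - F (p n) w) < \<epsilon>" by blast
      have "L2_inner M u (e i) = L2_inner M (\<lambda>w. u w - F (p n) w) (e i)"
        using F(1)[of "p n"] i by (subst L2_inner_diff_left) (auto simp: E_def u2 e2)
      then have "(cmod (L2_inner M u (e i)))\<^sup>2 \<le> L2_sqnorm M (\<lambda>w. u w - F (p n) w) * L2_sqnorm M (e i)"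
        using L2_Cauchy_Schwarz[OF L2_space_diff[OF u2 E2[OF F(1)]] e2[OF i], of "p n"] by simp
      also have "\<dots> \<le> \<epsilon> * L2_sqnorm M (e i)"
        using n by (intro mult_right_mono L2_sqnorm_nonneg) auto
      also have "\<dots> < \<epsilon> * (L2_sqnorm M (e i) + 1)" using \<open>0 < \<epsilon>\<close> by simp
      also have "\<dots> = (cmod (L2_inner M u (e i)))\<^sup>2" using pos by (simp add: \<epsilon>_def)
      finally show False by simp
    qed
    then show ?thesis using u2 by (simp add: E_def)
  qed
  \<comment> \<open>Parallelogram law for the form \<open>R\<close>, with the nonnegative term at
    \<open>h - (f - h)\<close> dropped. It carries the smallness of \<open>R\<close> along the
    sequence over to the limit \<open>u\<close>.\<close>
  have Radd: "R f \<le> 2 * R h + 2 * R (\<lambda>w. f w - h w)" if fh: "f \<in> E" "h \<in> E" for f h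
  proof -
    have d: "(\<lambda>w. f w - h w) \<in> E" by (rule Ediff[OF fh])
    have "0 \<le> R (\<lambda>w. h w - (f w - h w))" by (intro R0 Ediff fh)
    also have "\<dots> = 2 * R h + 2 * R (\<lambda>w. f w - h w) - R f"
    proof -
      have m: "L2_sqnorm M (\<lambda>w. h w + (f w - h w)) + L2_sqnorm M (\<lambda>w. h w - (f w - h w))
          = 2 * L2_sqnorm M h + 2 * L2_sqnorm M (\<lambda>w. f w - h w)"
        by (rule L2_sqnorm_parallelogram[OF E2[OF fh(2)] E2[OF d]])
      have "L2_sqnorm N (\<lambda>x. T h x + T (\<lambda>w. f w - h w) x) + L2_sqnorm N (\<lambda>x. T h x - T (\<lambda>w. f w - h w) x)
          = 2 * Q h + 2 * Q (\<lambda>w. f w - h w)"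
        unfolding Q_def by (rule L2_sqnorm_parallelogram[OF T_L2[OF E2[OF fh(2)]] T_L2[OF E2[OF d]]])
      moreover have "L2_sqnorm N (\<lambda>x. T h x + T (\<lambda>w. f w - h w) x) = Q (\<lambda>w. h w + (f w - h w))"
        unfolding Q_def by (rule L2_sqnorm_cong) (rule T_add[symmetric, OF E2[OF fh(2)] E2[OF d]])
      moreover have "L2_sqnorm N (\<lambda>x. T h x - T (\<lambda>w. f w - h w) x) = Q (\<lambda>w. h w - (f w - h w))"
        unfolding Q_def by (rule L2_sqnorm_cong) (rule T_diff[symmetric, OF E2[OF fh(2)] E2[OF d]])
      ultimately have "Q (\<lambda>w. h w + (f w - h w)) + Q (\<lambda>w. h w - (f w - h w)) = 2 * Q h + 2 * Q (\<lambda>w. f w - h w)"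
        by simp
      moreover have "(\<lambda>w. h w + (f w - h w)) = f" by simp
      ultimately have q: "Q (\<lambda>w. h w - (f w - h w)) = 2 * Q h + 2 * Q (\<lambda>w. f w - h w) - Q f" by simp
      have mm: "L2_sqnorm M (\<lambda>w. h w - (f w - h w)) = 2 * L2_sqnorm M h + 2 * L2_sqnorm M (\<lambda>w. f w - h w) - L2_sqnorm M f"
        using m \<open>(\<lambda>w. h w + (f w - h w)) = f\<close> by simp
      show ?thesis unfolding R_def q mm by (simp only: right_diff_distrib distrib_left mult.left_commute)
    qed
    finally show ?thesis by simp
  qed
  have "R u \<le> 0 + \<epsilon>" if \<epsilon>: "0 < \<epsilon>" for \<epsilon>
  proof -
    define \<delta> where "\<delta> = \<epsilon> / (2 + 2 * lam)"
    have "0 < \<delta>" using \<epsilon> lam0 by (simp add: \<delta>_def)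
    from conv[OF this] obtain n where n: "L2_sqnorm M (\<lambda>w. u w - F (p n) w) < \<delta>" "R (F (p n)) < \<delta>" by blast
    have "R u \<le> 2 * R (F (p n)) + 2 * R (\<lambda>w. u w - F (p n) w)" by (rule Radd[OF uE F(1)])
    also have "\<dots> \<le> 2 * \<delta> + 2 * (lam * \<delta>)"
    proof -
      have "R (\<lambda>w. u w - F (p n) w) \<le> lam * L2_sqnorm M (\<lambda>w. u w - F (p n) w)" by (rule Rle)
      also have "\<dots> \<le> lam * \<delta>" using n lam0 by simp
      finally show ?thesis using n by simp
    qed
    also have "\<dots> = (2 + 2 * lam) * \<delta>" by (simp add: algebra_simps)
    also have "\<dots> = \<epsilon>" using lam0 by (simp add: \<delta>_def)
    finally show ?thesis by simp
  qed
  then have "R u \<le> 0" by (rule field_le_epsilon)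
  then have "L2_sqnorm M (\<lambda>w. of_real lam * u w - K u w) \<le> 0"
    using key[OF uE] lam0 by (smt (verit) mult_nonneg_nonpos)
  then have "L2_sqnorm M (\<lambda>w. of_real lam * u w - K u w) = 0"
    using L2_sqnorm_nonneg[of M "\<lambda>w. of_real lam * u w - K u w"] by simp
  then have ae: "AE w in M. of_real lam * u w - K u w = 0"
    by (subst (asm) L2_sqnorm_eq_0_iff) (intro L2_space_diff L2_space_scale u2 K2)
  \<comment> \<open>A normalised function lies within squared distance below 1/2 of
    \<open>u\<close>, so 1 < 2 |u|^2 + 1 and \<open>u\<close> cannot vanish.\<close>
  have upos: "0 < L2_sqnorm M u"
  proof -
    obtain n where n: "L2_sqnorm M (\<lambda>w. u w - F (p n) w) < 1 / 2" using conv[of "1/2"] by auto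
    have d: "(\<lambda>w. u w - F (p n) w) \<in> L2_space M" by (intro L2_space_diff u2 E2 F)
    have "L2_sqnorm M (\<lambda>w. u w - (u w - F (p n) w)) \<le> 2 * L2_sqnorm M u + 2 * L2_sqnorm M (\<lambda>w. u w - F (p n) w)"
      using L2_sqnorm_parallelogram[OF u2 d] L2_sqnorm_nonneg[of M "\<lambda>w. u w + (u w - F (p n) w)"] by linarith
    then show ?thesis using F(2)[of "p n"] n by simp
  qed
  obtain c where c: "c > 0" "L2_sqnorm M (\<lambda>w. of_real c * u w) = 1" using normalise[OF upos] by blast
  let ?f = "\<lambda>w. of_real c * u w"
  have "?f \<in> singular_space M N T (sqrt lam)"
    unfolding singular_space_iff
  proof
    show "?f \<in> L2_space M" by (intro L2_space_scale u2)
    have "Tadj (T ?f) w = of_real c * K u w" for w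
    proof -
      have "T ?f = (\<lambda>x. of_real c * T u x)" using T_scale by blast
      then show ?thesis
        unfolding K_def using kernel_operator.T_scale[OF swap] by simp
    qed
    moreover have "AE w in M. of_real c * K u w = complex_of_real ((sqrt lam)\<^sup>2) * ?f w"
      using ae
    proof eventually_elim
      case (elim w)
      then have "K u w = of_real lam * u w" by simp
      then show ?case using lam0 by (simp add: real_sqrt_pow2 mult_ac flip: of_real_power)
    qed
    ultimately show "AE w in M. Tadj (T ?f) w = complex_of_real ((sqrt lam)\<^sup>2) * ?f w" by simp
  qed
  moreover have "s \<le> sqrt lam" using lam_s s by (intro real_le_rsqrt)
  moreover have "?f \<in> E" by (intro Escale uE)
  ultimately show ?thesis using c by (intro exI[of _ ?f] exI[of _ "sqrt lam"]) (auto simp: E_def)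
qed

text \<open>Orthonormal eigenvectors are built one at a time. As long as fewer than \<open>n\<close>
  are found, the test functions admit a nonzero combination orthogonal to all of them, and
  \<open>T\<close> still enlarges it by at least \<open>s\<close>; maximising over the orthogonal
  complement yields the next eigenvector with value at least \<open>s\<close>. Orthonormality then
  gives the independence that the definition asks for.\<close>

lemma singular_value_ge:
  assumes s: "0 < s" and v: "\<And>i. i < n \<Longrightarrow> v i \<in> L2_space M"
    and pos: "\<And>c. (\<exists>i<n. c i \<noteq> 0) \<Longrightarrow> 0 < L2_sqnorm M (\<lambda>w. \<Sum>i<n. c i * v i w)"
    and large: "\<And>c. s\<^sup>2 * L2_sqnorm M (\<lambda>w. \<Sum>i<n. c i * v i w) \<le> L2_sqnorm N (T (\<lambda>w. \<Sum>i<n. c i * v i w))"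
    and j: "1 \<le> j" "j \<le> n"
  shows "s \<le> singular_value M N T j"
proof -
  have "m \<le> n \<Longrightarrow> \<exists>e t. (\<forall>i<m. s \<le> t i \<and> e i \<in> singular_space M N T (t i) \<and> L2_sqnorm M (e i) = 1) \<and>
      (\<forall>i<m. \<forall>l<m. i \<noteq> l \<longrightarrow> L2_inner M (e i) (e l) = 0)" for m
  proof (induction m)
    case (Suc m)
    then obtain e t where e: "\<And>i. i < m \<Longrightarrow> s \<le> t i" "\<And>i. i < m \<Longrightarrow> e i \<in> singular_space M N T (t i)"
      "\<And>i. i < m \<Longrightarrow> L2_sqnorm M (e i) = 1" "\<And>i l. i < m \<Longrightarrow> l < m \<Longrightarrow> i \<noteq> l \<Longrightarrow> L2_inner M (e i) (e l) = 0"
      by (metis Suc_leD)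
    obtain c where c: "\<exists>i<n. c i \<noteq> 0" "\<forall>l\<in>{..<m}. (\<Sum>i<n. L2_inner M (v i) (e l) * c i) = 0"
      using underdetermined_system[of "{..<m}" n "\<lambda>l i. L2_inner M (v i) (e l)"] Suc.prems by auto
    let ?V = "\<lambda>w. \<Sum>i<n. c i * v i w"
    have V: "?V \<in> L2_space M" by (intro L2_space_sum) (auto intro: v)
    have "L2_inner M ?V (e l) = 0" if "l < m" for l
      using that c(2) e(2)[OF that] v
      by (subst L2_inner_sum_left) (auto simp: singular_space_iff mult.commute)
    from eigenvector_orthogonal[where e=e and m=m and t=t, OF e(2) V this pos[OF c(1)] large s]
    obtain f r where f: "s \<le> r" "f \<in> singular_space M N T r" "L2_sqnorm M f = 1" "\<forall>i<m. L2_inner M f (e i) = 0"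
      by blast
    have "L2_inner M (e i) f = 0" if "i < m" for i
      using f(4) that L2_inner_commute[of M "e i" f] by simp
    then show ?case
      using f e by (intro exI[of _ "e(m := f)"] exI[of _ "t(m := r)"]) (auto simp: less_Suc_eq)
  qed auto
  from this[OF j(2)] obtain e t where e: "\<And>i. i < j \<Longrightarrow> s \<le> t i" "\<And>i. i < j \<Longrightarrow> e i \<in> singular_space M N T (t i)"
    "\<And>i. i < j \<Longrightarrow> L2_sqnorm M (e i) = 1" "\<And>i l. i < j \<Longrightarrow> l < j \<Longrightarrow> i \<noteq> l \<Longrightarrow> L2_inner M (e i) (e l) = 0"
    by blast
  have e2: "\<And>i. i < j \<Longrightarrow> e i \<in> L2_space M" using e(2) by (auto simp: singular_space_iff)
  have "L2_independent M j e"
    unfolding L2_independent_def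
  proof (intro allI impI)
    fix c i assume ae: "AE x in M. (\<Sum>i<j. c i * e i x) = 0" and i: "i < j"
    have S: "(\<lambda>x. \<Sum>i<j. c i * e i x) \<in> L2_space M" by (intro L2_space_sum) (auto intro: e2)
    have "0 = L2_inner M (\<lambda>x. 0) (e i)" by (simp add: L2_inner_def)
    also have "\<dots> = L2_inner M (\<lambda>x. \<Sum>i<j. c i * e i x) (e i)"
      using ae by (intro L2_inner_cong_AE L2_spaceD(1)[OF S] L2_spaceD(1)[OF e2[OF i]]) auto
    also have "\<dots> = (\<Sum>l<j. c l * L2_inner M (e l) (e i))"
      by (rule L2_inner_sum_left) (auto intro: e2 i)
    also have "\<dots> = (\<Sum>l<j. if l = i then c i else 0)"
      by (intro sum.cong refl) (auto simp: e(3,4) i L2_inner_self)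
    also have "\<dots> = c i" using i by simp
    finally show "c i = 0" by simp
  qed
  then have "s \<in> insert 0 {s. 0 < s \<and>
       (\<exists>f. L2_independent M j f \<and> (\<forall>i<j. \<exists>t\<ge>s. f i \<in> singular_space M N T t))}"
    using s e by blast
  moreover have "bdd_above (insert 0 {s. 0 < s \<and>
       (\<exists>f. L2_independent M j f \<and> (\<forall>i<j. \<exists>t\<ge>s. f i \<in> singular_space M N T t))})"
  \<comment> \<open>The operator norm bounds the set; the combination with all coefficients 1 is a
    nonzero one because \<open>j \<ge> 1\<close>.\<close>
  proof (rule singular_value_le(2)[where s="sqrt (mN * (b\<^sup>2 * mM))"])
    fix f assume f: "\<And>i. i < j \<Longrightarrow> f i \<in> L2_space M"
    show "\<exists>c. (\<exists>i<j. c i \<noteq> 0) \<and> L2_sqnorm N (T (\<lambda>w. \<Sum>i<j. c i * f i w))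
        \<le> (sqrt (mN * (b\<^sup>2 * mM)))\<^sup>2 * L2_sqnorm M (\<lambda>w. \<Sum>i<j. c i * f i w)"
      using j T_sqnorm_le[OF L2_space_sum[of "{..<j}" f M "\<lambda>_. 1"]] f
      by (intro exI[of _ "\<lambda>_. 1"] conjI exI[of _ 0]) auto
  qed simp
  ultimately show ?thesis unfolding singular_value_def by (rule cSup_upper)
qed

end

section \<open>Gaussians and the surface measure\<close>

text \<open>The characteristic function of the standard normal law, rescaled by
  \<open>c = sqrt (2 * s)\<close>.\<close>

lemma gaussian_fourier_real:
  fixes s \<xi> :: real
  assumes s: "0 < s"
  shows "integrable lborel (\<lambda>x. iexp (\<xi> * x) * of_real (exp (- s * x\<^sup>2)))" (is "integrable _ ?g")
    and "(LINT x|lborel. iexp (\<xi> * x) * of_real (exp (- s * x\<^sup>2))) = of_real (sqrt (pi / s) * exp (- \<xi>\<^sup>2 / (4 * s)))"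
proof -
  define c where "c = sqrt (2 * s)"
  define t where "t = \<xi> / c"
  have c: "0 < c" "c\<^sup>2 = 2 * s" using s by (auto simp: c_def)
  define h where "h x = std_normal_density x *\<^sub>R iexp (t * x)" for x
  have h_c: "h (0 + c * x) = of_real (1 / sqrt (2 * pi)) * ?g x" for x
  proof -
    have "- (c * x)\<^sup>2 / 2 = - s * x\<^sup>2" by (simp add: power_mult_distrib c)
    moreover have "t * (c * x) = \<xi> * x" using c by (simp add: t_def)
    ultimately show ?thesis
      unfolding h_def std_normal_density_def by (simp only: add_0 scaleR_conv_of_real of_real_mult mult_ac)
  qed
  have ih: "integrable lborel h"
  proof (rule Bochner_Integration.integrable_bound)
    show "integrable lborel std_normal_density" by simp
    show "h \<in> borel_measurable lborel" unfolding h_def by measurable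
    show "AE x in lborel. norm (h x) \<le> norm (std_normal_density x)"
      by (simp add: h_def)
  qed
  have "integrable lborel (\<lambda>x. of_real (sqrt (2 * pi)) * h (0 + c * x))"
    by (intro integrable_mult_right lborel_integrable_real_affine[OF ih]) (use c in auto)
  then show "integrable lborel ?g"
    unfolding h_c mult.assoc[symmetric] of_real_mult[symmetric] by simp
  have "integral\<^sup>L lborel h = char std_normal_distribution t"
    unfolding char_def h_def by (subst integral_density) (auto simp: normal_density_nonneg)
  then have "of_real (exp (- t\<^sup>2 / 2)) = integral\<^sup>L lborel h"
    by (simp add: char_std_normal_distribution)
  also have "\<dots> = \<bar>c\<bar> *\<^sub>R (LINT x|lborel. h (0 + c * x))"
    by (rule lborel_integral_real_affine) (use c in auto)
  also have "\<dots> = of_real (c / sqrt (2 * pi)) * (LINT x|lborel. ?g x)"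
    unfolding h_c using c by (simp add: scaleR_conv_of_real)
  finally have "of_real (sqrt (2 * pi) / c) * complex_of_real (exp (- t\<^sup>2 / 2)) = (LINT x|lborel. ?g x)"
    using c by simp
  moreover have "sqrt (2 * pi) / c = sqrt (pi / s)"
    using s by (simp add: c_def real_sqrt_divide real_sqrt_mult)
  moreover have "- t\<^sup>2 / 2 = - \<xi>\<^sup>2 / (4 * s)"
    by (simp add: t_def power_divide c)
  ultimately show "(LINT x|lborel. ?g x) = of_real (sqrt (pi / s) * exp (- \<xi>\<^sup>2 / (4 * s)))"
    by simp
qed

text \<open>Phase and Gaussian both factor over an orthonormal basis, and Lebesgue measure is the
  image of a product measure.\<close>

lemma gaussian_fourier:
  fixes \<xi> :: "'a::euclidean_space"
  assumes s: "0 < s"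
  shows "integrable lborel (\<lambda>x. iexp (\<xi> \<bullet> x) * of_real (exp (- s * (norm x)\<^sup>2)))" (is "integrable _ ?g")
    and "(LINT x|lborel. iexp (\<xi> \<bullet> x) * of_real (exp (- s * (norm x)\<^sup>2)))
      = of_real (sqrt (pi / s) ^ DIM('a) * exp (- (norm \<xi>)\<^sup>2 / (4 * s)))"
proof -
  interpret P: product_sigma_finite "\<lambda>b::'a. lborel :: real measure" ..
  let ?P = "\<Pi>\<^sub>M b\<in>(Basis::'a set). (lborel :: real measure)"
  let ?e = "\<lambda>f. \<Sum>b\<in>(Basis::'a set). f b *\<^sub>R b"
  let ?h = "\<lambda>(b::'a) x. iexp ((\<xi> \<bullet> b) * x) * of_real (exp (- s * x\<^sup>2))"
  have e [measurable]: "?e \<in> ?P \<rightarrow>\<^sub>M borel" by measurable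
  have g [measurable]: "?g \<in> borel_measurable borel" by measurable
  have ge: "?g (?e f) = (\<Prod>b\<in>Basis. ?h b (f b))" for f
  proof -
    have e1: "\<xi> \<bullet> ?e f = (\<Sum>b\<in>Basis. (\<xi> \<bullet> b) * f b)"
      by (simp add: inner_sum_right mult.commute)
    have "(norm (?e f))\<^sup>2 = (\<Sum>b\<in>Basis. (f b)\<^sup>2)"
      unfolding power2_norm_eq_inner
      by (subst euclidean_inner) (simp add: power2_eq_square)
    then have e2: "exp (- s * (norm (?e f))\<^sup>2) = (\<Prod>b\<in>Basis. exp (- s * (f b)\<^sup>2))"
      by (simp add: sum_distrib_left exp_sum flip: sum_negf)
    have e3: "iexp (\<xi> \<bullet> ?e f) = (\<Prod>b\<in>Basis. iexp ((\<xi> \<bullet> b) * f b))"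
      unfolding e1 by (simp add: sum_distrib_left exp_sum)
    show ?thesis unfolding e2 e3 by (simp add: prod.distrib)
  qed
  have int: "integrable ?P (\<lambda>f. \<Prod>b\<in>Basis. ?h b (f b))"
    by (rule P.product_integrable_prod[OF finite_Basis gaussian_fourier_real(1)[OF s]])
  then have "integrable ?P (\<lambda>f. ?g (?e f))" unfolding ge .
  then show "integrable lborel ?g"
    unfolding lborel_eq[where ?'a='a] using integrable_distr_eq[OF e g] by blast
  have "(LINT x|lborel. ?g x) = (LINT f|?P. ?g (?e f))"
    unfolding lborel_eq[where ?'a='a] by (subst integral_distr) auto
  also have "\<dots> = (\<Prod>b\<in>Basis. LINT x|lborel. ?h b x)"
    unfolding ge by (rule P.product_integral_prod[OF finite_Basis gaussian_fourier_real(1)[OF s]])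
  also have "\<dots> = (\<Prod>b\<in>(Basis::'a set). of_real (sqrt (pi / s) * exp (- (\<xi> \<bullet> b)\<^sup>2 / (4 * s))))"
    by (simp only: gaussian_fourier_real(2)[OF s])
  also have "\<dots> = of_real (sqrt (pi / s) ^ DIM('a) * (\<Prod>b\<in>(Basis::'a set). exp (- (\<xi> \<bullet> b)\<^sup>2 / (4 * s))))"
    by (simp add: prod.distrib)
  also have "(\<Prod>b\<in>(Basis::'a set). exp (- (\<xi> \<bullet> b)\<^sup>2 / (4 * s))) = exp (- (norm \<xi>)\<^sup>2 / (4 * s))"
    unfolding exp_sum[OF finite_Basis, symmetric]
    unfolding power2_norm_eq_inner
    by (subst euclidean_inner) (simp add: power2_eq_square sum_divide_distrib sum_negf)
  finally show "(LINT x|lborel. ?g x) = of_real (sqrt (pi / s) ^ DIM('a) * exp (- (norm \<xi>)\<^sup>2 / (4 * s)))" .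
qed

lemma gaussian_integral:
  assumes s: "0 < s"
  shows "integrable lborel (\<lambda>x::'a::euclidean_space. exp (- s * (norm x)\<^sup>2))"
    and "(LINT x|lborel. exp (- s * (norm (x::'a))\<^sup>2)) = sqrt (pi / s) ^ DIM('a)"
proof -
  show i: "integrable lborel (\<lambda>x::'a. exp (- s * (norm x)\<^sup>2))"
    using gaussian_fourier(1)[OF s, of "0::'a"] complex_of_real_integrable_eq[of lborel "\<lambda>x::'a. exp (- s * (norm x)\<^sup>2)"]
    by simp
  show "(LINT x|lborel. exp (- s * (norm (x::'a))\<^sup>2)) = sqrt (pi / s) ^ DIM('a)"
    using gaussian_fourier(2)[OF s, of "0::'a"] by (simp del: of_real_exp of_real_power of_real_mult)
qed

section \<open>Surface measure, spherical caps and separated nets\<close>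

lemma space_surface_measure [simp]: "space surface_measure = sphere 0 1"
  by (simp add: surface_measure_def space_scale_measure space_restrict_space)

lemma sets_surface_measure [measurable_cong]:
  "sets surface_measure = sets (restrict_space borel (sphere 0 1))"
  by (simp add: surface_measure_def)

lemma measurable_surface_measure: "f \<in> measurable borel X \<Longrightarrow> f \<in> measurable surface_measure X"
  unfolding measurable_cong_sets[OF sets_surface_measure refl] by (rule measurable_restrict_space1)

lemma nn_integral_surface_measure:
  fixes f :: "real ^ 'n \<Rightarrow> ennreal"
  assumes [measurable]: "f \<in> borel_measurable borel"
  shows "(\<integral>\<^sup>+w. f w \<partial>surface_measure)
    = of_nat CARD('n) * (\<integral>\<^sup>+x. f (x /\<^sub>R norm x) * indicator (ball 0 1 - {0}) x \<partial>lborel)"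
proof -
  have f: "f \<in> borel_measurable (restrict_space borel (sphere 0 1))"
    by (rule measurable_restrict_space1) measurable
  show ?thesis
    unfolding surface_measure_def
    by (subst nn_integral_scale_measure)
       (simp_all add: f nn_integral_distr[OF measurable_radial_projection] nn_integral_restrict_space)
qed

lemma emeasure_ball_finite: "emeasure lborel (ball (x::'a::euclidean_space) r) < \<infinity>"
  by (rule emeasure_bounded_finite) simp

lemma finite_surface_measure: "finite_measure (surface_measure :: (real ^ 'n) measure)"
proof
  have "emeasure surface_measure (sphere 0 1 :: (real ^ 'n) set)
      \<le> of_nat CARD('n) * emeasure lborel (ball (0 :: real ^ 'n) 1)"
    by (subst emeasure_surface_measure) (auto intro!: mult_left_mono emeasure_mono)
  also have "\<dots> < \<infinity>"
    using emeasure_ball_finite[of "0 :: real ^ 'n" 1] by (simp add: ennreal_mult_less_top of_nat_less_top)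
  finally show "emeasure surface_measure (space (surface_measure :: (real ^ 'n) measure)) \<noteq> \<infinity>" by simp
qed

lemma finite_unit_ball_measure: "finite_measure (unit_ball_measure :: (real ^ 'n) measure)"
  unfolding unit_ball_measure_def
  using emeasure_ball_finite[of "0 :: real ^ 'n" 1]
  by (intro finite_measureI) (simp add: space_restrict_space emeasure_restrict_space)

lemma nn_integral_gaussian_translate:
  fixes c :: "'a::euclidean_space"
  assumes s: "0 < s"
  shows "(\<integral>\<^sup>+x. ennreal (exp (- s * (norm (x - c))\<^sup>2)) \<partial>lborel) = ennreal (sqrt (pi / s) ^ DIM('a))"
proof -
  have "(\<integral>\<^sup>+x. ennreal (exp (- s * (norm (x - c))\<^sup>2)) \<partial>lborel)
      = (\<integral>\<^sup>+x. ennreal (exp (- s * (norm (x - c))\<^sup>2)) \<partial>(distr lborel borel ((+) c)))"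
    by (simp add: lborel_distr_plus)
  also have "\<dots> = (\<integral>\<^sup>+x. ennreal (exp (- s * (norm (x::'a))\<^sup>2)) \<partial>lborel)"
    by (subst nn_integral_distr) auto
  also have "\<dots> = ennreal (sqrt (pi / s) ^ DIM('a))"
    using gaussian_integral[where ?'a='a, OF s] by (subst nn_integral_eq_integral) auto
  finally show ?thesis .
qed

text \<open>The cone over a cap of radius \<open>1/\<kappa>\<close> is a tube of that radius around the segment from \<open>0\<close> to
  \<open>\<omega>\<close>; the Gaussian of the tube is dominated by the average of the Gaussians centred at the points
  \<open>t \<omega>\<close>, \<open>0 \<le> t \<le> 2\<close>.\<close>

lemma radial_gaussian_le:
  fixes x w :: "'a::euclidean_space"
  assumes a: "0 < a" and \<kappa>: "1 \<le> \<kappa>" and w: "norm w = 1" and x: "0 < norm x" "norm x < 1"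
  shows "ennreal (exp (- a * (\<kappa> * norm (w - x /\<^sub>R norm x))\<^sup>2))
    \<le> ennreal (\<kappa> * exp a) * (\<integral>\<^sup>+t. ennreal (exp (- (a * \<kappa>\<^sup>2 / 2) * (norm (x - t *\<^sub>R w))\<^sup>2)) * indicator {0..2} t \<partial>lborel)"
proof -
  define e where "e = exp (- a * (\<kappa> * norm (w - x /\<^sub>R norm x))\<^sup>2)"
  let ?g = "\<lambda>t. exp (- (a * \<kappa>\<^sup>2 / 2) * (norm (x - t *\<^sub>R w))\<^sup>2)"
  \<comment> \<open>For t between |x| and |x| + 1/\<kappa> the point t w is within d + 1/\<kappa> of
    x; (y + 1)^2 \<le> 2 y^2 + 2 then costs half the rate and the factor \<open>exp a\<close>. The
    prefactor \<open>\<kappa>\<close> divides by the length of this interval, which lies in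
    [0, 2].\<close>
  have le: "e \<le> exp a * ?g t" if t: "norm x \<le> t" "t \<le> norm x + 1 / \<kappa>" for t
  proof -
    define d where "d = norm (w - x /\<^sub>R norm x)"
    have "norm (x - norm x *\<^sub>R w) = norm (norm x *\<^sub>R (x /\<^sub>R norm x - w))"
      using x by (simp add: scaleR_diff_right)
    also have "\<dots> = norm x * d" by (simp add: d_def norm_minus_commute)
    also have "\<dots> \<le> d" using x by (simp add: d_def mult_left_le_one_le)
    finally have 1: "norm (x - norm x *\<^sub>R w) \<le> d" .
    have "norm (x - t *\<^sub>R w) = norm ((x - norm x *\<^sub>R w) + (norm x - t) *\<^sub>R w)"
      by (simp add: algebra_simps)
    also have "\<dots> \<le> norm (x - norm x *\<^sub>R w) + \<bar>norm x - t\<bar> * norm w"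
      by (metis norm_triangle_ineq norm_scaleR)
    also have "\<dots> \<le> d + 1 / \<kappa>" using 1 t w by simp
    finally have "\<kappa> * norm (x - t *\<^sub>R w) \<le> \<kappa> * d + 1" using \<kappa> by (simp add: field_simps)
    then have "(\<kappa> * norm (x - t *\<^sub>R w))\<^sup>2 \<le> (\<kappa> * d + 1)\<^sup>2" using \<kappa> by (intro power_mono) auto
    also have "\<dots> \<le> 2 * (\<kappa> * d)\<^sup>2 + 2"
      using sum_squares_bound[of "\<kappa> * d" 1] by (simp add: power2_sum)
    finally have "a / 2 * (\<kappa> * norm (x - t *\<^sub>R w))\<^sup>2 \<le> a / 2 * (2 * (\<kappa> * d)\<^sup>2 + 2)"
      using a by (intro mult_left_mono) auto
    then have "- a * (\<kappa> * d)\<^sup>2 \<le> a + - (a * \<kappa>\<^sup>2 / 2) * (norm (x - t *\<^sub>R w))\<^sup>2"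
      by (simp add: power_mult_distrib algebra_simps)
    then show ?thesis unfolding e_def d_def[symmetric] by (simp flip: exp_add)
  qed
  have "1 / \<kappa> \<le> 1" using \<kappa> by simp
  have "ennreal e = ennreal \<kappa> * (\<integral>\<^sup>+t. ennreal e * indicator {norm x .. norm x + 1 / \<kappa>} t \<partial>lborel)"
    using \<kappa> by (simp add: nn_integral_cmult_indicator e_def ennreal_mult'[symmetric])
  also have "\<dots> \<le> ennreal \<kappa> * (\<integral>\<^sup>+t. ennreal (exp a) * (ennreal (?g t) * indicator {0..2} t) \<partial>lborel)"
  proof (intro mult_left_mono nn_integral_mono)
    fix t :: real
    show "ennreal e * indicator {norm x .. norm x + 1 / \<kappa>} t \<le> ennreal (exp a) * (ennreal (?g t) * indicator {0..2} t)"
      using le[of t] x \<open>1 / \<kappa> \<le> 1\<close> norm_ge_zero[of x] order_trans[OF norm_ge_zero, of x t]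
      by (auto simp: indicator_def ennreal_mult'[symmetric] intro!: ennreal_leI)
  qed auto
  also have "\<dots> = ennreal \<kappa> * (ennreal (exp a) * (\<integral>\<^sup>+t. ennreal (?g t) * indicator {0..2} t \<partial>lborel))"
    by (subst nn_integral_cmult) auto
  also have "\<dots> = ennreal (\<kappa> * exp a) * (\<integral>\<^sup>+t. ennreal (?g t) * indicator {0..2} t \<partial>lborel)"
    using \<kappa> by (simp add: ennreal_mult mult.assoc)
  finally show ?thesis by (simp add: e_def)
qed

text \<open>For fixed \<open>t\<close> the \<open>x\<close>-integral is a full Gaussian, of order
  \<kappa>^{-n}; the prefactor \<open>\<kappa>\<close> of the radial average leaves
  \<kappa>^{-(n-1)}, the scaling of a surface of dimension n - 1. This is the row bound for the
  Schur test.\<close>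

lemma surface_gaussian_le:
  fixes w :: "real ^ 'n"
  assumes a: "0 < a" and \<kappa>: "1 \<le> \<kappa>" and w: "norm w = 1"
  shows "(\<integral>\<^sup>+w'. ennreal (exp (- a * (\<kappa> * norm (w - w'))\<^sup>2)) \<partial>surface_measure)
    \<le> ennreal (2 * real CARD('n) * exp a * sqrt (2 * pi / a) ^ CARD('n) / \<kappa> ^ (CARD('n) - 1))"
proof -
  let ?n = "CARD('n)"
  let ?g = "\<lambda>x t. ennreal (exp (- (a * \<kappa>\<^sup>2 / 2) * (norm (x - t *\<^sub>R w))\<^sup>2)) * indicator {0..2} t"
  have "(\<integral>\<^sup>+w'. ennreal (exp (- a * (\<kappa> * norm (w - w'))\<^sup>2)) \<partial>surface_measure)
      = of_nat ?n * (\<integral>\<^sup>+x. ennreal (exp (- a * (\<kappa> * norm (w - x /\<^sub>R norm x))\<^sup>2)) * indicator (ball 0 1 - {0}) x \<partial>lborel)"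
    by (rule nn_integral_surface_measure) measurable
  also have "\<dots> \<le> of_nat ?n * (\<integral>\<^sup>+x. ennreal (\<kappa> * exp a) * (\<integral>\<^sup>+t. ?g x t \<partial>lborel) \<partial>lborel)"
    using radial_gaussian_le[OF a \<kappa> w]
    by (intro mult_left_mono nn_integral_mono) (auto simp: indicator_def split: if_splits)
  also have "\<dots> = of_nat ?n * (ennreal (\<kappa> * exp a) * (\<integral>\<^sup>+x. (\<integral>\<^sup>+t. ?g x t \<partial>lborel) \<partial>lborel))"
    by (subst nn_integral_cmult) auto
  also have "(\<integral>\<^sup>+x. (\<integral>\<^sup>+t. ?g x t \<partial>lborel) \<partial>lborel) = (\<integral>\<^sup>+t. (\<integral>\<^sup>+x. ?g x t \<partial>lborel) \<partial>lborel)"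
    by (rule lborel_pair.Fubini') measurable
  also have "\<dots> = (\<integral>\<^sup>+t. ennreal (sqrt (pi / (a * \<kappa>\<^sup>2 / 2)) ^ ?n) * indicator {0..2} (t::real) \<partial>lborel)"
  proof (rule nn_integral_cong)
    fix t :: real
    have "(\<integral>\<^sup>+x. ?g x t \<partial>lborel)
        = (\<integral>\<^sup>+x. ennreal (exp (- (a * \<kappa>\<^sup>2 / 2) * (norm (x - t *\<^sub>R w))\<^sup>2)) \<partial>lborel) * indicator {0..2} t"
      by (rule nn_integral_multc) measurable
    also have "(\<integral>\<^sup>+x. ennreal (exp (- (a * \<kappa>\<^sup>2 / 2) * (norm (x - t *\<^sub>R w))\<^sup>2)) \<partial>lborel)
        = ennreal (sqrt (pi / (a * \<kappa>\<^sup>2 / 2)) ^ DIM(real ^ 'n))"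
      using a \<kappa> by (intro nn_integral_gaussian_translate) auto
    finally show "(\<integral>\<^sup>+x. ?g x t \<partial>lborel)
        = ennreal (sqrt (pi / (a * \<kappa>\<^sup>2 / 2)) ^ ?n) * indicator {0..2} t" by simp
  qed
  also have "\<dots> = ennreal (sqrt (pi / (a * \<kappa>\<^sup>2 / 2)) ^ ?n) * ennreal 2"
    by (simp add: nn_integral_cmult_indicator)
  also have "sqrt (pi / (a * \<kappa>\<^sup>2 / 2)) = sqrt (2 * pi / a) / \<kappa>"
    using \<kappa> by (simp add: real_sqrt_divide real_sqrt_mult field_simps)
  also have "of_nat ?n * (ennreal (\<kappa> * exp a) * (ennreal ((sqrt (2 * pi / a) / \<kappa>) ^ ?n) * ennreal 2))
      = ennreal (real ?n * (\<kappa> * exp a * ((sqrt (2 * pi / a) / \<kappa>) ^ ?n * 2)))"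
    using \<kappa> a by (simp add: ennreal_mult ennreal_of_nat_eq_real_of_nat)
  also have "real ?n * (\<kappa> * exp a * ((sqrt (2 * pi / a) / \<kappa>) ^ ?n * 2))
      = 2 * real ?n * exp a * sqrt (2 * pi / a) ^ ?n / \<kappa> ^ (?n - 1)"
  proof -
    have "\<kappa> ^ ?n = \<kappa> * \<kappa> ^ (?n - 1)" by (metis power_Suc Suc_diff_1 zero_less_card_finite)
    then show ?thesis using \<kappa> by (simp add: power_divide)
  qed
  finally show ?thesis .
qed

text \<open>For r \<le> 1 the indicator of a cap is at most e times the Gaussian at scale \<kappa> =
  1/r; for larger r the total mass suffices. It bounds from below the number of caps needed to cover
  the sphere.\<close>

lemma cap_upper_bound:
  "\<exists>C>0. \<forall>r>0. \<forall>w::real ^ 'n. norm w = 1 \<longrightarrow>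
    measure surface_measure (sphere 0 1 \<inter> ball w r) \<le> C * r ^ (CARD('n) - 1)"
proof -
  interpret finite_measure "surface_measure :: (real ^ 'n) measure" by (rule finite_surface_measure)
  let ?n = "CARD('n)" and ?S = "surface_measure :: (real ^ 'n) measure"
  define C where "C = exp 1 * (2 * real ?n * exp 1 * sqrt (2 * pi / 1) ^ ?n)"
  have C: "0 < C" by (simp add: C_def)
  have small: "measure ?S (sphere 0 1 \<inter> ball w r) \<le> C * r ^ (?n - 1)"
    if r: "0 < r" "r \<le> 1" and w: "norm w = 1" for r and w :: "real ^ 'n"
  proof -
    have cap: "sphere 0 1 \<inter> ball w r \<in> sets ?S" by (auto simp: sets_surface_measure sets_restrict_space)
    have "emeasure ?S (sphere 0 1 \<inter> ball w r) = (\<integral>\<^sup>+w'. indicator (sphere 0 1 \<inter> ball w r) w' \<partial>?S)"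
      using cap by simp
    also have "\<dots> \<le> (\<integral>\<^sup>+w'. ennreal (exp 1) * ennreal (exp (- 1 * (1 / r * norm (w - w'))\<^sup>2)) \<partial>?S)"
    proof (rule nn_integral_mono)
      fix w' :: "real ^ 'n"
      have "1 \<le> exp 1 * exp (- 1 * (1 / r * norm (w - w'))\<^sup>2)" if "norm (w - w') < r"
      proof -
        have "(1 / r * norm (w - w'))\<^sup>2 \<le> 1" using that r by (simp add: power_le_one)
        then show ?thesis by (simp flip: exp_add)
      qed
      then show "indicator (sphere 0 1 \<inter> ball w r) w' \<le> ennreal (exp 1) * ennreal (exp (- 1 * (1 / r * norm (w - w'))\<^sup>2))"
        by (auto simp: indicator_def dist_norm ennreal_mult'[symmetric] simp flip: ennreal_1 intro!: ennreal_leI)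
    qed
    also have "\<dots> = ennreal (exp 1) * (\<integral>\<^sup>+w'. ennreal (exp (- 1 * (1 / r * norm (w - w'))\<^sup>2)) \<partial>?S)"
      by (rule nn_integral_cmult) (rule measurable_surface_measure, measurable)
    also have "\<dots> \<le> ennreal (exp 1) * ennreal (2 * real ?n * exp 1 * sqrt (2 * pi / 1) ^ ?n / (1 / r) ^ (?n - 1))"
      using r w by (intro mult_left_mono surface_gaussian_le) auto
    also have "\<dots> = ennreal (C * r ^ (?n - 1))"
      using r by (simp add: C_def ennreal_mult'[symmetric] power_divide)
    finally show ?thesis using r C by (simp add: emeasure_eq_measure)
  qed
  define C' where "C' = max C (measure ?S (space ?S))"
  have "measure ?S (sphere 0 1 \<inter> ball w r) \<le> C' * r ^ (?n - 1)"
    if r: "0 < r" and w: "norm w = 1" for r and w :: "real ^ 'n"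
  proof (cases "r \<le> 1")
    case True
    have "C * r ^ (?n - 1) \<le> C' * r ^ (?n - 1)" using r by (intro mult_right_mono) (auto simp: C'_def)
    then show ?thesis using small[OF r True w] by linarith
  next
    case False
    have "measure ?S (sphere 0 1 \<inter> ball w r) \<le> measure ?S (space ?S)"
      by (rule bounded_measure)
    also have "\<dots> \<le> C' * 1" by (simp add: C'_def)
    also have "\<dots> \<le> C' * r ^ (?n - 1)" using False C by (intro mult_left_mono one_le_power) (auto simp: C'_def)
    finally show ?thesis .
  qed
  moreover have "0 < C'" using C by (simp add: C'_def)
  ultimately show ?thesis by blast
qed

text \<open>The balls of radius \<open>r/16\<close> around \<open>t \<omega>\<close>, \<open>1/4 \<le> t \<le> 1/2\<close>, lie in the cone over the cap of radius
  \<open>r\<close>, and every point lies in them for a set of \<open>t\<close> of length at most \<open>r/8\<close>.\<close>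

lemma cap_lower_bound:
  "\<exists>c>0. \<forall>r. 0 < r \<longrightarrow> r \<le> 1 \<longrightarrow> (\<forall>w::real ^ 'n. norm w = 1 \<longrightarrow>
    c * r ^ (CARD('n) - 1) \<le> measure surface_measure (sphere 0 1 \<inter> ball w r))"
proof -
  interpret finite_measure "surface_measure :: (real ^ 'n) measure" by (rule finite_surface_measure)
  let ?n = "CARD('n)" and ?S = "surface_measure :: (real ^ 'n) measure"
  define v where "v = unit_ball_vol (real ?n)"
  define c where "c = real ?n * v / (8 * 16 ^ (?n - 1))"
  have v: "0 < v" by (simp add: v_def unit_ball_vol_pos)
  have "c * r ^ (?n - 1) \<le> measure ?S (sphere 0 1 \<inter> ball w r)"
    if r: "0 < r" "r \<le> 1" and w: "norm w = 1" for r and w :: "real ^ 'n"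
  proof -
    define \<rho> where "\<rho> = r / 16"
    have \<rho>: "0 < \<rho>" "\<rho> \<le> 1 / 16" using r by (auto simp: \<rho>_def)
    define Om where "Om = {x::real ^ 'n. 0 < norm x \<and> norm x < 1 \<and> x /\<^sub>R norm x \<in> sphere 0 1 \<inter> ball w r}"
    have Om [measurable]: "Om \<in> sets borel" unfolding Om_def mem_sphere_0 Int_iff mem_ball dist_norm by measurable
    \<comment> \<open>Here |x| > 1/8 and x is within 2 \<rho> = r/8 of |x| w, so dividing by |x|
      brings the direction of x within r of w. This is the origin of \<open>r / 16\<close>.\<close>
    have sub: "x \<in> Om" if t: "1 / 4 \<le> t" "t \<le> 1 / 2" and x: "norm (x - t *\<^sub>R w) < \<rho>" for x t
    proof -
      have tx: "\<bar>norm x - t\<bar> < \<rho>"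
        using norm_triangle_ineq3[of x "t *\<^sub>R w"] x w t by simp
      then have nx: "1 / 8 < norm x" "norm x < 1" using t \<rho> by auto
      then have "x \<noteq> 0" by auto
      have "norm (x - norm x *\<^sub>R w) = norm ((x - t *\<^sub>R w) + (t - norm x) *\<^sub>R w)"
        by (simp add: algebra_simps)
      also have "\<dots> \<le> norm (x - t *\<^sub>R w) + \<bar>t - norm x\<bar> * norm w"
        by (metis norm_triangle_ineq norm_scaleR)
      also have "\<dots> < 2 * \<rho>" using x tx w by simp
      finally have "norm (norm x *\<^sub>R (x /\<^sub>R norm x - w)) < 2 * \<rho>"
        using \<open>x \<noteq> 0\<close> by (simp add: scaleR_diff_right)
      then have "norm x * norm (x /\<^sub>R norm x - w) < r / 8" by (simp add: \<rho>_def)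
      moreover have "1 / 8 * norm (x /\<^sub>R norm x - w) \<le> norm x * norm (x /\<^sub>R norm x - w)"
        using nx by (intro mult_right_mono) auto
      ultimately have "norm (x /\<^sub>R norm x - w) < r" by linarith
      then show ?thesis using nx \<open>x \<noteq> 0\<close> by (auto simp: Om_def dist_norm norm_minus_commute)
    qed
    have "ennreal (v * \<rho> ^ ?n / 4) = (\<integral>\<^sup>+t. ennreal (v * \<rho> ^ ?n) * indicator {1/4..1/2} (t::real) \<partial>lborel)"
      using v \<rho> by (simp add: nn_integral_cmult_indicator ennreal_mult'[symmetric])
    also have "\<dots> = (\<integral>\<^sup>+t. (\<integral>\<^sup>+x. indicator (ball (t *\<^sub>R w) \<rho>) x * indicator {1/4..1/2} t \<partial>lborel) \<partial>lborel)"
      using \<rho> by (intro nn_integral_cong) (subst nn_integral_multc, auto simp: emeasure_ball v_def intro!: borel_measurable_indicator)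
    also have "\<dots> = (\<integral>\<^sup>+t. (\<integral>\<^sup>+x. (if norm (x - t *\<^sub>R w) < \<rho> then 1 else 0) * indicator {1/4..1/2} t \<partial>lborel) \<partial>lborel)"
      by (intro nn_integral_cong) (auto simp: indicator_def dist_norm norm_minus_commute)
    also have "\<dots> = (\<integral>\<^sup>+x. (\<integral>\<^sup>+t. (if norm (x - t *\<^sub>R w) < \<rho> then 1 else 0) * indicator {1/4..1/2} t \<partial>lborel) \<partial>lborel)"
      by (rule lborel_pair.Fubini'[symmetric]) measurable
    also have "\<dots> \<le> (\<integral>\<^sup>+x. ennreal (2 * \<rho>) * indicator Om x \<partial>lborel)"
    proof (rule nn_integral_mono)
      fix x :: "real ^ 'n"
      \<comment> \<open>Projecting onto \<open>w\<close> confines \<open>t\<close> to an interval of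
        length \<open>2 * \<rho>\<close>.\<close>
      have "(if norm (x - t *\<^sub>R w) < \<rho> then 1 else 0) * indicator {1/4..1/2} t
          \<le> (indicator {x \<bullet> w - \<rho> .. x \<bullet> w + \<rho>} t * indicator Om x :: ennreal)" for t
      proof -
        have "\<bar>x \<bullet> w - t\<bar> \<le> \<rho>" if "norm (x - t *\<^sub>R w) < \<rho>"
        proof -
          have "w \<bullet> w = 1" using w by (simp add: dot_square_norm)
          then have "(x - t *\<^sub>R w) \<bullet> w = x \<bullet> w - t" by (simp add: inner_diff_left)
          then show ?thesis using Cauchy_Schwarz_ineq2[of "x - t *\<^sub>R w" w] that w by simp
        qed
        then show ?thesis using sub[of t x] by (auto simp: indicator_def abs_le_iff)
      qed
      then have "(\<integral>\<^sup>+t. (if norm (x - t *\<^sub>R w) < \<rho> then 1 else 0) * indicator {1/4..1/2} t \<partial>lborel)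
          \<le> (\<integral>\<^sup>+t. indicator {x \<bullet> w - \<rho> .. x \<bullet> w + \<rho>} t * indicator Om x \<partial>lborel)"
        by (intro nn_integral_mono)
      also have "\<dots> = ennreal (2 * \<rho>) * indicator Om x"
        using \<rho> by (subst nn_integral_multc) auto
      finally show "(\<integral>\<^sup>+t. (if norm (x - t *\<^sub>R w) < \<rho> then 1 else 0) * indicator {1/4..1/2} t \<partial>lborel)
          \<le> ennreal (2 * \<rho>) * indicator Om x" .
    qed
    also have "\<dots> = ennreal (2 * \<rho>) * emeasure lborel Om" by (simp add: nn_integral_cmult_indicator)
    finally have 1: "ennreal (v * \<rho> ^ ?n / 4) \<le> ennreal (2 * \<rho>) * emeasure lborel Om" .
    have fin: "emeasure lborel Om < \<infinity>"
    proof -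
      have "Om \<subseteq> ball 0 1" by (auto simp: Om_def)
      then have "emeasure lborel Om \<le> emeasure lborel (ball (0 :: real ^ 'n) 1)" by (intro emeasure_mono) auto
      then show ?thesis using emeasure_ball_finite[of "0 :: real ^ 'n" 1] by (rule le_less_trans)
    qed
    then have Ome: "emeasure lborel Om = ennreal (measure lborel Om)"
      by (simp add: emeasure_eq_ennreal_measure)
    have "v * \<rho> ^ ?n / 4 \<le> 2 * \<rho> * measure lborel Om"
      using 1 \<rho> unfolding Ome by (simp add: ennreal_mult'[symmetric])
    moreover have "\<rho> ^ ?n = \<rho> * \<rho> ^ (?n - 1)" by (metis power_Suc Suc_diff_1 zero_less_card_finite)
    ultimately have "\<rho> * (v * \<rho> ^ (?n - 1) / 4) \<le> \<rho> * (2 * measure lborel Om)"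
      by (simp add: mult_ac)
    then have 2: "v * \<rho> ^ (?n - 1) / 8 \<le> measure lborel Om" using \<rho> by simp
    have "emeasure ?S (sphere 0 1 \<inter> ball w r) = of_nat ?n * emeasure lborel Om"
      unfolding Om_def by (rule emeasure_surface_measure) auto
    then have "measure ?S (sphere 0 1 \<inter> ball w r) = real ?n * measure lborel Om"
      unfolding Ome emeasure_eq_measure ennreal_of_nat_eq_real_of_nat by (simp add: ennreal_mult'[symmetric])
    moreover have "real ?n * (v * \<rho> ^ (?n - 1) / 8) \<le> real ?n * measure lborel Om"
      using 2 by (intro mult_left_mono) auto
    ultimately show ?thesis by (simp add: c_def \<rho>_def power_divide mult_ac)
  qed
  moreover have "0 < c" using v by (simp add: c_def)
  ultimately show ?thesis by blast
qed

text \<open>A separated set of maximal cardinality is a net, for an uncovered point could be added.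
  A maximum exists because sending each point to a nearby centre of a finite
  \<open>\<rho> / 2\<close>-net is injective on separated sets. Separation will decouple the caps,
  and covering will count them.\<close>

lemma compact_separated_net:
  fixes K :: "'a::metric_space set"
  assumes K: "compact K" and \<rho>: "0 < \<rho>"
  shows "\<exists>P\<subseteq>K. finite P \<and> (\<forall>p\<in>P. \<forall>q\<in>P. p \<noteq> q \<longrightarrow> \<rho> \<le> dist p q) \<and> K \<subseteq> (\<Union>p\<in>P. ball p \<rho>)"
proof -
  define sep where "sep P \<longleftrightarrow> P \<subseteq> K \<and> finite P \<and> (\<forall>p\<in>P. \<forall>q\<in>P. p \<noteq> q \<longrightarrow> \<rho> \<le> dist p q)" for P
  obtain F where F: "finite F" "K \<subseteq> (\<Union>x\<in>F. ball x (\<rho> / 2))"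
    using K \<rho> unfolding compact_eq_totally_bounded by (meson half_gt_zero)
  have card: "card P \<le> card F" if P: "sep P" for P
  proof -
    have "\<forall>p\<in>P. \<exists>x\<in>F. dist x p < \<rho> / 2" using P F(2) by (fastforce simp: sep_def)
    then obtain h where h: "\<And>p. p \<in> P \<Longrightarrow> h p \<in> F \<and> dist (h p) p < \<rho> / 2" by metis
    have "inj_on h P"
    proof (rule inj_onI, rule ccontr)
      fix p q assume pq: "p \<in> P" "q \<in> P" "h p = h q" "p \<noteq> q"
      then have "dist p q < \<rho>" using h[of p] h[of q] dist_triangle3[of p q "h p"] by simp
      then show False using pq P by (force simp: sep_def)
    qed
    then show ?thesis using h F(1) by (intro card_inj_on_le[of h]) auto
  qed
  have "sep {}" by (simp add: sep_def)
  then obtain P where P: "sep P" "\<And>Q. sep Q \<Longrightarrow> card Q \<le> card P"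
    using ex_has_greatest_nat[of sep "{}" card "Suc (card F)"] card by (metis less_Suc_eq_le)
  have "K \<subseteq> (\<Union>p\<in>P. ball p \<rho>)"
  proof (rule ccontr)
    assume "\<not> K \<subseteq> (\<Union>p\<in>P. ball p \<rho>)"
    then obtain y where y: "y \<in> K" "\<And>p. p \<in> P \<Longrightarrow> \<rho> \<le> dist p y" by force
    then have "y \<notin> P" using \<rho> by force
    have "sep (insert y P)" using P(1) y by (auto simp: sep_def dist_commute)
    from P(2)[OF this] show False using \<open>y \<notin> P\<close> P(1) by (simp add: sep_def)
  qed
  then show ?thesis using P(1) by (auto simp: sep_def)
qed

section \<open>The Herglotz operator with Gaussian weights\<close>

abbreviation sqdist :: "(real ^ 'n) \<times> (real ^ 'n) \<Rightarrow> real" where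
  "sqdist p \<equiv> (norm (fst p - snd p))\<^sup>2"

text \<open>Bound |f(x)| |f(y)| by half the sum of the squares; by symmetry of \<open>k\<close> both
  halves have the same integral, and integrating out one variable leaves the row bound
  \<open>D\<close>. The bound \<open>B\<close> provides integrability.\<close>

lemma schur_test:
  fixes k :: "'a \<times> 'a \<Rightarrow> real"
  assumes fin: "finite_measure M" and f: "f \<in> L2_space M"
    and k [measurable]: "k \<in> borel_measurable (M \<Otimes>\<^sub>M M)"
    and bound: "\<And>p. p \<in> space (M \<Otimes>\<^sub>M M) \<Longrightarrow> 0 \<le> k p \<and> k p \<le> B"
    and sym: "\<And>x y. k (x, y) = k (y, x)"
    and row: "\<And>x. x \<in> space M \<Longrightarrow> (\<integral>\<^sup>+y. ennreal (k (x, y)) \<partial>M) \<le> ennreal D" and D: "0 \<le> D"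
  shows "integrable (M \<Otimes>\<^sub>M M) (\<lambda>p. k p * (cmod (f (fst p)) * cmod (f (snd p))))"
    and "(LINT p|(M \<Otimes>\<^sub>M M). k p * (cmod (f (fst p)) * cmod (f (snd p)))) \<le> D * L2_sqnorm M f"
proof -
  interpret finite_measure M by fact
  interpret pair_sigma_finite M M ..
  have [measurable]: "f \<in> borel_measurable M" using f by (rule L2_spaceD)
  let ?g = "\<lambda>p. k p * (cmod (f (fst p)))\<^sup>2" and ?h = "\<lambda>p. k p * (cmod (f (snd p)))\<^sup>2"
  have int1: "integrable (M \<Otimes>\<^sub>M M) (\<lambda>p. (cmod (f (fst p)))\<^sup>2)"
    using L2_spaceD(2)[OF f] by (intro Fubini_integrable) auto
  have ig: "integrable (M \<Otimes>\<^sub>M M) ?g"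
  proof (rule Bochner_Integration.integrable_bound)
    show "integrable (M \<Otimes>\<^sub>M M) (\<lambda>p. B * (cmod (f (fst p)))\<^sup>2)" using int1 by simp
    show "AE p in M \<Otimes>\<^sub>M M. norm (?g p) \<le> norm (B * (cmod (f (fst p)))\<^sup>2)"
    proof (rule AE_I2)
      fix p assume "p \<in> space (M \<Otimes>\<^sub>M M)"
      from bound[OF this] show "norm (?g p) \<le> norm (B * (cmod (f (fst p)))\<^sup>2)"
        by (auto simp: abs_mult intro!: mult_right_mono)
    qed
  qed measurable
  have hg: "?h = (\<lambda>(x, y). ?g (y, x))" by (auto simp: sym)
  have ih: "integrable (M \<Otimes>\<^sub>M M) ?h" unfolding hg by (rule integrable_product_swap[OF ig])
  have eq: "integral\<^sup>L (M \<Otimes>\<^sub>M M) ?h = integral\<^sup>L (M \<Otimes>\<^sub>M M) ?g"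
    unfolding hg by (rule integral_product_swap) measurable
  have le: "k p * (cmod (f (fst p)) * cmod (f (snd p))) \<le> (?g p + ?h p) / 2" if "p \<in> space (M \<Otimes>\<^sub>M M)" for p
  proof -
    have "cmod (f (fst p)) * cmod (f (snd p)) \<le> ((cmod (f (fst p)))\<^sup>2 + (cmod (f (snd p)))\<^sup>2) / 2"
      using sum_squares_bound[of "cmod (f (fst p))" "cmod (f (snd p))"] by simp
    then have "k p * (cmod (f (fst p)) * cmod (f (snd p))) \<le> k p * (((cmod (f (fst p)))\<^sup>2 + (cmod (f (snd p)))\<^sup>2) / 2)"
      using bound[OF that] by (intro mult_left_mono) auto
    then show ?thesis by (simp add: field_simps)
  qed
  show int: "integrable (M \<Otimes>\<^sub>M M) (\<lambda>p. k p * (cmod (f (fst p)) * cmod (f (snd p))))"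
  proof (rule Bochner_Integration.integrable_bound)
    show "integrable (M \<Otimes>\<^sub>M M) (\<lambda>p. (?g p + ?h p) / 2)"
      using ig ih by (intro integrable_divide Bochner_Integration.integrable_add)
    show "AE p in M \<Otimes>\<^sub>M M. norm (k p * (cmod (f (fst p)) * cmod (f (snd p)))) \<le> norm ((?g p + ?h p) / 2)"
    proof (rule AE_I2)
      fix p assume p: "p \<in> space (M \<Otimes>\<^sub>M M)"
      have "0 \<le> k p * (cmod (f (fst p)) * cmod (f (snd p)))" using bound[OF p] by simp
      with le[OF p] show "norm (k p * (cmod (f (fst p)) * cmod (f (snd p)))) \<le> norm ((?g p + ?h p) / 2)"
        unfolding real_norm_def by linarith
    qed
  qed measurable
  have "(LINT p|(M \<Otimes>\<^sub>M M). k p * (cmod (f (fst p)) * cmod (f (snd p)))) \<le> (LINT p|(M \<Otimes>\<^sub>M M). (?g p + ?h p) / 2)"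
    using int ig ih le by (intro integral_mono integrable_divide Bochner_Integration.integrable_add)
  also have "\<dots> = integral\<^sup>L (M \<Otimes>\<^sub>M M) ?g"
    using ig ih eq by (simp add: add_divide_distrib)
  also have "\<dots> = (LINT x|M. LINT y|M. ?g (x, y))"
    by (rule integral_fst'[symmetric, OF ig])
  also have "\<dots> \<le> (LINT x|M. D * (cmod (f x))\<^sup>2)"
  proof (rule integral_mono)
    show "integrable M (\<lambda>x. LINT y|M. ?g (x, y))" by (rule integrable_fst'[OF ig])
    show "integrable M (\<lambda>x. D * (cmod (f x))\<^sup>2)" using L2_spaceD(2)[OF f] by simp
    fix x assume x: "x \<in> space M"
    have ky [measurable]: "(\<lambda>y. k (x, y)) \<in> borel_measurable M" using x by measurable
    have "0 \<le> k (x, y)" if "y \<in> space M" for y using bound[of "(x, y)"] x that by (auto simp: space_pair_measure)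
    then have "ennreal (LINT y|M. k (x, y)) \<le> (\<integral>\<^sup>+y. ennreal (k (x, y)) \<partial>M)"
      using bound x by (intro eq_refl[OF nn_integral_eq_integral[symmetric]] integrable_const_bound[where B=B] AE_I2)
        (auto simp: space_pair_measure)
    also have "\<dots> \<le> ennreal D" by (rule row[OF x])
    finally have "(LINT y|M. k (x, y)) \<le> D" using D by (auto simp: ennreal_le_iff2)
    then have "(LINT y|M. k (x, y)) * (cmod (f x))\<^sup>2 \<le> D * (cmod (f x))\<^sup>2" by (intro mult_right_mono) auto
    then show "(LINT y|M. ?g (x, y)) \<le> D * (cmod (f x))\<^sup>2" by simp
  qed
  also have "\<dots> = D * L2_sqnorm M f" by (simp add: L2_sqnorm_def)
  finally show "(LINT p|(M \<Otimes>\<^sub>M M). k p * (cmod (f (fst p)) * cmod (f (snd p)))) \<le> D * L2_sqnorm M f" .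
qed

lemma measurable_surface_pair:
  fixes f :: "(real ^ 'n) \<times> (real ^ 'n) \<Rightarrow> 'b"
  assumes "f \<in> measurable borel X"
  shows "f \<in> measurable (surface_measure \<Otimes>\<^sub>M surface_measure) X"
proof -
  have "(\<lambda>p. (fst p, snd p)) \<in> (surface_measure \<Otimes>\<^sub>M surface_measure :: ((real ^ 'n) \<times> (real ^ 'n)) measure) \<rightarrow>\<^sub>M (borel \<Otimes>\<^sub>M borel)"
    by (intro measurable_Pair measurable_compose[OF measurable_fst] measurable_compose[OF measurable_snd]
        measurable_surface_measure measurable_ident_sets) auto
  then show ?thesis
    using assms unfolding borel_prod by (auto intro: measurable_compose)
qed

text \<open>|P f|^2 is a double integral over the sphere with phase \<kappa>(w - w').x. The Gaussian
  weight makes the integrand absolutely integrable in all three variables, so the x-integral may be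
  taken first and is a Gaussian Fourier transform. All three claims come from the one integrability
  fact \<open>Fi\<close>.\<close>

lemma herglotz_gaussian_form:
  fixes f :: "real ^ 'n \<Rightarrow> complex"
  assumes f: "f \<in> L2_space surface_measure" and s: "0 < s"
  shows "integrable lborel (\<lambda>x. exp (- s * (norm x)\<^sup>2) * (cmod (herglotz_wave \<kappa> f x))\<^sup>2)"
    and "complex_of_real (LINT x|lborel. exp (- s * (norm x)\<^sup>2) * (cmod (herglotz_wave \<kappa> f x))\<^sup>2)
      = (LINT p|(surface_measure \<Otimes>\<^sub>M surface_measure).
          of_real (sqrt (pi / s) ^ CARD('n) * exp (- \<kappa>\<^sup>2 * sqdist p / (4 * s))) * (f (fst p) * cnj (f (snd p))))"
    and "integrable (surface_measure \<Otimes>\<^sub>M surface_measure) (\<lambda>p.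
          of_real (sqrt (pi / s) ^ CARD('n) * exp (- \<kappa>\<^sup>2 * sqdist p / (4 * s))) * (f (fst p) * cnj (f (snd p))))"
proof -
  let ?S = "surface_measure :: (real ^ 'n) measure" and ?L = "lborel :: (real ^ 'n) measure"
  interpret S: finite_measure ?S by (rule finite_surface_measure)
  interpret SS: pair_sigma_finite ?S ?S ..
  interpret SP: finite_measure "?S \<Otimes>\<^sub>M ?S" by (rule finite_measure_pair_measure) (rule finite_surface_measure)+
  interpret LS: pair_sigma_finite ?L "?S \<Otimes>\<^sub>M ?S" ..
  have [measurable]: "f \<in> borel_measurable ?S" using f by (rule L2_spaceD)
  have idS [measurable]: "(\<lambda>w. w) \<in> ?S \<rightarrow>\<^sub>M borel" by (rule measurable_surface_measure) simp
  have [measurable]: "fst \<in> ?S \<Otimes>\<^sub>M ?S \<rightarrow>\<^sub>M borel" "snd \<in> ?S \<Otimes>\<^sub>M ?S \<rightarrow>\<^sub>M borel"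
    by (rule measurable_compose[OF measurable_fst idS], rule measurable_compose[OF measurable_snd idS])
  have fi: "integrable ?S f" by (rule L2_L1_bound(1)[OF finite_surface_measure f])
  let ?ff = "\<lambda>p. f (fst p) * cnj (f (snd p))"
  have ffi: "integrable (?S \<Otimes>\<^sub>M ?S) ?ff"
    using fi by (intro SS.Fubini_integrable) (auto simp: norm_mult)
  define E where "E x p = iexp (\<kappa> * ((fst p - snd p) \<bullet> x)) * ?ff p" for x p
  have Em: "(\<lambda>z. E (fst z) (snd z)) \<in> borel_measurable (?L \<Otimes>\<^sub>M (?S \<Otimes>\<^sub>M ?S))"
    unfolding E_def by measurable
  have Ei: "integrable (?S \<Otimes>\<^sub>M ?S) (E x)" for x
  proof (rule Bochner_Integration.integrable_bound[OF ffi])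
    show "E x \<in> borel_measurable (?S \<Otimes>\<^sub>M ?S)" unfolding E_def by measurable
    show "AE p in ?S \<Otimes>\<^sub>M ?S. norm (E x p) \<le> norm (?ff p)" by (simp add: E_def norm_mult)
  qed
  have sq: "complex_of_real ((cmod (herglotz_wave \<kappa> f x))\<^sup>2) = (LINT p|(?S \<Otimes>\<^sub>M ?S). E x p)" for x
  proof -
    have "(LINT p|(?S \<Otimes>\<^sub>M ?S). E x p) = (LINT w|?S. LINT w'|?S. E x (w, w'))"
      by (rule SS.integral_fst'[symmetric, OF Ei])
    also have "\<dots> = (LINT w|?S. LINT w'|?S. (iexp (\<kappa> * (w \<bullet> x)) * f w) * cnj (iexp (\<kappa> * (w' \<bullet> x)) * f w'))"
    proof -
      have "E x (w, w') = (iexp (\<kappa> * (w \<bullet> x)) * f w) * cnj (iexp (\<kappa> * (w' \<bullet> x)) * f w')" for w w'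
      proof -
        have "iexp (\<kappa> * ((w - w') \<bullet> x)) = iexp (\<kappa> * (w \<bullet> x)) * cnj (iexp (\<kappa> * (w' \<bullet> x)))"
          unfolding exp_cnj by (simp add: inner_diff_left algebra_simps flip: exp_add)
        then show ?thesis unfolding E_def by (simp add: mult_ac)
      qed
      then show ?thesis by simp
    qed
    also have "\<dots> = (LINT w|?S. (iexp (\<kappa> * (w \<bullet> x)) * f w) * cnj (herglotz_wave \<kappa> f x))"
      unfolding herglotz_wave_def integral_mult_right_zero Bochner_Integration.integral_cnj ..
    also have "\<dots> = herglotz_wave \<kappa> f x * cnj (herglotz_wave \<kappa> f x)"
      unfolding integral_mult_left_zero herglotz_wave_def[symmetric] ..
    finally show ?thesis by (simp only: complex_norm_square)
  qed
  define F where "F x p = of_real (exp (- s * (norm x)\<^sup>2)) * E x p" for x p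
  have Fi: "integrable (?L \<Otimes>\<^sub>M (?S \<Otimes>\<^sub>M ?S)) (\<lambda>(x, p). F x p)"
  proof (rule Bochner_Integration.integrable_bound)
    show "integrable (?L \<Otimes>\<^sub>M (?S \<Otimes>\<^sub>M ?S)) (\<lambda>(x, p). exp (- s * (norm x)\<^sup>2) * norm (?ff p))"
      using gaussian_integral(1)[where ?'a="real ^ 'n", OF s] ffi
      by (intro LS.Fubini_integrable) (auto simp: abs_mult)
    show "(\<lambda>(x, p). F x p) \<in> borel_measurable (?L \<Otimes>\<^sub>M (?S \<Otimes>\<^sub>M ?S))"
      unfolding F_def case_prod_beta' using Em by measurable
  qed (auto simp: F_def E_def norm_mult)
  have inner: "(LINT p|(?S \<Otimes>\<^sub>M ?S). F x p) = complex_of_real (exp (- s * (norm x)\<^sup>2) * (cmod (herglotz_wave \<kappa> f x))\<^sup>2)" for x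
    unfolding F_def integral_mult_right_zero sq[symmetric] by simp
  have "integrable ?L (\<lambda>x. LINT p|(?S \<Otimes>\<^sub>M ?S). F x p)"
    using LS.integrable_fst'[OF Fi] by simp
  then show "integrable ?L (\<lambda>x. exp (- s * (norm x)\<^sup>2) * (cmod (herglotz_wave \<kappa> f x))\<^sup>2)"
    unfolding inner complex_of_real_integrable_eq .
  have outer: "(LINT x|?L. F x p)
      = of_real (sqrt (pi / s) ^ CARD('n) * exp (- \<kappa>\<^sup>2 * sqdist p / (4 * s))) * ?ff p" for p
  proof -
    have "(LINT x|?L. F x p) = (LINT x|?L. iexp ((\<kappa> *\<^sub>R (fst p - snd p)) \<bullet> x) * of_real (exp (- s * (norm x)\<^sup>2)) * ?ff p)"
      by (simp add: F_def E_def mult_ac)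
    also have "\<dots> = of_real (sqrt (pi / s) ^ CARD('n) * exp (- (norm (\<kappa> *\<^sub>R (fst p - snd p)))\<^sup>2 / (4 * s))) * ?ff p"
      unfolding integral_mult_left_zero gaussian_fourier(2)[OF s] by simp
    finally show ?thesis by (simp add: power_mult_distrib)
  qed
  show "integrable (?S \<Otimes>\<^sub>M ?S) (\<lambda>p. of_real (sqrt (pi / s) ^ CARD('n) * exp (- \<kappa>\<^sup>2 * sqdist p / (4 * s))) * ?ff p)"
    using LS.integrable_snd[OF Fi] unfolding outer .
  have "(LINT p|(?S \<Otimes>\<^sub>M ?S). LINT x|?L. F x p) = (LINT x|?L. LINT p|(?S \<Otimes>\<^sub>M ?S). F x p)"
    by (rule LS.Fubini_integral[OF Fi])
  then show "complex_of_real (LINT x|?L. exp (- s * (norm x)\<^sup>2) * (cmod (herglotz_wave \<kappa> f x))\<^sup>2)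
      = (LINT p|(?S \<Otimes>\<^sub>M ?S). of_real (sqrt (pi / s) ^ CARD('n) * exp (- \<kappa>\<^sup>2 * sqdist p / (4 * s))) * ?ff p)"
    unfolding outer inner integral_complex_of_real by simp
qed

lemma surface_gaussian_schur:
  fixes f :: "real ^ 'n \<Rightarrow> complex"
  assumes f: "f \<in> L2_space surface_measure" and a: "0 < a" and \<kappa>: "1 \<le> \<kappa>"
  shows "integrable (surface_measure \<Otimes>\<^sub>M surface_measure)
      (\<lambda>p. exp (- a * \<kappa>\<^sup>2 * sqdist p) * (cmod (f (fst p)) * cmod (f (snd p))))"
    and "(LINT p|(surface_measure \<Otimes>\<^sub>M surface_measure). exp (- a * \<kappa>\<^sup>2 * sqdist p) * (cmod (f (fst p)) * cmod (f (snd p))))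
     \<le> 2 * real CARD('n) * exp a * sqrt (2 * pi / a) ^ CARD('n) / \<kappa> ^ (CARD('n) - 1) * L2_sqnorm surface_measure f"
proof -
  have m: "(\<lambda>p::(real ^ 'n) \<times> (real ^ 'n). exp (- a * \<kappa>\<^sup>2 * sqdist p)) \<in> borel_measurable (surface_measure \<Otimes>\<^sub>M surface_measure)"
    by (rule measurable_surface_pair) (intro borel_measurable_continuous_onI continuous_intros)
  have b: "0 \<le> exp (- a * \<kappa>\<^sup>2 * sqdist p) \<and> exp (- a * \<kappa>\<^sup>2 * sqdist p) \<le> 1" for p :: "(real ^ 'n) \<times> (real ^ 'n)"
    using a by simp
  have sym: "exp (- a * \<kappa>\<^sup>2 * sqdist (x, y)) = exp (- a * \<kappa>\<^sup>2 * sqdist (y, x))" for x y :: "real ^ 'n"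
    by (simp add: norm_minus_commute)
  have row: "(\<integral>\<^sup>+y. ennreal (exp (- a * \<kappa>\<^sup>2 * sqdist (x, y))) \<partial>surface_measure)
     \<le> ennreal (2 * real CARD('n) * exp a * sqrt (2 * pi / a) ^ CARD('n) / \<kappa> ^ (CARD('n) - 1))"
    if "x \<in> space surface_measure" for x :: "real ^ 'n"
    using surface_gaussian_le[OF a \<kappa>, of x] that by (simp add: power_mult_distrib mult.assoc)
  have D: "0 \<le> 2 * real CARD('n) * exp a * sqrt (2 * pi / a) ^ CARD('n) / \<kappa> ^ (CARD('n) - 1)"
    using a \<kappa> by simp
  show "integrable (surface_measure \<Otimes>\<^sub>M surface_measure)
      (\<lambda>p. exp (- a * \<kappa>\<^sup>2 * sqdist p) * (cmod (f (fst p)) * cmod (f (snd p))))"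
    by (rule schur_test(1)[OF finite_surface_measure f m b sym row D])
  show "(LINT p|(surface_measure \<Otimes>\<^sub>M surface_measure). exp (- a * \<kappa>\<^sup>2 * sqdist p) * (cmod (f (fst p)) * cmod (f (snd p))))
     \<le> 2 * real CARD('n) * exp a * sqrt (2 * pi / a) ^ CARD('n) / \<kappa> ^ (CARD('n) - 1) * L2_sqnorm surface_measure f"
    by (rule schur_test(2)[OF finite_surface_measure f m b sym row D])
qed

text \<open>On the ball exp(|x|^2) \<le> e, so integrability is inherited from the Gaussian-weighted
  integral. The squared normalising weight becomes an integer power of \<kappa>, which matches the
  Schur constants.\<close>

lemma herglotz_operator_sqnorm:
  fixes f :: "real ^ 'n \<Rightarrow> complex"
  assumes f: "f \<in> L2_space surface_measure" and \<kappa>: "0 < \<kappa>"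
  shows "integrable lborel (\<lambda>x. indicator (ball 0 1) x * (cmod (herglotz_wave \<kappa> f x))\<^sup>2)"
    and "L2_sqnorm unit_ball_measure (herglotz_operator \<kappa> f)
      = \<kappa> ^ (CARD('n) - 1) * (LINT x|lborel. indicator (ball 0 1) x * (cmod (herglotz_wave \<kappa> f x))\<^sup>2)"
proof -
  let ?g = "\<lambda>x. exp (- 1 * (norm x)\<^sup>2) * (cmod (herglotz_wave \<kappa> f x))\<^sup>2"
  have g: "integrable lborel ?g" by (rule herglotz_gaussian_form(1)[OF f]) simp
  have eq: "indicator (ball 0 1) x * (cmod (herglotz_wave \<kappa> f x))\<^sup>2 = indicator (ball 0 1) x * exp ((norm x)\<^sup>2) * ?g x" for x
    by (simp add: mult.assoc[symmetric] flip: exp_add)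
  show "integrable lborel (\<lambda>x. indicator (ball 0 1) x * (cmod (herglotz_wave \<kappa> f x))\<^sup>2)"
    unfolding eq
  proof (rule Bochner_Integration.integrable_bound)
    show "integrable lborel (\<lambda>x. exp 1 * ?g x)" using g by (rule integrable_mult_right)
    have "indicator (ball 0 1) x * exp ((norm x)\<^sup>2) \<le> exp 1" for x :: "real ^ 'n"
      by (auto simp: indicator_def power_le_one)
    then have "indicator (ball 0 1) x * exp ((norm x)\<^sup>2) * ?g x \<le> exp 1 * ?g x" for x
      by (intro mult_right_mono) auto
    then show "AE x in lborel. norm (indicator (ball 0 1) x * exp ((norm x)\<^sup>2) * ?g x) \<le> norm (exp 1 * ?g x)"
      by (intro AE_I2) (simp add: abs_mult)
    have "(\<lambda>x::real ^ 'n. indicator (ball 0 1) x * exp ((norm x)\<^sup>2) :: real) \<in> borel_measurable lborel"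
      by (intro borel_measurable_times borel_measurable_indicator) auto
    then show "(\<lambda>x. indicator (ball 0 1) x * exp ((norm x)\<^sup>2) * ?g x) \<in> borel_measurable lborel"
      by (rule borel_measurable_times[OF _ borel_measurable_integrable[OF g]])
  qed
  have "(\<kappa> powr ((real CARD('n) - 1) / 2))\<^sup>2 = \<kappa> powr (real (CARD('n) - 1))"
    using \<kappa> by (simp add: power2_eq_square of_nat_diff Suc_leI flip: powr_add)
  then have k2: "(\<kappa> powr ((real CARD('n) - 1) / 2))\<^sup>2 = \<kappa> ^ (CARD('n) - 1)"
    by (simp only: powr_realpow[OF \<kappa>])
  have "L2_sqnorm unit_ball_measure (herglotz_operator \<kappa> f)
      = (\<kappa> powr ((real CARD('n) - 1) / 2))\<^sup>2 * L2_sqnorm unit_ball_measure (herglotz_wave \<kappa> f)"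
    unfolding herglotz_operator_def L2_sqnorm_scale by simp
  also have "L2_sqnorm unit_ball_measure (herglotz_wave \<kappa> f)
      = (LINT x|lborel. indicator (ball 0 1) x * (cmod (herglotz_wave \<kappa> f x))\<^sup>2)"
    unfolding L2_sqnorm_def unit_ball_measure_def by (subst integral_restrict_space) auto
  finally show "L2_sqnorm unit_ball_measure (herglotz_operator \<kappa> f)
      = \<kappa> ^ (CARD('n) - 1) * (LINT x|lborel. indicator (ball 0 1) x * (cmod (herglotz_wave \<kappa> f x))\<^sup>2)"
    unfolding k2 .
qed

text \<open>With \<open>s = 1\<close> the Gaussian rate on the sphere is 1/4, and the Schur bound
  contributes \<open>1 / \<kappa> ^ (CARD('n) - 1)\<close>, cancelled by the normalising weight;
  \<open>exp 1\<close> pays for replacing the indicator by the Gaussian.\<close>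

lemma herglotz_operator_bounded:
  "\<exists>C>0. \<forall>\<kappa>\<ge>1. \<forall>f \<in> L2_space (surface_measure :: (real ^ 'n) measure).
     L2_sqnorm unit_ball_measure (herglotz_operator \<kappa> f) \<le> C * L2_sqnorm surface_measure f"
proof -
  let ?n = "CARD('n)" and ?S = "surface_measure :: (real ^ 'n) measure"
  define D where "D = 2 * real ?n * exp (1/4) * sqrt (2 * pi / (1/4)) ^ ?n"
  define G where "G = sqrt (pi / 1) ^ ?n"
  have D: "0 < D" and G: "0 < G" by (auto simp: D_def G_def)
  have "L2_sqnorm unit_ball_measure (herglotz_operator \<kappa> f) \<le> (exp 1 * (G * D)) * L2_sqnorm ?S f"
    if \<kappa>: "1 \<le> \<kappa>" and f: "f \<in> L2_space ?S" for \<kappa> f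
  proof -
    let ?J = "LINT x|lborel. exp (- 1 * (norm x)\<^sup>2) * (cmod (herglotz_wave \<kappa> f x))\<^sup>2"
    let ?k = "\<lambda>p. exp (- (1/4) * \<kappa>\<^sup>2 * sqdist p) * (cmod (f (fst p)) * cmod (f (snd p)))"
    have k4: "exp (- \<kappa>\<^sup>2 * sqdist p / (4 * 1)) = exp (- (1/4) * \<kappa>\<^sup>2 * sqdist p)" for p :: "(real ^ 'n) \<times> (real ^ 'n)"
      by simp
    have "?J \<le> cmod (complex_of_real ?J)" by simp
    also have "\<dots> = cmod (LINT p|(?S \<Otimes>\<^sub>M ?S). of_real (G * exp (- \<kappa>\<^sup>2 * sqdist p / (4 * 1))) * (f (fst p) * cnj (f (snd p))))"
      unfolding G_def by (subst herglotz_gaussian_form(2)[OF f]) auto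
    also have "\<dots> \<le> (LINT p|(?S \<Otimes>\<^sub>M ?S). G * ?k p)"
    proof (rule norm_integral_le)
      show "integrable (?S \<Otimes>\<^sub>M ?S) (\<lambda>p. of_real (G * exp (- \<kappa>\<^sup>2 * sqdist p / (4 * 1))) * (f (fst p) * cnj (f (snd p))))"
        unfolding G_def by (rule herglotz_gaussian_form(3)[OF f]) simp
      show "integrable (?S \<Otimes>\<^sub>M ?S) (\<lambda>p. G * ?k p)"
        by (intro integrable_mult_right surface_gaussian_schur f \<kappa>) simp
      show "norm (of_real (G * exp (- \<kappa>\<^sup>2 * sqdist p / (4 * 1))) * (f (fst p) * cnj (f (snd p)))) \<le> G * ?k p" for p
        unfolding k4 using G by (simp add: norm_mult)
    qed
    also have "\<dots> = G * (LINT p|(?S \<Otimes>\<^sub>M ?S). ?k p)" by simp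
    also have "\<dots> \<le> G * (D / \<kappa> ^ (?n - 1) * L2_sqnorm ?S f)"
      unfolding D_def using G by (intro mult_left_mono surface_gaussian_schur f \<kappa>) auto
    finally have J: "?J \<le> G * D * L2_sqnorm ?S f / \<kappa> ^ (?n - 1)" by simp
    have "(LINT x|lborel. indicator (ball 0 1) x * (cmod (herglotz_wave \<kappa> f x))\<^sup>2)
        \<le> (LINT x|lborel. exp 1 * (exp (- 1 * (norm x)\<^sup>2) * (cmod (herglotz_wave \<kappa> f x))\<^sup>2))"
    proof (rule integral_mono)
      show "integrable lborel (\<lambda>x. indicator (ball 0 1) x * (cmod (herglotz_wave \<kappa> f x))\<^sup>2)"
        using \<kappa> by (intro herglotz_operator_sqnorm f) simp
      show "integrable lborel (\<lambda>x. exp 1 * (exp (- 1 * (norm x)\<^sup>2) * (cmod (herglotz_wave \<kappa> f x))\<^sup>2))"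
        by (intro integrable_mult_right herglotz_gaussian_form f) simp
      fix x :: "real ^ 'n"
      have "indicator (ball 0 1) x \<le> exp 1 * exp (- 1 * (norm x)\<^sup>2)"
        by (auto simp: indicator_def power_le_one simp flip: exp_add)
      then show "indicator (ball 0 1) x * (cmod (herglotz_wave \<kappa> f x))\<^sup>2
          \<le> exp 1 * (exp (- 1 * (norm x)\<^sup>2) * (cmod (herglotz_wave \<kappa> f x))\<^sup>2)"
        unfolding mult.assoc[symmetric] by (intro mult_right_mono) auto
    qed
    also have "\<dots> = exp 1 * ?J" by simp
    also have "\<dots> \<le> exp 1 * (G * D * L2_sqnorm ?S f / \<kappa> ^ (?n - 1))" by (intro mult_left_mono J) simp
    finally have "\<kappa> ^ (?n - 1) * (LINT x|lborel. indicator (ball 0 1) x * (cmod (herglotz_wave \<kappa> f x))\<^sup>2)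
        \<le> \<kappa> ^ (?n - 1) * (exp 1 * (G * D * L2_sqnorm ?S f / \<kappa> ^ (?n - 1)))"
      using \<kappa> by (intro mult_left_mono) auto
    then show ?thesis using \<kappa> herglotz_operator_sqnorm(2)[OF f, of \<kappa>] by simp
  qed
  moreover have "0 < exp 1 * (G * D)" using G D by simp
  ultimately show ?thesis by blast
qed

text \<open>The difference of Gaussians \<open>e\<^bsup>-2n|x|\<^sup>2\<^esup> - e\<^bsup>-n\<^esup> e\<^bsup>-n|x|\<^sup>2\<^esup>\<close> is at most \<open>1\<close> and nonpositive outside the
  unit ball, so it minorises the indicator of the ball, while its Fourier transform is still
  pinched between two positive multiples of one Gaussian.\<close>

lemma two_gaussians_le_indicator:
  fixes x :: "'a::real_normed_vector"
  assumes m: "0 < m"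
  shows "exp (- (2 * m) * (norm x)\<^sup>2) - exp (- m) * exp (- m * (norm x)\<^sup>2) \<le> indicator (ball 0 1) x"
proof (cases "norm x < 1")
  case True
  have "exp (- (2 * m) * (norm x)\<^sup>2) \<le> 1" using m by simp
  then have "exp (- (2 * m) * (norm x)\<^sup>2) - exp (- m) * exp (- m * (norm x)\<^sup>2) \<le> 1"
    using mult_pos_pos[OF exp_gt_zero exp_gt_zero, of "- m" "- m * (norm x)\<^sup>2"] by linarith
  then show ?thesis using True by simp
next
  case False
  then have "1 \<le> (norm x)\<^sup>2" by simp
  then have "m * 1 \<le> m * (norm x)\<^sup>2" using m by (intro mult_left_mono) auto
  then have "exp (- (2 * m) * (norm x)\<^sup>2) \<le> exp (- m + - m * (norm x)\<^sup>2)" by simp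
  then show ?thesis using False unfolding exp_add by simp
qed

lemma sqrt2_power_lt_exp: "0 < n \<Longrightarrow> sqrt 2 ^ n < exp (real n)"
proof -
  assume n: "0 < n"
  have "sqrt 2 < 2" by (rule real_less_lsqrt) auto
  also have "2 \<le> exp (1::real)" using exp_ge_add_one_self[of 1] by simp
  finally have "sqrt 2 ^ n < exp 1 ^ n" using n by (intro power_strict_mono) auto
  then show ?thesis by (simp add: exp_of_nat_mult[symmetric])
qed

text \<open>\<open>\<Phi>\<close> is the Fourier transform of the two-Gaussian minorant with m = n,
  as a function of the squared frequency \<open>u\<close>. The subtracted term decays faster but has
  the larger amplitude \<open>G * sqrt 2 ^ n\<close>; the factor \<open>exp (- n)\<close> beats
  \<open>sqrt 2 ^ n\<close>, which explains rates that are multiples of the dimension.\<close>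

lemma two_gaussian_kernel_bounds:
  fixes n :: nat and u :: real
  assumes n: "0 < n" and u: "0 \<le> u"
  defines "\<Phi> \<equiv> sqrt (pi / (2 * real n)) ^ n * exp (- u / (4 * (2 * real n)))
      - exp (- real n) * (sqrt (pi / real n) ^ n * exp (- u / (4 * real n)))"
    and "G \<equiv> sqrt (pi / (2 * real n)) ^ n"
  shows "G * (1 - exp (- real n) * sqrt 2 ^ n) * exp (- u / (8 * real n)) \<le> \<Phi>" "\<Phi> \<le> G * exp (- u / (8 * real n))"
    "0 < G * (1 - exp (- real n) * sqrt 2 ^ n)"
proof -
  have G: "0 < G" using n by (simp add: G_def)
  have "pi / real n = pi / (2 * real n) * 2" by simp
  then have "sqrt (pi / real n) = sqrt (pi / (2 * real n)) * sqrt 2" by (simp only: real_sqrt_mult)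
  then have G2: "sqrt (pi / real n) ^ n = G * sqrt 2 ^ n" by (simp only: G_def power_mult_distrib)
  have e: "exp (- u / (4 * (2 * real n))) = exp (- u / (8 * real n))" by simp
  have "u / (8 * real n) \<le> u / (4 * real n)" using n u by (intro divide_left_mono) auto
  then have le: "exp (- u / (4 * real n)) \<le> exp (- u / (8 * real n))" by simp
  have "exp (- real n) * (G * sqrt 2 ^ n * exp (- u / (4 * real n))) \<le> exp (- real n) * (G * sqrt 2 ^ n * exp (- u / (8 * real n)))"
    using G le by (intro mult_left_mono) auto
  then show "G * (1 - exp (- real n) * sqrt 2 ^ n) * exp (- u / (8 * real n)) \<le> \<Phi>"
    unfolding \<Phi>_def G2 e G_def[symmetric] by (simp add: algebra_simps)
  show "\<Phi> \<le> G * exp (- u / (8 * real n))"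
    unfolding \<Phi>_def G2 e G_def[symmetric] using G by simp
  have "exp (- real n) * sqrt 2 ^ n < exp (- real n) * exp (real n)"
    by (intro mult_strict_left_mono sqrt2_power_lt_exp n) simp
  then show "0 < G * (1 - exp (- real n) * sqrt 2 ^ n)" using G by (simp flip: exp_add)
qed

lemma exp_small: "0 < e \<Longrightarrow> 0 < b \<Longrightarrow> \<exists>R\<ge>0. exp (- b * R\<^sup>2) < (e::real)"
proof -
  assume e: "0 < e" and b: "0 < b"
  define R where "R = max 1 ((\<bar>ln e\<bar> + 1) / b)"
  have R: "1 \<le> R" "(\<bar>ln e\<bar> + 1) / b \<le> R" by (auto simp: R_def)
  have "\<bar>ln e\<bar> + 1 \<le> b * R" using R(2) b by (simp add: field_simps)
  also have "\<dots> \<le> b * R\<^sup>2" using b R(1) by (simp add: power2_eq_square)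
  finally have "- b * R\<^sup>2 < ln e" by linarith
  then have "exp (- b * R\<^sup>2) < e" using e by (metis exp_less_cancel_iff exp_ln)
  then show ?thesis using R(1) by (intro exI[of _ R]) auto
qed

lemma sum_indicator_disjoint:
  fixes c :: "nat \<Rightarrow> complex"
  assumes "i < N" "w \<in> A i" "\<And>i l. i < N \<Longrightarrow> l < N \<Longrightarrow> i \<noteq> l \<Longrightarrow> A i \<inter> A l = {}"
  shows "(\<Sum>l<N. c l * indicator (A l) w) = c i"
proof -
  have "(\<Sum>l<N. c l * indicator (A l) w) = (\<Sum>l<N. if l = i then c i else 0)"
    using assms by (intro sum.cong) (auto simp: indicator_def)
  then show ?thesis using assms(1) by simp
qed

text \<open>Diagonal dominance for combinations of indicators of caps of radius \<open>1/\<kappa>\<close> whose centres are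
  \<open>(R + 2)/\<kappa>\<close>-separated: the off-diagonal part is estimated by the Schur test, with a kernel that has
  gained the factor \<open>e\<^bsup>-R\<^sup>2/(16n)\<^esup>\<close>.\<close>

lemma herglotz_test_functions:
  fixes A :: "nat \<Rightarrow> (real ^ 'n) set" and c :: "nat \<Rightarrow> complex"
  assumes \<kappa>: "1 \<le> \<kappa>" and R: "0 \<le> R"
    and A: "\<And>i. i < N \<Longrightarrow> A i \<in> sets surface_measure"
    and diam: "\<And>i w w'. i < N \<Longrightarrow> w \<in> A i \<Longrightarrow> w' \<in> A i \<Longrightarrow> \<kappa> * norm (w - w') \<le> 2"
    and sep: "\<And>i l w w'. i < N \<Longrightarrow> l < N \<Longrightarrow> i \<noteq> l \<Longrightarrow> w \<in> A i \<Longrightarrow> w' \<in> A l \<Longrightarrow> R \<le> \<kappa> * norm (w - w')"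
    and disj: "\<And>i l. i < N \<Longrightarrow> l < N \<Longrightarrow> i \<noteq> l \<Longrightarrow> A i \<inter> A l = {}"
    and big: "\<And>i. i < N \<Longrightarrow> m \<le> \<kappa> ^ (CARD('n) - 1) * measure surface_measure (A i)"
  defines "n \<equiv> real CARD('n)" and "f \<equiv> \<lambda>w. \<Sum>i<N. c i * indicator (A i) w"
  defines "G \<equiv> sqrt (pi / (2 * n)) ^ CARD('n)"
  defines "g \<equiv> G * (1 - exp (- n) * sqrt 2 ^ CARD('n))" and "a \<equiv> 1 / (16 * n)"
  shows "f \<in> L2_space surface_measure"
    and "L2_sqnorm surface_measure f = (\<Sum>i<N. (cmod (c i))\<^sup>2 * measure surface_measure (A i))"
    and "(g * exp (- 4 / (8 * n)) * m - G * exp (- a * R\<^sup>2) * (2 * n * exp a * sqrt (2 * pi / a) ^ CARD('n))) * L2_sqnorm surface_measure f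
      \<le> L2_sqnorm unit_ball_measure (herglotz_operator \<kappa> f)"
proof -
  let ?S = "surface_measure :: (real ^ 'n) measure"
  interpret S: finite_measure ?S by (rule finite_surface_measure)
  interpret SS: pair_sigma_finite ?S ?S ..
  interpret SP: finite_measure "?S \<Otimes>\<^sub>M ?S" by (rule finite_measure_pair_measure) (rule finite_surface_measure)+
  have n: "0 < n" by (simp add: n_def)
  have G: "0 < G" using n by (simp add: G_def)
  have g: "0 < g" unfolding g_def G_def n_def by (rule two_gaussian_kernel_bounds(3)) auto
  have a: "0 < a" using n by (simp add: a_def)
  have f_in: "f w = c i" if "i < N" "w \<in> A i" for w i
    unfolding f_def by (rule sum_indicator_disjoint) (use that disj in auto)
  have f_out: "f w = 0" if "\<And>i. i < N \<Longrightarrow> w \<notin> A i" for w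
    unfolding f_def using that by (intro sum.neutral) auto
  show f2: "f \<in> L2_space ?S"
    unfolding f_def
  proof (rule L2_space_sum, rule L2_space_bounded[where b=1, OF finite_surface_measure])
    show "indicator (A i) \<in> borel_measurable ?S" if "i \<in> {..<N}" for i
      using A[of i] that by (intro borel_measurable_indicator) auto
    show "cmod (indicator (A i) w) \<le> 1" for i w by (simp add: indicator_def)
  qed
  have cf: "(cmod (f w))\<^sup>2 = (\<Sum>i<N. (cmod (c i))\<^sup>2 * indicator (A i) w)" for w
  proof (cases "\<exists>i<N. w \<in> A i")
    case True
    then obtain i where i: "i < N" "w \<in> A i" by blast
    have "(\<Sum>l<N. (cmod (c l))\<^sup>2 * indicator (A l) w) = (\<Sum>l<N. if l = i then (cmod (c i))\<^sup>2 else 0)"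
      using i disj by (intro sum.cong) (auto simp: indicator_def)
    then show ?thesis using i by (simp add: f_in)
  next
    case False
    then show ?thesis by (subst f_out) (auto intro!: sum.neutral[symmetric])
  qed
  show sqn: "L2_sqnorm ?S f = (\<Sum>i<N. (cmod (c i))\<^sup>2 * measure ?S (A i))"
    unfolding L2_sqnorm_def cf
  proof (subst Bochner_Integration.integral_sum)
    show "integrable ?S (\<lambda>w. (cmod (c i))\<^sup>2 * indicator (A i) w)" if "i \<in> {..<N}" for i
      using A[of i] that by (intro integrable_mult_right integrable_real_indicator) (auto simp: less_top[symmetric])
    show "(\<Sum>i<N. LINT w|?S. (cmod (c i))\<^sup>2 * indicator (A i) w) = (\<Sum>i<N. (cmod (c i))\<^sup>2 * measure ?S (A i))"
      using sets.Int_space_eq2[OF A] by (intro sum.cong refl) simp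
  qed
  define \<Phi> where "\<Phi> u = sqrt (pi / (2 * n)) ^ CARD('n) * exp (- u / (4 * (2 * n)))
      - exp (- n) * (sqrt (pi / n) ^ CARD('n) * exp (- u / (4 * n)))" for u
  have \<Phi>: "g * exp (- u / (8 * n)) \<le> \<Phi> u" "\<Phi> u \<le> G * exp (- u / (8 * n))" if "0 \<le> u" for u
    using two_gaussian_kernel_bounds(1,2)[OF _ that, of "CARD('n)"] by (auto simp: \<Phi>_def g_def G_def n_def)
  let ?h = "\<lambda>x. (cmod (herglotz_wave \<kappa> f x))\<^sup>2"
  let ?ff = "\<lambda>p. f (fst p) * cnj (f (snd p))"
  let ?k = "\<lambda>p. exp (- a * \<kappa>\<^sup>2 * sqdist p) * (cmod (f (fst p)) * cmod (f (snd p)))"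
  have n2: "0 < 2 * n" using n by simp
  note h2 = herglotz_gaussian_form[OF f2 n2, of \<kappa>] and h1 = herglotz_gaussian_form[OF f2 n, of \<kappa>]
  define I where "I = (LINT x|lborel. exp (- (2 * n) * (norm x)\<^sup>2) * ?h x) - exp (- n) * (LINT x|lborel. exp (- n * (norm x)\<^sup>2) * ?h x)"
  have "I = (LINT x|lborel. exp (- (2 * n) * (norm x)\<^sup>2) * ?h x - exp (- n) * (exp (- n * (norm x)\<^sup>2) * ?h x))"
    unfolding I_def using h1(1) h2(1) by (subst Bochner_Integration.integral_diff) auto
  also have "\<dots> \<le> (LINT x|lborel. indicator (ball 0 1) x * ?h x)"
  proof (rule integral_mono)
    show "integrable lborel (\<lambda>x. exp (- (2 * n) * (norm x)\<^sup>2) * ?h x - exp (- n) * (exp (- n * (norm x)\<^sup>2) * ?h x))"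
      using h1(1) h2(1) by (intro Bochner_Integration.integrable_diff integrable_mult_right)
    show "integrable lborel (\<lambda>x. indicator (ball 0 1) x * ?h x)"
      using \<kappa> by (intro herglotz_operator_sqnorm f2) simp
    fix x :: "real ^ 'n"
    show "exp (- (2 * n) * (norm x)\<^sup>2) * ?h x - exp (- n) * (exp (- n * (norm x)\<^sup>2) * ?h x) \<le> indicator (ball 0 1) x * ?h x"
      using mult_right_mono[OF two_gaussians_le_indicator[OF n, of x], of "?h x"] by (simp add: algebra_simps)
  qed
  finally have I_le: "\<kappa> ^ (CARD('n) - 1) * I \<le> L2_sqnorm unit_ball_measure (herglotz_operator \<kappa> f)"
    using \<kappa> herglotz_operator_sqnorm(2)[OF f2, of \<kappa>] by (simp add: mult_left_mono)
  define K where "K s p = of_real (sqrt (pi / s) ^ CARD('n) * exp (- \<kappa>\<^sup>2 * sqdist p / (4 * s))) * ?ff p" for s p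
  have K: "integrable (?S \<Otimes>\<^sub>M ?S) (K (2 * n))" "integrable (?S \<Otimes>\<^sub>M ?S) (K n)"
    using h2(3) h1(3) unfolding K_def[abs_def] by blast+
  have Kdiff: "K (2 * n) p - of_real (exp (- n)) * K n p = of_real (\<Phi> (\<kappa>\<^sup>2 * sqdist p)) * ?ff p" for p
    unfolding K_def \<Phi>_def mult.assoc[symmetric] left_diff_distrib[symmetric] of_real_mult[symmetric] of_real_diff[symmetric]
    by simp
  have Kint: "integrable (?S \<Otimes>\<^sub>M ?S) (\<lambda>p. of_real (\<Phi> (\<kappa>\<^sup>2 * sqdist p)) * ?ff p)"
    unfolding Kdiff[symmetric] using K by (intro Bochner_Integration.integrable_diff integrable_mult_right)
  have "complex_of_real I = (LINT p|(?S \<Otimes>\<^sub>M ?S). K (2 * n) p) - of_real (exp (- n)) * (LINT p|(?S \<Otimes>\<^sub>M ?S). K n p)"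
    unfolding I_def of_real_diff of_real_mult h1(2) h2(2) K_def by simp
  also have "\<dots> = (LINT p|(?S \<Otimes>\<^sub>M ?S). K (2 * n) p - of_real (exp (- n)) * K n p)"
    using K by (subst Bochner_Integration.integral_diff) (auto simp del: of_real_exp)
  also have "\<dots> = (LINT p|(?S \<Otimes>\<^sub>M ?S). of_real (\<Phi> (\<kappa>\<^sup>2 * sqdist p)) * ?ff p)"
    unfolding Kdiff ..
  finally have I_eq: "I = (LINT p|(?S \<Otimes>\<^sub>M ?S). Re (of_real (\<Phi> (\<kappa>\<^sup>2 * sqdist p)) * ?ff p))"
    using integral_Re[OF Kint] by (metis Re_complex_of_real)
  \<comment> \<open>By disjointness \<open>?d\<close> equals \<open>?ff\<close> on pairs in a common
    cap and vanishes elsewhere: it is the diagonal part of the form.\<close>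
  let ?d = "\<lambda>p. \<Sum>i<N. (cmod (c i))\<^sup>2 * indicator (A i \<times> A i) p"
  have AA: "A i \<times> A i \<in> sets (?S \<Otimes>\<^sub>M ?S)" if "i < N" for i using A[OF that] by auto
  have d_int: "integrable (?S \<Otimes>\<^sub>M ?S) ?d"
    using AA by (intro Bochner_Integration.integrable_sum integrable_mult_right integrable_real_indicator)
      (auto simp: less_top[symmetric])
  have d_eq: "(LINT p|(?S \<Otimes>\<^sub>M ?S). ?d p) = (\<Sum>i<N. (cmod (c i))\<^sup>2 * (measure ?S (A i))\<^sup>2)"
  proof -
    have m: "measure (?S \<Otimes>\<^sub>M ?S) (A i \<times> A i) = (measure ?S (A i))\<^sup>2" if "i < N" for i
      using A[OF that]
      by (simp add: measure_def S.emeasure_pair_measure_Times enn2real_mult power2_eq_square)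
    have "(LINT p|(?S \<Otimes>\<^sub>M ?S). ?d p) = (\<Sum>i<N. LINT p|(?S \<Otimes>\<^sub>M ?S). (cmod (c i))\<^sup>2 * indicator (A i \<times> A i) p)"
      using AA by (intro Bochner_Integration.integral_sum integrable_mult_right integrable_real_indicator)
        (auto simp: less_top[symmetric])
    also have "\<dots> = (\<Sum>i<N. (cmod (c i))\<^sup>2 * (measure ?S (A i))\<^sup>2)"
      using sets.Int_space_eq2[OF AA] m by (intro sum.cong refl) simp
    finally show ?thesis .
  qed
  note k = surface_gaussian_schur[OF f2 a \<kappa>]
  \<comment> \<open>Pairs in a common cap feed the diagonal; pairs in different caps cost at most
    the Schur kernel with its gained factor; for all other pairs the product of values is
    zero.\<close>
  have point: "g * exp (- 4 / (8 * n)) * ?d p - G * exp (- a * R\<^sup>2) * ?k p \<le> Re (of_real (\<Phi> (\<kappa>\<^sup>2 * sqdist p)) * ?ff p)" for p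
  proof -
    obtain w w' where p: "p = (w, w')" by (cases p)
    define u where "u = \<kappa>\<^sup>2 * sqdist p"
    have u: "u = (\<kappa> * norm (w - w'))\<^sup>2" "0 \<le> u" by (simp_all add: u_def p power_mult_distrib)
    have k0: "0 \<le> G * exp (- a * R\<^sup>2) * ?k p" using G by (intro mult_nonneg_nonneg) auto
    consider (same) i where "i < N" "w \<in> A i" "w' \<in> A i"
      | (diff) i l where "i < N" "l < N" "i \<noteq> l" "w \<in> A i" "w' \<in> A l"
      | (left) "\<And>i. i < N \<Longrightarrow> w \<notin> A i" | (right) "\<And>i. i < N \<Longrightarrow> w' \<notin> A i"
      by metis
    then show ?thesis
    proof cases
      case same
      have "?d p = (\<Sum>l<N. if l = i then (cmod (c i))\<^sup>2 else 0)"
        using same disj by (intro sum.cong) (auto simp: indicator_def p)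
      then have d: "?d p = (cmod (c i))\<^sup>2" using same by simp
      have ff: "?ff p = of_real ((cmod (c i))\<^sup>2)"
        using same by (simp add: p f_in complex_norm_square del: of_real_power)
      \<comment> \<open>The diameter bound 2 is the origin of the exponent
        \<open>- 4 / (8 * n)\<close>.\<close>
      have "u \<le> 2\<^sup>2" unfolding u(1) using \<kappa> by (intro power_mono diam[OF same]) auto
      then have "exp (- 4 / (8 * n)) \<le> exp (- u / (8 * n))"
        unfolding exp_le_cancel_iff using n by (intro divide_right_mono) auto
      then have "g * exp (- 4 / (8 * n)) \<le> g * exp (- u / (8 * n))" using g by (intro mult_left_mono) auto
      also have "\<dots> \<le> \<Phi> u" by (rule \<Phi>(1)[OF u(2)])
      finally have "g * exp (- 4 / (8 * n)) * (cmod (c i))\<^sup>2 \<le> \<Phi> u * (cmod (c i))\<^sup>2" by (intro mult_right_mono) auto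
      moreover have "Re (of_real (\<Phi> (\<kappa>\<^sup>2 * sqdist p)) * ?ff p) = \<Phi> u * (cmod (c i))\<^sup>2"
        unfolding ff u_def by simp
      ultimately show ?thesis using k0 unfolding d by linarith
    next
      case diff
      have "l' < N \<Longrightarrow> \<not> (w \<in> A l' \<and> w' \<in> A l')" for l'
        using diff disj by (metis IntI empty_iff)
      then have d: "?d p = 0" by (intro sum.neutral) (auto simp: indicator_def p)
      have Ru: "R\<^sup>2 \<le> u" unfolding u(1) using sep[OF diff] R by (intro power_mono) auto
      \<comment> \<open>The rate 1/(8n) is split into two halves \<open>a\<close>: one is evaluated
        at the separation and gives smallness, the other remains as the kernel of the Schur
        test.\<close>
      have "exp (- u / (8 * n)) = exp (- a * u) * exp (- a * u)"
        using n by (simp add: a_def flip: exp_add)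
      also have "\<dots> \<le> exp (- a * R\<^sup>2) * exp (- a * u)"
        using a Ru by (intro mult_right_mono) auto
      finally have "G * exp (- u / (8 * n)) \<le> G * (exp (- a * R\<^sup>2) * exp (- a * u))" using G by simp
      then have up: "\<Phi> u \<le> G * (exp (- a * R\<^sup>2) * exp (- a * u))" using \<Phi>(2)[OF u(2)] by linarith
      have "0 \<le> \<Phi> u" using \<Phi>(1)[OF u(2)] g by (meson exp_ge_zero less_imp_le mult_nonneg_nonneg order_trans)
      then have "cmod (of_real (\<Phi> u) * ?ff p) = \<Phi> u * (cmod (f w) * cmod (f w'))"
        by (simp add: norm_mult p)
      also have "\<dots> \<le> G * (exp (- a * R\<^sup>2) * exp (- a * u)) * (cmod (f w) * cmod (f w'))"
        by (intro mult_right_mono up) auto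
      also have "\<dots> = G * exp (- a * R\<^sup>2) * ?k p" by (simp add: p u_def mult_ac)
      finally have "\<bar>Re (of_real (\<Phi> u) * ?ff p)\<bar> \<le> G * exp (- a * R\<^sup>2) * ?k p"
        using abs_Re_le_cmod order_trans by blast
      then show ?thesis unfolding d u_def by linarith
    next
      case left
      then have "?d p = 0" "f w = 0" by (auto intro!: sum.neutral f_out simp: indicator_def p)
      then show ?thesis using k0 by (simp add: p)
    next
      case right
      then have "?d p = 0" "f w' = 0" by (auto intro!: sum.neutral f_out simp: indicator_def p)
      then show ?thesis using k0 by (simp add: p)
    qed
  qed
  define D where "D = 2 * n * exp a * sqrt (2 * pi / a) ^ CARD('n)"
  let ?q = "L2_sqnorm ?S f"
  have "g * exp (- 4 / (8 * n)) * (\<Sum>i<N. (cmod (c i))\<^sup>2 * (measure ?S (A i))\<^sup>2)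
      - G * exp (- a * R\<^sup>2) * (D / \<kappa> ^ (CARD('n) - 1) * ?q)
      \<le> g * exp (- 4 / (8 * n)) * (LINT p|(?S \<Otimes>\<^sub>M ?S). ?d p) - G * exp (- a * R\<^sup>2) * (LINT p|(?S \<Otimes>\<^sub>M ?S). ?k p)"
    unfolding d_eq D_def n_def using G by (intro diff_left_mono mult_left_mono k(2)) auto
  also have "\<dots> = (LINT p|(?S \<Otimes>\<^sub>M ?S). g * exp (- 4 / (8 * n)) * ?d p - G * exp (- a * R\<^sup>2) * ?k p)"
    using d_int k(1) by (subst Bochner_Integration.integral_diff) (auto intro!: integrable_mult_right simp del: integrable_mult_right_iff)
  also have "\<dots> \<le> I"
    unfolding I_eq
  proof (rule integral_mono)
    show "integrable (?S \<Otimes>\<^sub>M ?S) (\<lambda>p. g * exp (- 4 / (8 * n)) * ?d p - G * exp (- a * R\<^sup>2) * ?k p)"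
      using d_int k(1) by (intro Bochner_Integration.integrable_diff integrable_mult_right)
    show "integrable (?S \<Otimes>\<^sub>M ?S) (\<lambda>p. Re (of_real (\<Phi> (\<kappa>\<^sup>2 * sqdist p)) * ?ff p))"
      by (rule integrable_Re[OF Kint])
  qed (rule point)
  finally have low: "\<kappa> ^ (CARD('n) - 1) * (g * exp (- 4 / (8 * n)) * (\<Sum>i<N. (cmod (c i))\<^sup>2 * (measure ?S (A i))\<^sup>2)
      - G * exp (- a * R\<^sup>2) * (D / \<kappa> ^ (CARD('n) - 1) * ?q)) \<le> \<kappa> ^ (CARD('n) - 1) * I"
    using \<kappa> by (intro mult_left_mono) auto
  \<comment> \<open>The diagonal carries squared cap measures; one factor is traded for
    \<open>m\<close> through \<open>big\<close>, which leaves the squared norm of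
    \<open>f\<close>.\<close>
  have "m * ?q = (\<Sum>i<N. (cmod (c i))\<^sup>2 * measure ?S (A i) * m)"
    unfolding sqn sum_distrib_left by (simp add: mult_ac)
  also have "\<dots> \<le> (\<Sum>i<N. (cmod (c i))\<^sup>2 * measure ?S (A i) * (\<kappa> ^ (CARD('n) - 1) * measure ?S (A i)))"
    by (intro sum_mono mult_left_mono big) auto
  also have "\<dots> = \<kappa> ^ (CARD('n) - 1) * (\<Sum>i<N. (cmod (c i))\<^sup>2 * (measure ?S (A i))\<^sup>2)"
    unfolding sum_distrib_left by (simp add: power2_eq_square mult_ac)
  finally have "g * exp (- 4 / (8 * n)) * (m * ?q)
      \<le> g * exp (- 4 / (8 * n)) * (\<kappa> ^ (CARD('n) - 1) * (\<Sum>i<N. (cmod (c i))\<^sup>2 * (measure ?S (A i))\<^sup>2))"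
    using g by (intro mult_left_mono) auto
  moreover have "\<kappa> ^ (CARD('n) - 1) * (G * exp (- a * R\<^sup>2) * (D / \<kappa> ^ (CARD('n) - 1) * ?q)) = G * exp (- a * R\<^sup>2) * D * ?q"
    using \<kappa> by simp
  ultimately have "(g * exp (- 4 / (8 * n)) * m - G * exp (- a * R\<^sup>2) * D) * ?q \<le> \<kappa> ^ (CARD('n) - 1) * I"
    using low unfolding right_diff_distrib left_diff_distrib by (simp only: mult_ac)
  then show "(g * exp (- 4 / (8 * n)) * m - G * exp (- a * R\<^sup>2) * (2 * n * exp a * sqrt (2 * pi / a) ^ CARD('n))) * ?q
      \<le> L2_sqnorm unit_ball_measure (herglotz_operator \<kappa> f)"
    using I_le unfolding D_def by linarith
qed

text \<open>The caps are centred at a separated net. Covering forces at least c0 \<kappa>^{n-1} of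
  them, because a covering cap has measure at most of order ((R + 2)/\<kappa>)^{n-1}; separation
  makes the lower bound on their span positive, uniformly in \<kappa>.\<close>

lemma herglotz_test_space:
  "\<exists>s>0. \<exists>c0>0. \<forall>\<kappa>\<ge>1. \<exists>N. \<exists>v :: nat \<Rightarrow> real ^ 'n \<Rightarrow> complex. c0 * \<kappa> ^ (CARD('n) - 1) \<le> real N \<and>
     (\<forall>i<N. v i \<in> L2_space surface_measure) \<and>
     (\<forall>c. (\<exists>i<N. c i \<noteq> 0) \<longrightarrow> 0 < L2_sqnorm surface_measure (\<lambda>w. \<Sum>i<N. c i * v i w)) \<and>
     (\<forall>c. s\<^sup>2 * L2_sqnorm surface_measure (\<lambda>w. \<Sum>i<N. c i * v i w)
        \<le> L2_sqnorm unit_ball_measure (herglotz_operator \<kappa> (\<lambda>w. \<Sum>i<N. c i * v i w)))"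
proof -
  let ?S = "surface_measure :: (real ^ 'n) measure"
  interpret S: finite_measure ?S by (rule finite_surface_measure)
  obtain m where m: "0 < m" "\<And>r w. 0 < r \<Longrightarrow> r \<le> 1 \<Longrightarrow> norm w = 1 \<Longrightarrow>
      m * r ^ (CARD('n) - 1) \<le> measure ?S (sphere 0 1 \<inter> ball w r)"
    using cap_lower_bound[where ?'n='n] by blast
  obtain C where C: "0 < C" "\<And>r w. 0 < r \<Longrightarrow> norm w = 1 \<Longrightarrow>
      measure ?S (sphere 0 1 \<inter> ball w r) \<le> C * r ^ (CARD('n) - 1)"
    using cap_upper_bound[where ?'n='n] by blast
  define n where "n = real CARD('n)"
  define G where "G = sqrt (pi / (2 * n)) ^ CARD('n)"
  define g where "g = G * (1 - exp (- n) * sqrt 2 ^ CARD('n))"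
  define a where "a = 1 / (16 * n)"
  define D where "D = 2 * n * exp a * sqrt (2 * pi / a) ^ CARD('n)"
  have n: "0 < n" by (simp add: n_def)
  have pos: "0 < G" "0 < a" "0 < D" using n by (auto simp: G_def a_def D_def)
  have g: "0 < g" unfolding g_def G_def n_def by (rule two_gaussian_kernel_bounds(3)) auto
  define \<alpha> where "\<alpha> = g * exp (- 4 / (8 * n)) * m"
  have \<alpha>: "0 < \<alpha>" using g m by (simp add: \<alpha>_def)
  \<comment> \<open>\<open>R\<close> depends on the dimension alone and makes the off-diagonal loss
    at most half of the diagonal gain \<open>\<alpha>\<close>.\<close>
  obtain R where R: "0 \<le> R" "exp (- a * R\<^sup>2) < \<alpha> / (2 * (G * D))"
    using exp_small[of "\<alpha> / (2 * (G * D))" a] \<alpha> pos by auto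
  have bracket: "\<alpha> / 2 \<le> \<alpha> - G * exp (- a * R\<^sup>2) * D"
    using R(2) pos by (simp add: field_simps)
  define mS where "mS = measure ?S (space ?S)"
  obtain w0 :: "real ^ 'n" where "norm w0 = 1" using vector_choose_size[of 1] by auto
  then have "m * 1 ^ (CARD('n) - 1) \<le> mS"
    using m(2)[of 1 w0] S.bounded_measure[of "sphere 0 1 \<inter> ball w0 1"] unfolding mS_def by linarith
  then have mS: "0 < mS" using m(1) by simp
  define c0 where "c0 = mS / (C * (R + 2) ^ (CARD('n) - 1))"
  have R2: "0 < (R + 2) ^ (CARD('n) - 1)" using R(1) by simp
  have c0: "0 < c0" using mS C(1) R2 by (simp add: c0_def)
  have "\<exists>N. \<exists>v :: nat \<Rightarrow> real ^ 'n \<Rightarrow> complex. c0 * \<kappa> ^ (CARD('n) - 1) \<le> real N \<and>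
     (\<forall>i<N. v i \<in> L2_space surface_measure) \<and>
     (\<forall>c. (\<exists>i<N. c i \<noteq> 0) \<longrightarrow> 0 < L2_sqnorm surface_measure (\<lambda>w. \<Sum>i<N. c i * v i w)) \<and>
     (\<forall>c. (sqrt (\<alpha> / 2))\<^sup>2 * L2_sqnorm surface_measure (\<lambda>w. \<Sum>i<N. c i * v i w)
        \<le> L2_sqnorm unit_ball_measure (herglotz_operator \<kappa> (\<lambda>w. \<Sum>i<N. c i * v i w)))"
    if \<kappa>: "1 \<le> \<kappa>" for \<kappa>
  proof -
    \<comment> \<open>The extra 2 is the sum of two cap radii in units of 1/\<kappa>: points of
      different caps stay at least R/\<kappa> apart.\<close>
    define \<rho> where "\<rho> = (R + 2) / \<kappa>"
    have \<rho>: "0 < \<rho>" and \<kappa>\<rho>: "\<kappa> * \<rho> = R + 2" using R(1) \<kappa> by (simp_all add: \<rho>_def)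
    obtain P where P: "P \<subseteq> sphere (0 :: real ^ 'n) 1" "finite P"
      "\<And>p q. p \<in> P \<Longrightarrow> q \<in> P \<Longrightarrow> p \<noteq> q \<Longrightarrow> \<rho> \<le> dist p q" "sphere 0 1 \<subseteq> (\<Union>p\<in>P. ball p \<rho>)"
      using compact_separated_net[of "sphere (0 :: real ^ 'n) 1" \<rho>] \<rho> by auto
    define N where "N = card P"
    obtain h where h: "bij_betw h {..<N} P"
      using ex_bij_betw_nat_finite[OF P(2)] unfolding N_def atLeast0LessThan by blast
    have hP: "h i \<in> P" "norm (h i) = 1" if "i < N" for i
      using h P(1) that by (auto simp: bij_betw_def)
    have hne: "\<rho> \<le> norm (h i - h l)" if "i < N" "l < N" "i \<noteq> l" for i l
    proof -
      have "h i \<noteq> h l" using h that unfolding bij_betw_def inj_on_def by blast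
      then show ?thesis using P(3)[OF hP(1) hP(1), OF that(1,2)] by (simp add: dist_norm)
    qed
    define A where "A i = sphere 0 1 \<inter> ball (h i) (1 / \<kappa>)" for i
    have cap: "sphere 0 1 \<inter> ball p r \<in> sets ?S" for p r by (auto simp: sets_surface_measure sets_restrict_space)
    have A: "A i \<in> sets ?S" for i unfolding A_def by (rule cap)
    have Ad: "\<kappa> * norm (w - h i) < 1" if "w \<in> A i" for w i
      using that \<kappa> by (simp add: A_def dist_norm norm_minus_commute field_simps)
    have diam: "\<kappa> * norm (w - w') \<le> 2" if "i < N" "w \<in> A i" "w' \<in> A i" for i w w'
    proof -
      have "norm (w - w') \<le> norm (w - h i) + norm (w' - h i)"
        using norm_triangle_ineq4[of "w - h i" "w' - h i"] by simp
      then have "\<kappa> * norm (w - w') \<le> \<kappa> * (norm (w - h i) + norm (w' - h i))"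
        using \<kappa> by (intro mult_left_mono) auto
      also have "\<dots> = \<kappa> * norm (w - h i) + \<kappa> * norm (w' - h i)" by (simp add: distrib_left)
      finally show ?thesis using Ad[OF that(2)] Ad[OF that(3)] by linarith
    qed
    have sep: "R < \<kappa> * norm (w - w')" if "i < N" "l < N" "i \<noteq> l" "w \<in> A i" "w' \<in> A l" for i l w w'
    proof -
      have "norm (h i - h l) \<le> norm (w - h i) + norm (w - w') + norm (w' - h l)"
        using dist_triangle[of "h i" "h l" w] dist_triangle[of w "h l" w'] unfolding dist_norm
        by (simp add: norm_minus_commute)
      then have "\<rho> \<le> norm (w - h i) + norm (w - w') + norm (w' - h l)" using hne[OF that(1-3)] by linarith
      then have "\<kappa> * \<rho> \<le> \<kappa> * (norm (w - h i) + norm (w - w') + norm (w' - h l))"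
        using \<kappa> by (intro mult_left_mono) auto
      then have "R + 2 \<le> \<kappa> * norm (w - h i) + \<kappa> * norm (w - w') + \<kappa> * norm (w' - h l)"
        using \<kappa>\<rho> unfolding distrib_left by simp
      then show ?thesis using Ad[OF that(4)] Ad[OF that(5)] by linarith
    qed
    have disj: "A i \<inter> A l = {}" if "i < N" "l < N" "i \<noteq> l" for i l
      using sep[OF that] R(1) by fastforce
    have big: "m \<le> \<kappa> ^ (CARD('n) - 1) * measure ?S (A i)" if "i < N" for i
    proof -
      have "m * (1 / \<kappa>) ^ (CARD('n) - 1) \<le> measure ?S (A i)"
        unfolding A_def using \<kappa> hP(2)[OF that] by (intro m) auto
      then show ?thesis using \<kappa> by (simp add: power_divide field_simps)
    qed
    define v :: "nat \<Rightarrow> real ^ 'n \<Rightarrow> complex" where "v i = indicator (A i)" for i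
    note test = herglotz_test_functions[where N=N and A=A and m=m, OF \<kappa> R(1) A diam less_imp_le[OF sep] disj big,
        folded n_def, folded G_def g_def a_def, folded D_def \<alpha>_def]
    have test2: "L2_sqnorm ?S (\<lambda>w. \<Sum>i<N. c i * indicator (A i) w) = (\<Sum>i<N. (cmod (c i))\<^sup>2 * measure ?S (A i))" for c
      by (rule test(2)) assumption+
    have test3: "(\<alpha> - G * exp (- a * R\<^sup>2) * D) * L2_sqnorm ?S (\<lambda>w. \<Sum>i<N. c i * indicator (A i) w)
        \<le> L2_sqnorm unit_ball_measure (herglotz_operator \<kappa> (\<lambda>w. \<Sum>i<N. c i * indicator (A i) w))" for c
      by (rule test(3)) assumption+
    \<comment> \<open>Covering count: the mass of the whole sphere is exhausted by \<open>N\<close>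
      caps of radius \<open>\<rho>\<close>.\<close>
    have "mS \<le> (\<Sum>p\<in>P. measure ?S (sphere 0 1 \<inter> ball p \<rho>))"
    proof -
      have "mS \<le> measure ?S (\<Union>p\<in>P. sphere 0 1 \<inter> ball p \<rho>)"
        unfolding mS_def using P(2,4) cap by (intro S.finite_measure_mono sets.finite_UN) auto
      also have "\<dots> \<le> (\<Sum>p\<in>P. measure ?S (sphere 0 1 \<inter> ball p \<rho>))"
        using P(2) cap by (intro S.finite_measure_subadditive_finite) auto
      finally show ?thesis .
    qed
    also have "\<dots> \<le> (\<Sum>p\<in>P. C * \<rho> ^ (CARD('n) - 1))"
      using P(1) by (intro sum_mono C \<rho>) auto
    also have "\<dots> = real N * (C * (R + 2) ^ (CARD('n) - 1) / \<kappa> ^ (CARD('n) - 1))"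
      by (simp add: N_def \<rho>_def power_divide)
    finally have "mS \<le> real N * (C * (R + 2) ^ (CARD('n) - 1) / \<kappa> ^ (CARD('n) - 1))" .
    then have "c0 * \<kappa> ^ (CARD('n) - 1) \<le> real N"
      using \<kappa> C(1) R2 by (simp add: c0_def field_simps)
    moreover have "\<forall>i<N. v i \<in> L2_space ?S"
    proof (intro allI impI)
      fix i assume "i < N"
      show "v i \<in> L2_space ?S"
        unfolding v_def
        by (rule L2_space_bounded[where b=1, OF finite_surface_measure borel_measurable_indicator[OF A]])
           (simp add: indicator_def)
    qed
    moreover have "0 < L2_sqnorm ?S (\<lambda>w. \<Sum>i<N. c i * v i w)" if "\<exists>i<N. c i \<noteq> 0" for c
    proof -
      obtain i where i: "i < N" "c i \<noteq> 0" using \<open>\<exists>i<N. c i \<noteq> 0\<close> by blast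
      have "0 < \<kappa> ^ (CARD('n) - 1) * measure ?S (A i)" using big[OF i(1)] m(1) by linarith
      then have "0 < measure ?S (A i)" using \<kappa> by (simp add: zero_less_mult_iff)
      then show ?thesis
        unfolding v_def test2 using i by (intro sum_pos2[of _ i]) auto
    qed
    moreover have "(sqrt (\<alpha> / 2))\<^sup>2 * L2_sqnorm ?S (\<lambda>w. \<Sum>i<N. c i * v i w)
        \<le> L2_sqnorm unit_ball_measure (herglotz_operator \<kappa> (\<lambda>w. \<Sum>i<N. c i * v i w))" for c
    proof -
      have "\<alpha> / 2 * L2_sqnorm ?S (\<lambda>w. \<Sum>i<N. c i * v i w)
          \<le> (\<alpha> - G * exp (- a * R\<^sup>2) * D) * L2_sqnorm ?S (\<lambda>w. \<Sum>i<N. c i * v i w)"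
        by (intro mult_right_mono bracket L2_sqnorm_nonneg)
      also have "\<dots> \<le> L2_sqnorm unit_ball_measure (herglotz_operator \<kappa> (\<lambda>w. \<Sum>i<N. c i * v i w))"
        unfolding v_def by (rule test3)
      finally show ?thesis using \<alpha> by simp
    qed
    ultimately show ?thesis by (intro exI[of _ N] exI[of _ v]) auto
  qed
  then show ?thesis using c0 \<alpha> by (intro exI[of _ "sqrt (\<alpha> / 2)"] conjI exI[of _ c0]) auto
qed

section \<open>Polynomials on the sphere\<close>

text \<open>Modulo \<open>|\<omega>|\<^sup>2 = 1\<close> every polynomial is a combination of monomials that are at most linear in a
  distinguished variable.  This is what makes the count grow like \<open>d\<^bsup>n-1\<^esup>\<close> instead of \<open>d\<^bsup>n\<^esup>\<close>.\<close>

definition sphere_exponents :: "'n \<Rightarrow> nat \<Rightarrow> ('n::finite \<Rightarrow> nat) set" where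
  "sphere_exponents i0 d = {\<alpha>. \<alpha> i0 \<le> 1 \<and> (\<forall>i. i \<noteq> i0 \<longrightarrow> \<alpha> i \<le> 2 * d)}"

definition vec_monomial :: "('n::finite \<Rightarrow> nat) \<Rightarrow> real ^ 'n \<Rightarrow> real" where
  "vec_monomial \<alpha> w = (\<Prod>i\<in>UNIV. (w $ i) ^ \<alpha> i)"

text \<open>Equality is demanded on unit vectors, so that |w|^2 = 1 may be used for reduction; level
  \<open>d\<close> is meant to hold products of up to \<open>d\<close> coordinates.\<close>

definition sphere_poly :: "'n::finite \<Rightarrow> nat \<Rightarrow> (real ^ 'n \<Rightarrow> real) \<Rightarrow> bool" where
  "sphere_poly i0 d g \<longleftrightarrow>
     (\<exists>c. \<forall>w. norm w = 1 \<longrightarrow> g w = (\<Sum>\<alpha>\<in>sphere_exponents i0 d. c \<alpha> * vec_monomial \<alpha> w))"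

lemma sphere_exponents_card:
  "finite (sphere_exponents i0 d)" "card (sphere_exponents i0 d) = 2 * (2 * d + 1) ^ (CARD('n) - 1)"
  for i0 :: "'n::finite"
proof -
  let ?F = "\<lambda>i. if i = i0 then {..1::nat} else {..2 * d}"
  have eq: "sphere_exponents i0 d = PiE UNIV ?F"
    by (auto simp: sphere_exponents_def PiE_def Pi_def split: if_splits)
  show "finite (sphere_exponents i0 d)" unfolding eq by (rule finite_PiE) auto
  have "card (sphere_exponents i0 d) = (\<Prod>i\<in>UNIV. card (?F i))"
    unfolding eq by (rule card_PiE) simp
  also have "\<dots> = card (?F i0) * (\<Prod>i\<in>UNIV - {i0}. card (?F i))" by (rule prod.remove) auto
  also have "(\<Prod>i\<in>UNIV - {i0}. card (?F i)) = (\<Prod>i\<in>UNIV - {i0}. 2 * d + 1)"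
    by (intro prod.cong) auto
  finally show "card (sphere_exponents i0 d) = 2 * (2 * d + 1) ^ (CARD('n) - 1)" by simp
qed

lemma sphere_poly_cong: "sphere_poly i0 d g \<Longrightarrow> (\<And>w. norm w = 1 \<Longrightarrow> h w = g w) \<Longrightarrow> sphere_poly i0 d h"
  by (simp add: sphere_poly_def)

lemma sphere_poly_monomial:
  fixes i0 :: "'n::finite"
  assumes "\<alpha> \<in> sphere_exponents i0 d"
  shows "sphere_poly i0 d (vec_monomial \<alpha>)"
  unfolding sphere_poly_def
proof (intro exI[of _ "\<lambda>\<beta>. if \<beta> = \<alpha> then 1 else 0"] allI impI)
  fix w :: "real ^ 'n"
  have "(\<Sum>\<beta>\<in>sphere_exponents i0 d. (if \<beta> = \<alpha> then 1 else 0) * vec_monomial \<beta> w)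
      = (\<Sum>\<beta>\<in>sphere_exponents i0 d. if \<beta> = \<alpha> then vec_monomial \<beta> w else 0)"
    by (intro sum.cong) auto
  then show "vec_monomial \<alpha> w = (\<Sum>\<beta>\<in>sphere_exponents i0 d. (if \<beta> = \<alpha> then 1 else 0) * vec_monomial \<beta> w)"
    using assms sphere_exponents_card(1)[of i0 d] by simp
qed

lemma sphere_poly_sum:
  fixes i0 :: "'n::finite"
  assumes "\<And>i. i \<in> J \<Longrightarrow> sphere_poly i0 d (g i)"
  shows "sphere_poly i0 d (\<lambda>w. \<Sum>i\<in>J. a i * g i w)"
proof -
  obtain c where c: "\<And>i w. i \<in> J \<Longrightarrow> norm w = 1 \<Longrightarrow> g i w = (\<Sum>\<alpha>\<in>sphere_exponents i0 d. c i \<alpha> * vec_monomial \<alpha> w)"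
    using assms unfolding sphere_poly_def by metis
  show ?thesis
    unfolding sphere_poly_def
  proof (intro exI[of _ "\<lambda>\<alpha>. \<Sum>i\<in>J. a i * c i \<alpha>"] allI impI)
    fix w :: "real ^ 'n" assume w: "norm w = 1"
    have "(\<Sum>i\<in>J. a i * g i w) = (\<Sum>i\<in>J. \<Sum>\<alpha>\<in>sphere_exponents i0 d. a i * c i \<alpha> * vec_monomial \<alpha> w)"
      by (intro sum.cong refl) (simp add: c[OF _ w] sum_distrib_left mult.assoc)
    also have "\<dots> = (\<Sum>\<alpha>\<in>sphere_exponents i0 d. \<Sum>i\<in>J. a i * c i \<alpha> * vec_monomial \<alpha> w)" by (rule sum.swap)
    finally show "(\<Sum>i\<in>J. a i * g i w) = (\<Sum>\<alpha>\<in>sphere_exponents i0 d. (\<Sum>i\<in>J. a i * c i \<alpha>) * vec_monomial \<alpha> w)"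
      by (simp add: sum_distrib_right)
  qed
qed

lemma sphere_poly_diff:
  assumes "sphere_poly i0 d g" "sphere_poly i0 d h"
  shows "sphere_poly i0 d (\<lambda>w. g w - h w)"
  by (rule sphere_poly_cong[OF sphere_poly_sum[of "{True, False}" i0 d "\<lambda>b. if b then g else h" "\<lambda>b. if b then 1 else -1"]])
     (use assms in auto)

lemma vec_monomial_mult:
  "w $ i ^ k * vec_monomial \<alpha> w = vec_monomial (\<alpha>(i := \<alpha> i + k)) w"
proof -
  have "vec_monomial \<alpha> w = (w $ i) ^ \<alpha> i * (\<Prod>l\<in>UNIV - {i}. (w $ l) ^ \<alpha> l)"
    unfolding vec_monomial_def by (rule prod.remove) auto
  moreover have "vec_monomial (\<alpha>(i := \<alpha> i + k)) w = (w $ i) ^ (\<alpha> i + k) * (\<Prod>l\<in>UNIV - {i}. (w $ l) ^ \<alpha> l)"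
    unfolding vec_monomial_def by (subst prod.remove[of UNIV i]) (auto intro!: prod.cong)
  ultimately show ?thesis by (simp add: power_add mult_ac)
qed

lemma sphere_poly_mult_coord_monomial:
  fixes i0 :: "'n::finite"
  assumes \<alpha>: "\<alpha> \<in> sphere_exponents i0 d"
  shows "sphere_poly i0 (Suc d) (\<lambda>w. w $ i * vec_monomial \<alpha> w)"
proof (cases "i = i0 \<and> \<alpha> i0 = 1")
  case False
  then have "\<alpha>(i := \<alpha> i + 1) \<in> sphere_exponents i0 (Suc d)"
    using \<alpha> by (auto simp: sphere_exponents_def)
  from sphere_poly_monomial[OF this] show ?thesis
    using vec_monomial_mult[of _ i 1 \<alpha>] by simp
next
  case True
  define \<beta> where "\<beta> = \<alpha>(i0 := 0)"
  have \<alpha>\<beta>: "\<alpha> = \<beta>(i0 := \<beta> i0 + 1)" using True by (auto simp: \<beta>_def)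
  have 1: "sphere_poly i0 (Suc d) (vec_monomial \<beta>)"
    using \<alpha> by (intro sphere_poly_monomial) (auto simp: sphere_exponents_def \<beta>_def intro: le_trans)
  have 2: "sphere_poly i0 (Suc d) (\<lambda>w. \<Sum>l\<in>UNIV - {i0}. 1 * vec_monomial (\<beta>(l := \<beta> l + 2)) w)"
    using \<alpha> by (intro sphere_poly_sum sphere_poly_monomial) (auto simp: sphere_exponents_def \<beta>_def intro: le_trans)
  show ?thesis
  proof (rule sphere_poly_cong[OF sphere_poly_diff[OF 1 2]])
    fix w :: "real ^ 'n" assume w: "norm w = 1"
    have "(\<Sum>l\<in>UNIV. (w $ l)\<^sup>2) = 1"
      using w by (simp add: norm_vec_def L2_set_def)
    then have "(w $ i0)\<^sup>2 + (\<Sum>l\<in>UNIV - {i0}. (w $ l)\<^sup>2) = 1"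
      by (subst (asm) sum.remove[of UNIV i0]) auto
    then have sq: "(w $ i0)\<^sup>2 = 1 - (\<Sum>l\<in>UNIV - {i0}. (w $ l)\<^sup>2)" by simp
    have "vec_monomial \<alpha> w = w $ i0 ^ 1 * vec_monomial \<beta> w"
      unfolding \<alpha>\<beta> by (rule vec_monomial_mult[symmetric])
    then have "w $ i * vec_monomial \<alpha> w = (w $ i0)\<^sup>2 * vec_monomial \<beta> w"
      using True by (simp add: power2_eq_square mult_ac)
    also have "\<dots> = vec_monomial \<beta> w - (\<Sum>l\<in>UNIV - {i0}. (w $ l)\<^sup>2 * vec_monomial \<beta> w)"
      unfolding sq by (simp add: left_diff_distrib sum_distrib_right)
    also have "\<dots> = vec_monomial \<beta> w - (\<Sum>l\<in>UNIV - {i0}. 1 * vec_monomial (\<beta>(l := \<beta> l + 2)) w)"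
      unfolding vec_monomial_mult by simp
    finally show "w $ i * vec_monomial \<alpha> w = \<dots>" .
  qed
qed

lemma sphere_poly_mult_coord:
  assumes "sphere_poly i0 d g"
  shows "sphere_poly i0 (Suc d) (\<lambda>w. w $ i * g w)"
proof -
  obtain c where c: "\<And>w. norm w = 1 \<Longrightarrow> g w = (\<Sum>\<alpha>\<in>sphere_exponents i0 d. c \<alpha> * vec_monomial \<alpha> w)"
    using assms unfolding sphere_poly_def by metis
  show ?thesis
    by (rule sphere_poly_cong[OF sphere_poly_sum[of "sphere_exponents i0 d" i0 "Suc d" "\<lambda>\<alpha> w. w $ i * vec_monomial \<alpha> w" c]])
       (auto simp: c sum_distrib_left mult_ac intro: sphere_poly_mult_coord_monomial)
qed

lemma sphere_poly_mono:
  assumes "d \<le> e" "sphere_poly i0 d g"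
  shows "sphere_poly i0 e g"
proof -
  obtain c where c: "\<And>w. norm w = 1 \<Longrightarrow> g w = (\<Sum>\<alpha>\<in>sphere_exponents i0 d. c \<alpha> * vec_monomial \<alpha> w)"
    using assms(2) unfolding sphere_poly_def by metis
  have mono: "\<alpha> \<in> sphere_exponents i0 e" if "\<alpha> \<in> sphere_exponents i0 d" for \<alpha>
    using that assms(1) by (fastforce simp: sphere_exponents_def intro: le_trans)
  show ?thesis
    by (rule sphere_poly_cong[OF sphere_poly_sum[of "sphere_exponents i0 d" i0 e vec_monomial c]])
       (simp_all add: c mono sphere_poly_monomial)
qed

lemma sphere_poly_inner_power: "sphere_poly i0 l (\<lambda>w. (w \<bullet> x) ^ l)"
proof (induction l)
  case 0
  have "(\<lambda>_. 0) \<in> sphere_exponents i0 0" by (simp add: sphere_exponents_def)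
  from sphere_poly_monomial[OF this] show ?case
    by (rule sphere_poly_cong) (simp add: vec_monomial_def)
next
  case (Suc l)
  show ?case
    by (rule sphere_poly_cong[OF sphere_poly_sum[of UNIV i0 "Suc l" "\<lambda>i w. w $ i * (w \<bullet> x) ^ l" "\<lambda>i. x $ i"]])
       (rule sphere_poly_mult_coord[OF Suc], simp add: inner_vec_def sum_distrib_right mult_ac)
qed

lemma vec_monomial_measurable: "vec_monomial \<alpha> \<in> borel_measurable borel"
  unfolding vec_monomial_def
  by (intro borel_measurable_continuous_onI continuous_intros)

lemma vec_monomial_L2:
  fixes \<alpha> :: "'n::finite \<Rightarrow> nat"
  shows "(\<lambda>w. complex_of_real (vec_monomial \<alpha> w)) \<in> L2_space surface_measure"
proof (rule L2_space_bounded[where b=1, OF finite_surface_measure])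
  show "(\<lambda>w. complex_of_real (vec_monomial \<alpha> w)) \<in> borel_measurable surface_measure"
    using measurable_surface_measure[OF vec_monomial_measurable] by measurable
  fix w :: "real ^ 'n" assume "w \<in> space surface_measure"
  then have "\<bar>w $ i\<bar> \<le> 1" for i using component_le_norm_cart[of w i] by simp
  then show "cmod (complex_of_real (vec_monomial \<alpha> w)) \<le> 1"
    unfolding norm_of_real vec_monomial_def abs_prod power_abs
    by (intro prod_le_1) (auto intro: power_le_one)
qed

lemma herglotz_moment_bound:
  fixes f :: "real ^ 'n \<Rightarrow> complex"
  assumes f: "f \<in> L2_space surface_measure" and \<kappa>: "0 < \<kappa>"
    and moments: "\<And>\<alpha>. \<alpha> \<in> sphere_exponents i0 d \<Longrightarrow> (LINT w|surface_measure. of_real (vec_monomial \<alpha> w) * f w) = 0"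
    and x: "norm x < 1"
  shows "(cmod (herglotz_wave \<kappa> f x))\<^sup>2
    \<le> (\<kappa> ^ Suc d / fact (Suc d))\<^sup>2 * (measure surface_measure (sphere (0 :: real ^ 'n) 1) * L2_sqnorm surface_measure f)"
proof -
  let ?S = "surface_measure :: (real ^ 'n) measure"
  interpret S: finite_measure ?S by (rule finite_surface_measure)
  have fi: "integrable ?S f" by (rule L2_L1_bound(1)[OF finite_surface_measure f])
  have [measurable]: "f \<in> borel_measurable ?S" using f by (rule L2_spaceD)
  have [measurable]: "(\<lambda>w. w \<bullet> x) \<in> borel_measurable ?S" by (rule measurable_surface_measure) measurable
  have wx: "\<bar>w \<bullet> x\<bar> \<le> 1" if "w \<in> space ?S" for w
    using Cauchy_Schwarz_ineq2[of w x] that x by simp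
  have mon: "integrable ?S (\<lambda>w. of_real (vec_monomial \<alpha> w) * f w)" for \<alpha>
  proof -
    have "(\<lambda>w. cnj (of_real (vec_monomial \<alpha> w))) \<in> L2_space ?S" using vec_monomial_L2[of \<alpha>] by simp
    from L2_integrable_mult[OF f this] show ?thesis by (simp add: mult.commute)
  qed
  \<comment> \<open>Every power up to \<open>d\<close> reduces on the sphere to the listed
    monomials, so the moment conditions annihilate it.\<close>
  have zero: "integrable ?S (\<lambda>w. of_real ((w \<bullet> x) ^ l) * f w) \<and> (LINT w|?S. of_real ((w \<bullet> x) ^ l) * f w) = 0" if l: "l \<le> d" for l
  proof -
    obtain c where c: "\<And>w. norm w = 1 \<Longrightarrow> (w \<bullet> x) ^ l = (\<Sum>\<alpha>\<in>sphere_exponents i0 d. c \<alpha> * vec_monomial \<alpha> w)"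
      using sphere_poly_mono[OF l sphere_poly_inner_power[of i0 l x]] unfolding sphere_poly_def by blast
    have eq: "of_real ((w \<bullet> x) ^ l) * f w = (\<Sum>\<alpha>\<in>sphere_exponents i0 d. of_real (c \<alpha>) * (of_real (vec_monomial \<alpha> w) * f w))"
      if "w \<in> space ?S" for w
      using that by (subst c) (auto simp: sum_distrib_right mult.assoc)
    have "integrable ?S (\<lambda>w. \<Sum>\<alpha>\<in>sphere_exponents i0 d. of_real (c \<alpha>) * (of_real (vec_monomial \<alpha> w) * f w))"
      by (intro Bochner_Integration.integrable_sum integrable_mult_right mon)
    then have "integrable ?S (\<lambda>w. of_real ((w \<bullet> x) ^ l) * f w)"
      by (simp only: Bochner_Integration.integrable_cong[where f="\<lambda>w. of_real ((w \<bullet> x) ^ l) * f w", OF refl eq])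
    moreover have "(LINT w|?S. of_real ((w \<bullet> x) ^ l) * f w)
        = (LINT w|?S. (\<Sum>\<alpha>\<in>sphere_exponents i0 d. of_real (c \<alpha>) * (of_real (vec_monomial \<alpha> w) * f w)))"
      by (rule Bochner_Integration.integral_cong[OF refl eq])
    then have "(LINT w|?S. of_real ((w \<bullet> x) ^ l) * f w) = 0"
      by (subst (asm) Bochner_Integration.integral_sum) (auto intro!: integrable_mult_right mon simp: moments)
    ultimately show ?thesis by blast
  qed
  \<comment> \<open>The Taylor polynomial of the exponential integrates to 0 against
    \<open>f\<close>, so it may be subtracted; the remainder is then estimated with |w.x| \<le>
    1.\<close>
  define T where "T w = (\<Sum>l\<le>d. (\<i> * complex_of_real (\<kappa> * (w \<bullet> x))) ^ l / fact l)" for w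
  have Tf: "T w * f w = (\<Sum>l\<le>d. ((\<i> * \<kappa>) ^ l / fact l) * (of_real ((w \<bullet> x) ^ l) * f w))" for w
    unfolding T_def sum_distrib_right by (intro sum.cong refl) (simp add: power_mult_distrib)
  have Ti: "integrable ?S (\<lambda>w. T w * f w)" "(LINT w|?S. T w * f w) = 0"
    unfolding Tf using zero
    by (auto intro!: Bochner_Integration.integrable_sum integrable_mult_right simp del: of_real_power)
  have Ei: "integrable ?S (\<lambda>w. iexp (\<kappa> * (w \<bullet> x)) * f w)"
    by (rule Bochner_Integration.integrable_bound[OF fi]) (auto simp: norm_mult)
  have "herglotz_wave \<kappa> f x = (LINT w|?S. iexp (\<kappa> * (w \<bullet> x)) * f w - T w * f w)"
    unfolding herglotz_wave_def using Ei Ti by simp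
  also have "cmod \<dots> \<le> (LINT w|?S. \<kappa> ^ Suc d / fact (Suc d) * cmod (f w))"
  proof (rule norm_integral_le)
    show "integrable ?S (\<lambda>w. iexp (\<kappa> * (w \<bullet> x)) * f w - T w * f w)" using Ei Ti(1) by simp
    show "integrable ?S (\<lambda>w. \<kappa> ^ Suc d / fact (Suc d) * cmod (f w))"
      by (rule integrable_mult_right) (use fi in simp)
    fix w assume w: "w \<in> space ?S"
    have "cmod (iexp (\<kappa> * (w \<bullet> x)) - T w) \<le> \<bar>\<kappa> * (w \<bullet> x)\<bar> ^ Suc d / fact (Suc d)"
      unfolding T_def by (rule iexp_approx1)
    also have "\<dots> \<le> \<kappa> ^ Suc d / fact (Suc d)"
    proof (rule divide_right_mono[OF power_mono])
      show "\<bar>\<kappa> * (w \<bullet> x)\<bar> \<le> \<kappa>" using wx[OF w] \<kappa> by (simp add: abs_mult mult_left_le)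
    qed auto
    finally have "cmod (iexp (\<kappa> * (w \<bullet> x)) - T w) * cmod (f w) \<le> \<kappa> ^ Suc d / fact (Suc d) * cmod (f w)"
      by (rule mult_right_mono) simp
    then show "norm (iexp (\<kappa> * (w \<bullet> x)) * f w - T w * f w) \<le> \<kappa> ^ Suc d / fact (Suc d) * cmod (f w)"
      unfolding left_diff_distrib[symmetric] norm_mult .
  qed
  also have "\<dots> = \<kappa> ^ Suc d / fact (Suc d) * (LINT w|?S. cmod (f w))" by (rule integral_mult_right_zero)
  finally have "(cmod (herglotz_wave \<kappa> f x))\<^sup>2 \<le> (\<kappa> ^ Suc d / fact (Suc d) * (LINT w|?S. cmod (f w)))\<^sup>2"
    by (rule power_mono) simp
  also have "\<dots> = (\<kappa> ^ Suc d / fact (Suc d))\<^sup>2 * (LINT w|?S. cmod (f w))\<^sup>2" by (rule power_mult_distrib)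
  also have "\<dots> \<le> (\<kappa> ^ Suc d / fact (Suc d))\<^sup>2 * (measure ?S (sphere 0 1) * L2_sqnorm ?S f)"
    using L2_L1_bound(2)[OF finite_surface_measure f] by (intro mult_left_mono) auto
  finally show ?thesis .
qed

lemma herglotz_operator_moment_bound:
  fixes f :: "real ^ 'n \<Rightarrow> complex"
  assumes f: "f \<in> L2_space surface_measure" and \<kappa>: "0 < \<kappa>"
    and moments: "\<And>\<alpha>. \<alpha> \<in> sphere_exponents i0 d \<Longrightarrow> (LINT w|surface_measure. of_real (vec_monomial \<alpha> w) * f w) = 0"
  shows "L2_sqnorm unit_ball_measure (herglotz_operator \<kappa> f)
    \<le> \<kappa> ^ (CARD('n) - 1) * ((\<kappa> ^ Suc d / fact (Suc d))\<^sup>2 * (measure surface_measure (sphere (0 :: real ^ 'n) 1) * L2_sqnorm surface_measure f)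
        * measure lborel (ball (0 :: real ^ 'n) 1))"
proof -
  define K where "K = (\<kappa> ^ Suc d / fact (Suc d))\<^sup>2 * (measure surface_measure (sphere (0 :: real ^ 'n) 1) * L2_sqnorm surface_measure f)"
  have mb: "(cmod (herglotz_wave \<kappa> f x))\<^sup>2 \<le> K" if "norm x < 1" for x
    unfolding K_def by (rule herglotz_moment_bound[OF f \<kappa> moments that])
  have fin: "emeasure lborel (ball (0 :: real ^ 'n) 1) < \<infinity>" by (rule emeasure_ball_finite)
  have "(LINT x|lborel. indicator (ball 0 1) x * (cmod (herglotz_wave \<kappa> f x))\<^sup>2)
      \<le> (LINT x|lborel. K * indicator (ball (0 :: real ^ 'n) 1) x)"
  proof (rule integral_mono)
    show "integrable lborel (\<lambda>x. indicator (ball 0 1) x * (cmod (herglotz_wave \<kappa> f x))\<^sup>2)"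
      by (rule herglotz_operator_sqnorm(1)[OF f \<kappa>])
    show "integrable lborel (\<lambda>x. K * indicator (ball (0 :: real ^ 'n) 1) x)"
      using fin by (intro integrable_mult_right integrable_real_indicator) auto
    show "indicator (ball 0 1) x * (cmod (herglotz_wave \<kappa> f x))\<^sup>2 \<le> K * indicator (ball 0 1) x" for x
      using mb[of x] by (simp add: indicator_def)
  qed
  also have "\<dots> = K * measure lborel (ball (0 :: real ^ 'n) 1)" by simp
  finally have le: "(LINT x|lborel. indicator (ball 0 1) x * (cmod (herglotz_wave \<kappa> f x))\<^sup>2)
      \<le> K * measure lborel (ball (0 :: real ^ 'n) 1)" .
  show ?thesis
    unfolding herglotz_operator_sqnorm(2)[OF f \<kappa>] K_def[symmetric]
    by (rule mult_left_mono[OF le]) (use \<kappa> in simp)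
qed

section \<open>Singular values of the Herglotz operator\<close>

lemma power_over_fact_le_exp: "0 \<le> x \<Longrightarrow> x ^ p / fact p \<le> exp (x::real)"
proof -
  assume x: "0 \<le> x"
  have "(\<Sum>i\<in>{p}. inverse (fact i) *\<^sub>R x ^ i) \<le> (\<Sum>i. inverse (fact i) *\<^sub>R x ^ i)"
    by (rule sum_le_suminf[OF summable_exp_generic]) (use x in auto)
  then show ?thesis by (simp add: exp_def field_simps)
qed

text \<open>A single term of the exponential series gives D^D / D! \<le> e^D, and 9 \<ge> e^2 makes
  (1/9)^D e^D at most e^{-D}.\<close>

lemma power_fact_decay:
  fixes \<kappa> :: real
  assumes \<kappa>: "0 \<le> \<kappa>" "9 * \<kappa> \<le> real D"
  shows "\<kappa> ^ D / fact D \<le> exp (- real D)"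
proof -
  have "\<kappa> ^ D / fact D \<le> (real D / 9) ^ D / fact D"
    using \<kappa> by (intro divide_right_mono power_mono) auto
  also have "\<dots> = (1 / 9) ^ D * (real D ^ D / fact D)" by (simp add: power_divide)
  also have "\<dots> \<le> (1 / 9) ^ D * exp (real D)"
    by (intro mult_left_mono power_over_fact_le_exp) auto
  also have "(1 / 9 :: real) ^ D \<le> exp (- 2) ^ D"
  proof (rule power_mono)
    have "exp (2::real) = exp 1 * exp 1" by (simp flip: exp_add)
    also have "\<dots> \<le> 3 * 3" using exp_le by (intro mult_mono) auto
    finally show "1 / 9 \<le> exp (- 2 :: real)" by (simp add: exp_minus field_simps)
  qed simp
  also have "exp (- 2) ^ D * exp (real D) = exp (- real D)"
    by (simp add: exp_of_nat_mult[symmetric] flip: exp_add)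
  finally show ?thesis by simp
qed

lemma measurable_unit_ball_measure: "f \<in> measurable borel X \<Longrightarrow> f \<in> measurable unit_ball_measure X"
  unfolding unit_ball_measure_def by (rule measurable_restrict_space1) simp

lemma space_unit_ball_measure [simp]: "space unit_ball_measure = ball 0 1"
  by (simp add: unit_ball_measure_def space_restrict_space)

definition herglotz_kernel :: "real \<Rightarrow> real ^ 'n \<Rightarrow> real ^ 'n \<Rightarrow> complex" where
  "herglotz_kernel \<kappa> x w = of_real (\<kappa> powr ((real CARD('n) - 1) / 2)) * iexp (\<kappa> * (w \<bullet> x))"

lemma herglotz_operator_kernel: "herglotz_operator \<kappa> = kernel_op surface_measure (herglotz_kernel \<kappa>)"
  by (intro ext) (simp add: herglotz_operator_def herglotz_wave_def kernel_op_def herglotz_kernel_def mult.assoc)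

lemma compact_kernel_operator_herglotz:
  fixes \<kappa> :: real
  assumes \<kappa>: "0 < \<kappa>"
  shows "compact_kernel_operator (surface_measure :: (real ^ 'n) measure) unit_ball_measure (herglotz_kernel \<kappa>)
    (\<kappa> powr ((real CARD('n) - 1) / 2)) (\<kappa> powr ((real CARD('n) - 1) / 2) * \<kappa>)"
proof -
  let ?S = "surface_measure :: (real ^ 'n) measure" and ?B = "unit_ball_measure :: (real ^ 'n) measure"
  let ?c = "\<kappa> powr ((real CARD('n) - 1) / 2)"
  show ?thesis
  proof (intro compact_kernel_operator.intro kernel_operator.intro compact_kernel_operator_axioms.intro)
    show "finite_measure ?S" "finite_measure ?B"
      by (rule finite_surface_measure, rule finite_unit_ball_measure)
    show "compact (space ?S)" by simp
    show "(\<lambda>(x, w). herglotz_kernel \<kappa> x w) \<in> borel_measurable (?B \<Otimes>\<^sub>M ?S)"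
    proof -
      have "(\<lambda>p. (fst p, snd p)) \<in> (?B \<Otimes>\<^sub>M ?S) \<rightarrow>\<^sub>M (borel \<Otimes>\<^sub>M borel)"
        by (intro measurable_Pair measurable_compose[OF measurable_fst] measurable_compose[OF measurable_snd]
            measurable_surface_measure measurable_unit_ball_measure measurable_ident_sets) auto
      moreover have "(\<lambda>p. herglotz_kernel \<kappa> (fst p) (snd p)) \<in> borel_measurable (borel \<Otimes>\<^sub>M borel)"
        unfolding borel_prod herglotz_kernel_def
        by (intro borel_measurable_continuous_onI continuous_intros)
      ultimately show ?thesis by (auto intro: measurable_compose simp: case_prod_beta')
    qed
    show "cmod (herglotz_kernel \<kappa> x w) \<le> ?c" for x w :: "real ^ 'n"
      by (simp add: herglotz_kernel_def norm_mult)
    show "cmod (herglotz_kernel \<kappa> x w - herglotz_kernel \<kappa> x w') \<le> ?c * \<kappa> * norm (w - w')"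
      if "x \<in> space ?B" for x w w' :: "real ^ 'n"
    proof -
      define d where "d = \<kappa> * (w \<bullet> x) - \<kappa> * (w' \<bullet> x)"
      have "iexp (\<kappa> * (w \<bullet> x)) - iexp (\<kappa> * (w' \<bullet> x)) = iexp (\<kappa> * (w' \<bullet> x)) * (iexp d - 1)"
        by (simp add: d_def algebra_simps flip: exp_add)
      then have "cmod (iexp (\<kappa> * (w \<bullet> x)) - iexp (\<kappa> * (w' \<bullet> x))) = cmod (iexp d - 1)"
        by (simp add: norm_mult)
      \<comment> \<open>\<open>iexp_approx1\<close> at order 0 is the bound |e^{id} - 1| \<le>
        |d|.\<close>
      also have "\<dots> \<le> \<bar>d\<bar>" using iexp_approx1[of d 0] by simp
      also have "\<bar>d\<bar> = \<kappa> * \<bar>(w - w') \<bullet> x\<bar>"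
        using \<kappa> by (simp add: d_def abs_mult inner_diff_left flip: right_diff_distrib)
      also have "\<dots> \<le> \<kappa> * (norm (w - w') * norm x)"
        using \<kappa> Cauchy_Schwarz_ineq2[of "w - w'" x] by (intro mult_left_mono) auto
      also have "\<dots> \<le> \<kappa> * norm (w - w')" using \<kappa> that by (simp add: mult_left_le)
      finally have "?c * cmod (iexp (\<kappa> * (w \<bullet> x)) - iexp (\<kappa> * (w' \<bullet> x))) \<le> ?c * (\<kappa> * norm (w - w'))"
        by (intro mult_left_mono) auto
      then show ?thesis
        unfolding herglotz_kernel_def right_diff_distrib[symmetric] norm_mult by (simp add: mult.assoc)
    qed
  qed
qed

lemma herglotz_singular_value_bounded:
  "\<exists>C>0. \<forall>\<kappa>\<ge>1. \<forall>j\<ge>1. herglotz_singular_value TYPE('n::finite) \<kappa> j \<le> C"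
proof -
  obtain C where C: "0 < C" "\<And>\<kappa> f. 1 \<le> \<kappa> \<Longrightarrow> f \<in> L2_space (surface_measure :: (real ^ 'n) measure) \<Longrightarrow>
     L2_sqnorm unit_ball_measure (herglotz_operator \<kappa> f) \<le> C * L2_sqnorm surface_measure f"
    using herglotz_operator_bounded[where ?'n='n] by blast
  have "herglotz_singular_value TYPE('n) \<kappa> j \<le> sqrt C" if \<kappa>: "1 \<le> \<kappa>" and j: "1 \<le> j" for \<kappa> j
  proof -
    interpret compact_kernel_operator "surface_measure :: (real ^ 'n) measure" unit_ball_measure "herglotz_kernel \<kappa>"
      "\<kappa> powr ((real CARD('n) - 1) / 2)" "\<kappa> powr ((real CARD('n) - 1) / 2) * \<kappa>"
      using \<kappa> by (intro compact_kernel_operator_herglotz) simp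
    show ?thesis
      unfolding herglotz_singular_value_def herglotz_operator_kernel
    proof (rule singular_value_le(1))
      fix f :: "nat \<Rightarrow> real ^ 'n \<Rightarrow> complex" assume f: "\<And>i. i < j \<Longrightarrow> f i \<in> L2_space surface_measure"
      have "(\<lambda>w. \<Sum>i<j. 1 * f i w) \<in> L2_space surface_measure" by (rule L2_space_sum) (use f in auto)
      from C(2)[OF \<kappa> this] show "\<exists>c. (\<exists>i<j. c i \<noteq> 0) \<and>
          L2_sqnorm unit_ball_measure (kernel_op surface_measure (herglotz_kernel \<kappa>) (\<lambda>w. \<Sum>i<j. c i * f i w))
          \<le> (sqrt C)\<^sup>2 * L2_sqnorm surface_measure (\<lambda>w. \<Sum>i<j. c i * f i w)"
        using C(1) j unfolding herglotz_operator_kernel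
        by (intro exI[of _ "\<lambda>_. 1"] conjI exI[of _ 0]) auto
    qed (use C in simp)
  qed
  then show ?thesis using C(1) by (intro exI[of _ "sqrt C"]) auto
qed

lemma herglotz_singular_value_lower:
  "\<exists>s>0. \<exists>c0>0. \<forall>\<kappa>\<ge>1. \<forall>j. 1 \<le> j \<longrightarrow> real j \<le> c0 * \<kappa> ^ (CARD('n) - 1) \<longrightarrow>
     s \<le> herglotz_singular_value TYPE('n::finite) \<kappa> j"
proof -
  obtain s c0 where s: "0 < s" "0 < c0" and ex: "\<And>\<kappa>. 1 \<le> \<kappa> \<Longrightarrow> \<exists>N. \<exists>v :: nat \<Rightarrow> real ^ 'n \<Rightarrow> complex. c0 * \<kappa> ^ (CARD('n) - 1) \<le> real N \<and>
     (\<forall>i<N. v i \<in> L2_space surface_measure) \<and>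
     (\<forall>c. (\<exists>i<N. c i \<noteq> 0) \<longrightarrow> 0 < L2_sqnorm surface_measure (\<lambda>w. \<Sum>i<N. c i * v i w)) \<and>
     (\<forall>c. s\<^sup>2 * L2_sqnorm surface_measure (\<lambda>w. \<Sum>i<N. c i * v i w)
        \<le> L2_sqnorm unit_ball_measure (herglotz_operator \<kappa> (\<lambda>w. \<Sum>i<N. c i * v i w)))"
    using herglotz_test_space[where ?'n='n] by blast
  have "s \<le> herglotz_singular_value TYPE('n) \<kappa> j"
    if \<kappa>: "1 \<le> \<kappa>" and j: "1 \<le> j" "real j \<le> c0 * \<kappa> ^ (CARD('n) - 1)" for \<kappa> j
  proof -
    interpret compact_kernel_operator "surface_measure :: (real ^ 'n) measure" unit_ball_measure "herglotz_kernel \<kappa>"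
      "\<kappa> powr ((real CARD('n) - 1) / 2)" "\<kappa> powr ((real CARD('n) - 1) / 2) * \<kappa>"
      using \<kappa> by (intro compact_kernel_operator_herglotz) simp
    obtain N and v :: "nat \<Rightarrow> real ^ 'n \<Rightarrow> complex" where N: "c0 * \<kappa> ^ (CARD('n) - 1) \<le> real N"
      and v: "\<And>i. i < N \<Longrightarrow> v i \<in> L2_space surface_measure"
        "\<And>c. (\<exists>i<N. c i \<noteq> 0) \<Longrightarrow> 0 < L2_sqnorm surface_measure (\<lambda>w. \<Sum>i<N. c i * v i w)"
        "\<And>c. s\<^sup>2 * L2_sqnorm surface_measure (\<lambda>w. \<Sum>i<N. c i * v i w)
          \<le> L2_sqnorm unit_ball_measure (herglotz_operator \<kappa> (\<lambda>w. \<Sum>i<N. c i * v i w))"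
      using ex[OF \<kappa>] by auto
    have "j \<le> N" using j(2) N by linarith
    then show ?thesis
      unfolding herglotz_singular_value_def herglotz_operator_kernel
      using singular_value_ge[OF s(1) v(1,2) v(3)[unfolded herglotz_operator_kernel] j(1)] by blast
  qed
  then show ?thesis using s by blast
qed

text \<open>With more functions than monomials, some nonzero combination has all moments zero, and
  the Taylor remainder bound applies to it.\<close>

lemma herglotz_singular_value_rank:
  fixes \<kappa> :: real
  assumes \<kappa>: "1 \<le> \<kappa>" and j: "2 * (2 * d + 1) ^ (CARD('n::finite) - 1) < j"
  defines "V \<equiv> measure surface_measure (sphere (0 :: real ^ 'n) 1) * measure lborel (ball (0 :: real ^ 'n) 1)"
  shows "herglotz_singular_value TYPE('n) \<kappa> j \<le> sqrt (\<kappa> ^ (CARD('n) - 1) * V) * (\<kappa> ^ Suc d / fact (Suc d))"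
proof -
  let ?S = "surface_measure :: (real ^ 'n) measure"
  let ?s = "sqrt (\<kappa> ^ (CARD('n) - 1) * V) * (\<kappa> ^ Suc d / fact (Suc d))"
  interpret compact_kernel_operator ?S unit_ball_measure "herglotz_kernel \<kappa>"
    "\<kappa> powr ((real CARD('n) - 1) / 2)" "\<kappa> powr ((real CARD('n) - 1) / 2) * \<kappa>"
    using \<kappa> by (intro compact_kernel_operator_herglotz) simp
  have V: "0 \<le> V" by (simp add: V_def)
  \<comment> \<open>Any coordinate can serve as the distinguished variable.\<close>
  obtain i0 :: 'n where True by simp
  have s2: "?s\<^sup>2 = \<kappa> ^ (CARD('n) - 1) * V * (\<kappa> ^ Suc d / fact (Suc d))\<^sup>2"
    unfolding power_mult_distrib using \<kappa> V by simp
  show ?thesis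
    unfolding herglotz_singular_value_def herglotz_operator_kernel
  proof (rule singular_value_le(1))
    show "0 \<le> ?s" using \<kappa> V by (intro mult_nonneg_nonneg) auto
    fix f :: "nat \<Rightarrow> real ^ 'n \<Rightarrow> complex" assume f: "\<And>i. i < j \<Longrightarrow> f i \<in> L2_space ?S"
    have mon: "integrable ?S (\<lambda>w. of_real (vec_monomial \<alpha> w) * f i w)" if "i < j" for i \<alpha>
    proof -
      have "(\<lambda>w. cnj (of_real (vec_monomial \<alpha> w))) \<in> L2_space ?S" using vec_monomial_L2[of \<alpha>] by simp
      from L2_integrable_mult[OF f[OF that] this] show ?thesis by (simp add: mult.commute)
    qed
    define a where "a \<alpha> i = (LINT w|?S. of_real (vec_monomial \<alpha> w) * f i w)" for \<alpha> i
    obtain c where c: "\<exists>i<j. c i \<noteq> 0" "\<forall>\<alpha>\<in>sphere_exponents i0 d. (\<Sum>i<j. a \<alpha> i * c i) = 0"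
      using underdetermined_system[of "sphere_exponents i0 d" j a] sphere_exponents_card[of i0 d] j by auto
    let ?F = "\<lambda>w. \<Sum>i<j. c i * f i w"
    have F: "?F \<in> L2_space ?S" by (rule L2_space_sum) (use f in auto)
    have mom: "(LINT w|?S. of_real (vec_monomial \<alpha> w) * ?F w) = 0" if \<alpha>: "\<alpha> \<in> sphere_exponents i0 d" for \<alpha>
    proof -
      have "(LINT w|?S. of_real (vec_monomial \<alpha> w) * ?F w) = (LINT w|?S. (\<Sum>i<j. c i * (of_real (vec_monomial \<alpha> w) * f i w)))"
        by (simp add: sum_distrib_left mult_ac)
      also have "\<dots> = (\<Sum>i<j. c i * a \<alpha> i)"
        unfolding a_def by (subst Bochner_Integration.integral_sum) (auto intro!: integrable_mult_right mon)
      finally show ?thesis using c(2) \<alpha> by (simp add: mult.commute)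
    qed
    have "L2_sqnorm unit_ball_measure (herglotz_operator \<kappa> ?F)
      \<le> \<kappa> ^ (CARD('n) - 1) * ((\<kappa> ^ Suc d / fact (Suc d))\<^sup>2 * (measure ?S (sphere 0 1) * L2_sqnorm ?S ?F)
        * measure lborel (ball (0 :: real ^ 'n) 1))"
      using \<kappa> by (intro herglotz_operator_moment_bound[OF F _ mom]) auto
    also have "\<dots> = ?s\<^sup>2 * L2_sqnorm ?S ?F" unfolding s2 unfolding V_def by (simp only: mult_ac)
    finally show "\<exists>c. (\<exists>i<j. c i \<noteq> 0) \<and>
        L2_sqnorm unit_ball_measure (kernel_op ?S (herglotz_kernel \<kappa>) (\<lambda>w. \<Sum>i<j. c i * f i w))
        \<le> ?s\<^sup>2 * L2_sqnorm ?S (\<lambda>w. \<Sum>i<j. c i * f i w)"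
      using c(1) unfolding herglotz_operator_kernel by blast
  qed
qed

lemma herglotz_singular_value_decay:
  assumes n2: "2 \<le> CARD('n::finite)"
  shows "\<exists>C>0. \<forall>\<kappa>\<ge>1. \<forall>j. 144 ^ (CARD('n) - 1) * \<kappa> ^ (CARD('n) - 1) \<le> real j \<longrightarrow>
    herglotz_singular_value TYPE('n) \<kappa> j \<le> C * exp (- (1 / 32) * inverse \<kappa> * real j powr (1 / (real CARD('n) - 1)))"
proof -
  define p where "p = CARD('n) - 1"
  have p: "0 < p" "real p = real CARD('n) - 1" using n2 by (auto simp: p_def)
  define V where "V = measure surface_measure (sphere (0 :: real ^ 'n) 1) * measure lborel (ball (0 :: real ^ 'n) 1)"
  have V: "0 \<le> V" by (simp add: V_def)
  \<comment> \<open>The summand 1 makes the constant positive without a lower bound on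
    \<open>V\<close>.\<close>
  define C where "C = sqrt V * (2 ^ p * fact p) + 1"
  have C: "0 < C" using V by (simp add: C_def add_nonneg_pos)
  have "herglotz_singular_value TYPE('n) \<kappa> j \<le> C * exp (- (1 / 32) * inverse \<kappa> * real j powr (1 / real p))"
    if \<kappa>: "1 \<le> \<kappa>" and j: "144 ^ p * \<kappa> ^ p \<le> real j" for \<kappa> :: real and j :: nat
  proof -
    define J where "J = real j powr (1 / real p)"
    have j0: "0 < real j" using j \<kappa> by (smt (verit) zero_less_power mult_pos_pos)
    have J0: "0 < J" using j0 by (simp add: J_def)
    have Jp: "J ^ p = real j"
      using j0 p(1) by (simp add: J_def powr_powr flip: powr_realpow)
    have J: "144 * \<kappa> \<le> J"
    proof (rule ccontr)
      assume "\<not> 144 * \<kappa> \<le> J"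
      then have "J ^ p < (144 * \<kappa>) ^ p" using J0 p(1) by (intro power_strict_mono) auto
      then show False using j by (simp add: Jp power_mult_distrib)
    qed
    \<comment> \<open>From J \<ge> 144 one gets 2 d + 1 \<le> J/8 + 1 \<le> J/4, so there are at
      most 2 (J/4)^p = 2 * 4^{-p} * j < j monomials. At the same time D \<ge> J/16 \<ge> 9\<kappa>,
      as the factorial estimate requires; hence 144 = 9 * 16.\<close>
    define d where "d = nat \<lfloor>J / 16\<rfloor>"
    define D where "D = Suc d"
    have "real d = of_int \<lfloor>J / 16\<rfloor>" using J0 by (simp add: d_def)
    then have d: "real d \<le> J / 16" "J / 16 < real d + 1"
      using floor_correct[of "J / 16"] by linarith+
    have D: "J / 16 \<le> real D" using d by (simp add: D_def)
    have "real (2 * (2 * d + 1) ^ p) \<le> 2 * (J / 4) ^ p"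
      using d J \<kappa> by (auto intro!: power_mono)
    also have "\<dots> = 2 / 4 ^ p * real j" by (simp add: power_divide Jp)
    also have "\<dots> < 1 * real j"
    proof (rule mult_strict_right_mono[OF _ j0])
      have "(4::real) ^ 1 \<le> 4 ^ p" using p(1) by (intro power_increasing) auto
      then show "2 / 4 ^ p < (1::real)" by simp
    qed
    finally have "2 * (2 * d + 1) ^ p < j" by (simp only: mult_1 of_nat_less_iff)
    then have "herglotz_singular_value TYPE('n) \<kappa> j \<le> sqrt (\<kappa> ^ p * V) * (\<kappa> ^ D / fact D)"
      unfolding D_def V_def p_def by (rule herglotz_singular_value_rank[OF \<kappa>])
    also have "\<dots> \<le> (real D ^ p * sqrt V) * exp (- real D)"
    proof (rule mult_mono)
      show "\<kappa> ^ D / fact D \<le> exp (- real D)" using D J \<kappa> by (intro power_fact_decay) auto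
      have k1: "1 \<le> \<kappa> ^ p" using \<kappa> by (rule one_le_power)
      then have "\<kappa> ^ p * 1 \<le> \<kappa> ^ p * \<kappa> ^ p" by (intro mult_left_mono) auto
      then have "sqrt (\<kappa> ^ p) \<le> \<kappa> ^ p" using k1 by (intro real_le_lsqrt) (auto simp: power2_eq_square)
      also have "\<dots> \<le> real D ^ p" using D J \<kappa> by (intro power_mono) auto
      finally show "sqrt (\<kappa> ^ p * V) \<le> real D ^ p * sqrt V"
        unfolding real_sqrt_mult using V by (intro mult_right_mono) auto
    qed (use \<kappa> V in auto)
    \<comment> \<open>Half of the exponential decay is spent on absorbing the polynomial factor
      D^p.\<close>
    also have "\<dots> \<le> (2 ^ p * fact p * exp (real D / 2) * sqrt V) * exp (- real D)"
    proof -
      have "(real D / 2) ^ p / fact p \<le> exp (real D / 2)" by (rule power_over_fact_le_exp) simp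
      then have "real D ^ p \<le> 2 ^ p * fact p * exp (real D / 2)" by (simp add: power_divide field_simps)
      then show ?thesis using V by (intro mult_right_mono) auto
    qed
    also have "\<dots> = sqrt V * (2 ^ p * fact p) * (exp (real D / 2) * exp (- real D))" by (simp only: mult_ac)
    also have "exp (real D / 2) * exp (- real D) = exp (- real D / 2)" by (simp flip: exp_add)
    also have "sqrt V * (2 ^ p * fact p) * exp (- real D / 2) \<le> C * exp (- real D / 2)"
      by (intro mult_right_mono) (auto simp: C_def)
    \<comment> \<open>The remaining exponent satisfies D/2 \<ge> J/32, whence the constant 1/32;
      inserting 1/\<kappa> \<le> 1 only enlarges the right-hand side.\<close>
    also have "\<dots> \<le> C * exp (- (1 / 32) * inverse \<kappa> * J)"
    proof -
      have "inverse \<kappa> * J \<le> 1 * J" using \<kappa> J0 by (intro mult_right_mono) (auto simp: inverse_le_1_iff)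
      then have "- real D / 2 \<le> - (1 / 32) * inverse \<kappa> * J" using D unfolding mult.assoc by linarith
      then show ?thesis using C by simp
    qed
    finally show ?thesis by (simp add: J_def)
  qed
  then show ?thesis using C p(2) unfolding p_def by (intro exI[of _ C]) auto
qed

theorem theorem1p1:
  assumes "CARD('n::finite) \<ge> 2"
  shows "\<exists>c c0 C0 C :: real. c > 0 \<and> c0 > 0 \<and> C0 > 0 \<and> C > 0 \<and>
    (\<forall>\<kappa>::real. \<kappa> \<ge> 1 \<longrightarrow>
      (\<forall>j::nat. 1 \<le> j \<and> real j \<le> c0 * \<kappa> ^ (CARD('n) - 1) \<longrightarrow>
         inverse C \<le> herglotz_singular_value TYPE('n) \<kappa> j \<and>
         herglotz_singular_value TYPE('n) \<kappa> j \<le> C) \<and>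
      (\<forall>j::nat. real j \<ge> C0 * \<kappa> ^ (CARD('n) - 1) \<longrightarrow>
         herglotz_singular_value TYPE('n) \<kappa> j
           \<le> C * exp (- c * inverse \<kappa> * real j powr (1 / (real CARD('n) - 1)))))"
proof -
  obtain C1 where C1: "0 < C1" "\<And>\<kappa> j. 1 \<le> \<kappa> \<Longrightarrow> 1 \<le> j \<Longrightarrow> herglotz_singular_value TYPE('n) \<kappa> j \<le> C1"
    using herglotz_singular_value_bounded[where ?'n='n] by blast
  obtain s c0 where s: "0 < s" "0 < c0" "\<And>\<kappa> j. 1 \<le> \<kappa> \<Longrightarrow> 1 \<le> j \<Longrightarrow> real j \<le> c0 * \<kappa> ^ (CARD('n) - 1) \<Longrightarrow>
      s \<le> herglotz_singular_value TYPE('n) \<kappa> j"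
    using herglotz_singular_value_lower[where ?'n='n] by blast
  obtain C2 where C2: "0 < C2" "\<And>\<kappa> j. 1 \<le> \<kappa> \<Longrightarrow> 144 ^ (CARD('n) - 1) * \<kappa> ^ (CARD('n) - 1) \<le> real j \<Longrightarrow>
      herglotz_singular_value TYPE('n) \<kappa> j \<le> C2 * exp (- (1 / 32) * inverse \<kappa> * real j powr (1 / (real CARD('n) - 1)))"
    using herglotz_singular_value_decay[OF assms] by blast
  \<comment> \<open>One constant serves as plateau bound from both sides and as prefactor of the
    decay, hence the maximum.\<close>
  define C where "C = max (max C1 C2) (inverse s)"
  have C: "0 < C" "C1 \<le> C" "C2 \<le> C" using C1(1) by (auto simp: C_def)
  have "inverse s \<le> C" by (simp add: C_def)
  then have sC: "inverse C \<le> s" using s(1) by (metis inverse_inverse_eq le_imp_inverse_le positive_imp_inverse_positive)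
  show ?thesis
  proof (rule exI[of _ "1 / 32"], rule exI[of _ c0], rule exI[of _ "144 ^ (CARD('n) - 1)"], rule exI[of _ C],
      intro conjI allI impI)
    fix \<kappa> :: real and j :: nat
    assume \<kappa>: "1 \<le> \<kappa>"
    show "inverse C \<le> herglotz_singular_value TYPE('n) \<kappa> j" "herglotz_singular_value TYPE('n) \<kappa> j \<le> C"
      if "1 \<le> j \<and> real j \<le> c0 * \<kappa> ^ (CARD('n) - 1)"
      using s(3)[OF \<kappa>, of j] C1(2)[OF \<kappa>, of j] that sC C(2) by auto
    assume j: "144 ^ (CARD('n) - 1) * \<kappa> ^ (CARD('n) - 1) \<le> real j"
    show "herglotz_singular_value TYPE('n) \<kappa> j
        \<le> C * exp (- (1 / 32) * inverse \<kappa> * real j powr (1 / (real CARD('n) - 1)))"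
      by (rule order_trans[OF C2(2)[OF \<kappa> j] mult_right_mono[OF C(3)]]) simp
  qed (use C s in auto)
qed

end
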